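(* Let $(V,\omega)$ be a $2n$-dimensional real symplectic space, $L_1,L_2,L_3\in\Lambda(V,\omega)$, $\psi:[0,T]\to\mathrm{Sp}(V,\omega)$ of class $\mathscr C^1$ with $\psi(0)=\mathrm{Id}$, and $\ell_i(t)=\psi(t)L_i$ for $i=1,2$. Let $k\in\mathbb N$ and assume: (1) $\ell_2$ is an $L_3$-plus curve; (2) $\iota(L_1,L_2,L_3)=n-\dim(L_1\cap L_2)$; (3) $\dim(L_3\cap L_2)=k$; (4) $\iota^{\mathrm{CLM}}(L_3,\ell_1(t);t\in[0,T])=k$. Then $\iota^{\mathrm{CLM}}(L_3,\ell_2(t);t\in[0,T])=k$.
   Context: $\Lambda(V,\omega)$ is the Lagrangian Grassmannian of $(V,\omega)$. For $L_0\in\Lambda(V,\omega)$ and a continuous path $\ell:[a,b]\to\Lambda(V,\omega)$, $\iota^{\mathrm{CLM}}(L_0,\ell(t);t\in[a,b])\in\mathbb Z$ denotes the Cappell–Lee–Miller Maslov index: the intersection index of $\ell$ with the Maslov cycle $\Sigma(L_0)=\{L: L\cap L_0\neq\{0\}\}$; it is invariant under fixed-endpoint homotopies, additive under concatenation, and for $\mathscr C^1$ paths with only regular crossings equals $n_+(\Gamma(\ell,L_0,a))+\sum_{a<t<b}\operatorname{sgn}\Gamma(\ell,L_0,t)-n_-(\Gamma(\ell,L_0,b))$, where a crossing is $t_0$ with $\ell(t_0)\cap L_0\ne\{0\}$, the crossing form on $\ell(t_0)\cap L_0$ is $\Gamma(\ell,L_0,t_0)[v]=\frac{d}{dt}|_{t=t_0}\omega(v,w(t))$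 with $w(t)$ the unique vector in a fixed Lagrangian $W$ transversal to $\ell(t_0)$ such that $v+w(t)\in\ell(t)$, and regular means nondegenerate. A $\mathscr C^1$ curve $\ell$ is an $L_0$-plus curve if at each crossing the crossing form is positive definite. Triple index: for $\alpha,\beta,\gamma\in\Lambda(V,\omega)$ let $Q(\alpha,\beta;\gamma)$ be the quadratic form on $\alpha\cap(\beta+\gamma)$ given by $Q(\alpha,\beta;\gamma)(x)=\omega(y,z)$ where $x=y+z$ with $y\in\beta$, $z\in\gamma$ (independent of the decomposition); then $\iota(\alpha,\beta,\gamma)=n_+\big(Q(\alpha,\beta;\gamma)\big)+\dim(\alpha\cap\gamma)-\dim(\alpha\cap\beta\cap\gamma)$, where $n_+$ is the positive inertia index. *)

theory Defs
  imports "HOL-Analysis.Analysis"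
begin

text \<open>The symplectic space V is modelled as a Euclidean space type 'v (finite dimensional
real vector space; the inner product is only used to topologize the Lagrangian Grassmannian).\<close>

definition symplectic_form :: "('v::euclidean_space \<Rightarrow> 'v \<Rightarrow> real) \<Rightarrow> bool" where
  "symplectic_form \<omega> \<longleftrightarrow> bilinear \<omega> \<and> (\<forall>x y. \<omega> x y = - \<omega> y x)
     \<and> (\<forall>x. (\<forall>y. \<omega> x y = 0) \<longrightarrow> x = 0)"

definition lagrangian :: "('v::euclidean_space \<Rightarrow> 'v \<Rightarrow> real) \<Rightarrow> 'v set \<Rightarrow> bool" where
  "lagrangian \<omega> L \<longleftrightarrow> subspace L \<and> (\<forall>x\<in>L. \<forall>y\<in>L. \<omega> x y = 0) \<and> 2 * dim L = DIM('v)"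

definition symplectic_map :: "('v::euclidean_space \<Rightarrow> 'v \<Rightarrow> real) \<Rightarrow> ('v \<Rightarrow>\<^sub>L 'v) \<Rightarrow> bool" where
  "symplectic_map \<omega> A \<longleftrightarrow> bij (blinfun_apply A) \<and> (\<forall>x y. \<omega> (A x) (A y) = \<omega> x y)"

definition pos_index :: "('v::euclidean_space \<Rightarrow> real) \<Rightarrow> 'v set \<Rightarrow> nat" where
  "pos_index q S = Max {dim U | U. subspace U \<and> U \<subseteq> S \<and> (\<forall>u\<in>U. u \<noteq> 0 \<longrightarrow> q u > 0)}"

definition neg_index :: "('v::euclidean_space \<Rightarrow> real) \<Rightarrow> 'v set \<Rightarrow> nat" where
  "neg_index q S = pos_index (\<lambda>x. - q x) S"

definition qf_signature :: "('v::euclidean_space \<Rightarrow> real) \<Rightarrow> 'v set \<Rightarrow> int" where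
  "qf_signature q S = int (pos_index q S) - int (neg_index q S)"

definition qf_nondegenerate :: "('v::euclidean_space \<Rightarrow> real) \<Rightarrow> 'v set \<Rightarrow> bool" where
  "qf_nondegenerate q S \<longleftrightarrow> (\<forall>u\<in>S. (\<forall>v\<in>S. q (u + v) - q u - q v = 0) \<longrightarrow> u = 0)"

definition qf_pos_def :: "('v::euclidean_space \<Rightarrow> real) \<Rightarrow> 'v set \<Rightarrow> bool" where
  "qf_pos_def q S \<longleftrightarrow> (\<forall>u\<in>S. u \<noteq> 0 \<longrightarrow> q u > 0)"

definition triple_Q :: "('v::euclidean_space \<Rightarrow> 'v \<Rightarrow> real) \<Rightarrow> 'v set \<Rightarrow> 'v set \<Rightarrow> 'v \<Rightarrow> real" where
  "triple_Q \<omega> \<beta> \<gamma> x = (let (y, z) = (SOME (y, z). y \<in> \<beta> \<and> z \<in> \<gamma> \<and> x = y + z) in \<omega> y z)"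

definition triple_index :: "('v::euclidean_space \<Rightarrow> 'v \<Rightarrow> real) \<Rightarrow> 'v set \<Rightarrow> 'v set \<Rightarrow> 'v set \<Rightarrow> int" where
  "triple_index \<omega> \<alpha> \<beta> \<gamma> =
     int (pos_index (triple_Q \<omega> \<beta> \<gamma>) (\<alpha> \<inter> {y + z | y z. y \<in> \<beta> \<and> z \<in> \<gamma>}))
     + int (dim (\<alpha> \<inter> \<gamma>)) - int (dim (\<alpha> \<inter> \<beta> \<inter> \<gamma>))"

text \<open>Hausdorff distance of the closed unit balls of two subspaces (the gap metric).\<close>
definition subspace_dist :: "'v::euclidean_space set \<Rightarrow> 'v set \<Rightarrow> real" where
  "subspace_dist L M = max (SUP x\<in>L \<inter> cball 0 1. infdist x M) (SUP y\<in>M \<inter> cball 0 1. infdist y L)"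

definition subspace_continuous_on :: "'a::metric_space set \<Rightarrow> ('a \<Rightarrow> 'v::euclidean_space set) \<Rightarrow> bool" where
  "subspace_continuous_on S H \<longleftrightarrow>
     (\<forall>p\<in>S. \<forall>e>0. \<exists>d>0. \<forall>q\<in>S. dist q p < d \<longrightarrow> subspace_dist (H q) (H p) < e)"

definition lag_path :: "('v::euclidean_space \<Rightarrow> 'v \<Rightarrow> real) \<Rightarrow> (real \<Rightarrow> 'v set) \<Rightarrow> real \<Rightarrow> real \<Rightarrow> bool" where
  "lag_path \<omega> l a b \<longleftrightarrow> (\<forall>t\<in>{a..b}. lagrangian \<omega> (l t)) \<and> subspace_continuous_on {a..b} l"

definition lag_homotopic :: "('v::euclidean_space \<Rightarrow> 'v \<Rightarrow> real) \<Rightarrow> real \<Rightarrow> real \<Rightarrow> (real \<Rightarrow> 'v set) \<Rightarrow> (real \<Rightarrow> 'v set) \<Rightarrow> bool" where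
  "lag_homotopic \<omega> a b l l' \<longleftrightarrow> (\<exists>H :: real \<times> real \<Rightarrow> 'v set.
      (\<forall>p\<in>{0..1} \<times> {a..b}. lagrangian \<omega> (H p))
    \<and> subspace_continuous_on ({0..1} \<times> {a..b}) H
    \<and> (\<forall>t\<in>{a..b}. H (0, t) = l t \<and> H (1, t) = l' t)
    \<and> (\<forall>s\<in>{0..1}. H (s, a) = l a \<and> H (s, b) = l b))"

definition C1_on_interval :: "real \<Rightarrow> real \<Rightarrow> (real \<Rightarrow> 'a::real_normed_vector) \<Rightarrow> bool" where
  "C1_on_interval a b f \<longleftrightarrow> (\<exists>f'. (\<forall>t\<in>{a..b}. (f has_vector_derivative f' t) (at t within {a..b}))
      \<and> continuous_on {a..b} f')"

definition lag_C1 :: "('v::euclidean_space \<Rightarrow> 'v \<Rightarrow> real) \<Rightarrow> (real \<Rightarrow> 'v set) \<Rightarrow> real \<Rightarrow> real \<Rightarrow> bool" where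
  "lag_C1 \<omega> l a b \<longleftrightarrow> (\<forall>t\<in>{a..b}. lagrangian \<omega> (l t)) \<and>
     (\<exists>F :: real \<Rightarrow> nat \<Rightarrow> 'v. (\<forall>t\<in>{a..b}. l t = span (F t ` {..<DIM('v) div 2}))
        \<and> (\<forall>i. C1_on_interval a b (\<lambda>t. F t i)))"

definition crossing_form :: "('v::euclidean_space \<Rightarrow> 'v \<Rightarrow> real) \<Rightarrow> (real \<Rightarrow> 'v set) \<Rightarrow> 'v set \<Rightarrow> real \<Rightarrow> real \<Rightarrow> real \<Rightarrow> 'v \<Rightarrow> real" where
  "crossing_form \<omega> l L0 a b t0 v =
     (let W = (SOME W. lagrangian \<omega> W \<and> W \<inter> l t0 = {0});
          w = (\<lambda>t. THE w. w \<in> W \<and> v + w \<in> l t)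
      in THE D. ((\<lambda>t. \<omega> v (w t)) has_real_derivative D) (at t0 within {a..b}))"

definition is_crossing :: "(real \<Rightarrow> 'v::euclidean_space set) \<Rightarrow> 'v set \<Rightarrow> real \<Rightarrow> bool" where
  "is_crossing l L0 t \<longleftrightarrow> l t \<inter> L0 \<noteq> {0}"

definition regular_crossings :: "('v::euclidean_space \<Rightarrow> 'v \<Rightarrow> real) \<Rightarrow> (real \<Rightarrow> 'v set) \<Rightarrow> 'v set \<Rightarrow> real \<Rightarrow> real \<Rightarrow> bool" where
  "regular_crossings \<omega> l L0 a b \<longleftrightarrow> (\<forall>t\<in>{a..b}. is_crossing l L0 t \<longrightarrow>
      qf_nondegenerate (crossing_form \<omega> l L0 a b t) (l t \<inter> L0))"

definition plus_curve :: "('v::euclidean_space \<Rightarrow> 'v \<Rightarrow> real) \<Rightarrow> (real \<Rightarrow> 'v set) \<Rightarrow> 'v set \<Rightarrow> real \<Rightarrow> real \<Rightarrow> bool" where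
  "plus_curve \<omega> l L0 a b \<longleftrightarrow> lag_C1 \<omega> l a b \<and> (\<forall>t\<in>{a..b}. is_crossing l L0 t \<longrightarrow>
      qf_pos_def (crossing_form \<omega> l L0 a b t) (l t \<inter> L0))"

definition maslov_regular :: "('v::euclidean_space \<Rightarrow> 'v \<Rightarrow> real) \<Rightarrow> 'v set \<Rightarrow> (real \<Rightarrow> 'v set) \<Rightarrow> real \<Rightarrow> real \<Rightarrow> int" where
  "maslov_regular \<omega> L0 l a b =
     int (pos_index (crossing_form \<omega> l L0 a b a) (l a \<inter> L0))
     + (\<Sum>t\<in>{t. a < t \<and> t < b \<and> is_crossing l L0 t}. qf_signature (crossing_form \<omega> l L0 a b t) (l t \<inter> L0))
     - int (neg_index (crossing_form \<omega> l L0 a b b) (l b \<inter> L0))"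

text \<open>Cappell--Lee--Miller index of a continuous path: the crossing formula of any C^1 path with
only regular crossings homotopic to it with fixed endpoints (well defined by homotopy invariance).\<close>
definition iota_CLM :: "('v::euclidean_space \<Rightarrow> 'v \<Rightarrow> real) \<Rightarrow> 'v set \<Rightarrow> (real \<Rightarrow> 'v set) \<Rightarrow> real \<Rightarrow> real \<Rightarrow> int" where
  "iota_CLM \<omega> L0 l a b = (THE m. \<exists>l'. lag_C1 \<omega> l' a b \<and> regular_crossings \<omega> l' L0 a b
       \<and> lag_homotopic \<omega> a b l l' \<and> m = maslov_regular \<omega> L0 l' a b)"

end

theory Submission
  imports Defs
begin

text \<open>
  Fix a Lagrangian \<open>C\<close>. If \<open>W\<close> is transversal to \<open>L\<close>, let \<open>chart_index C W L\<close> be the positive index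
  on \<open>C\<close> of \<open>x \<mapsto> \<omega> x (P x)\<close>, where \<open>P\<close> projects onto \<open>L\<close> along \<open>W\<close>. A cocycle identity relates the
  chart indices of two Lagrangians, their triple index with \<open>C\<close>, and a form whose nullity does not
  involve \<open>C\<close>. It shows that two chart indices differ by a locally constant function of \<open>L\<close>, so they
  glue along paths and homotopies to an integer primitive. At a regular crossing the primitive jumps
  by the indices of the crossing form, hence the crossing formula is the increment of the primitive
  and is invariant under homotopy. Every path \<open>\<psi> t ` L\<close> has a regular representative, obtained by
  rotating it with a compatible complex structure.

  The same cocycle identity shows that the indices of \<open>\<psi> t ` L1\<close> and \<open>\<psi> t ` L2\<close> differ by the change
  of the triple index between the endpoints. The triple index is maximal at \<open>t = 0\<close>, so the index of
  the second path is at most \<open>k\<close>. It is at least \<open>k\<close>, because the path is a plus curve that starts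
  with a \<open>k\<close>-dimensional crossing.
\<close>

subsection \<open>Quadratic forms on subspaces\<close>

text \<open>\<open>iota_CLM\<close> is a definite description, so hypothesis (4) carries no
  information until two facts are known: a regular representative exists, and all of them yield the
  same number. The second is the obstacle, because a homotopy between regular paths may pass through
  degenerate crossings, where the crossing formula says nothing. Primitives involve no derivative,
  so they survive along the whole homotopy, and the crossing formula has to be compared with them
  only on one regular path at a time.

  All local constancy rests on inertia with constant nullity. For two charts \<open>W\<close>,
  \<open>W'\<close> of a moving Lagrangian the nullity is governed by \<open>W \<inter> W'\<close>,
  which does not move. For the two paths of the theorem it is governed by the intersection of the
  two moving Lagrangians, the image of \<open>L1 \<inter> L2\<close> under an injective map, whose
  dimension does not move either. This is where it matters that both paths come from the same
  \<psi>.\<close>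

abbreviation sum_space :: "'a::euclidean_space set \<Rightarrow> 'a set \<Rightarrow> 'a set" where
  "sum_space S T \<equiv> {x + y | x y. x \<in> S \<and> y \<in> T}"

abbreviation form_index :: "('a::euclidean_space \<Rightarrow> 'a \<Rightarrow> real) \<Rightarrow> 'a set \<Rightarrow> nat" where
  "form_index B S \<equiv> pos_index (\<lambda>x. B x x) S"

section \<open>Dimension counts for linear maps and bilinear forms\<close>

lemma sum_space_subset:
  "subspace Z \<Longrightarrow> S \<subseteq> Z \<Longrightarrow> T \<subseteq> Z \<Longrightarrow> sum_space S T \<subseteq> Z"
proof
  fix z assume Z: "subspace Z" "S \<subseteq> Z" "T \<subseteq> Z" and "z \<in> sum_space S T"
  then obtain x y where "z = x + y" "x \<in> S" "y \<in> T" by blast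
  then show "z \<in> Z" using Z by (auto intro: subspace_add)
qed

lemma dim_independent_sum_le:
  fixes S T E :: "'a::euclidean_space set"
  assumes "subspace S" "subspace T" "subspace E" "S \<subseteq> E" "T \<subseteq> E" "S \<inter> T \<subseteq> {0}"
  shows "dim S + dim T \<le> dim E"
proof -
  have "dim (sum_space S T) + dim (S \<inter> T) = dim S + dim T"
    using assms by (intro dim_sums_Int)
  moreover have "dim (S \<inter> T) = 0" using assms(6) by (simp add: dim_eq_0)
  moreover have "sum_space S T \<subseteq> E" using assms by (auto intro: subspace_add)
  ultimately show ?thesis using dim_subset[of "sum_space S T" E] by linarith
qed

text \<open>On the orthogonal complement of the kernel inside \<open>S\<close> the map is injective
  and still has the full image, which gives rank-nullity for a map restricted to a subspace.\<close>

lemma dim_kernel_image: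
  fixes f :: "'a::euclidean_space \<Rightarrow> 'b::euclidean_space"
  assumes f: "linear f" and S: "subspace S"
  shows "dim (f ` S) + dim {x\<in>S. f x = 0} = dim S"
proof -
  let ?K = "{x\<in>S. f x = 0}"
  have K: "subspace ?K"
    using S f by (auto simp: subspace_def linear_add linear_scale linear_0)
  define S' where "S' = {y\<in>S. \<forall>x\<in>?K. orthogonal x y}"
  have S': "subspace S'"
    using S unfolding S'_def subspace_def orthogonal_def
    by (auto simp: inner_right_distrib)
  have d: "dim S' + dim ?K = dim S"
    unfolding S'_def by (rule dim_subspace_orthogonal_to_vectors[OF K S]) auto
  have inj: "inj_on f S'"
  proof (subst linear_inj_on_iff_eq_0[OF f S'], safe)
    fix x assume "x \<in> S'" "f x = 0"
    then show "x = 0" by (auto simp: S'_def orthogonal_def)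
  qed
  have im: "f ` S' = f ` S"
  proof (intro equalityI subsetI)
    fix y assume "y \<in> f ` S"
    then obtain x where x: "x \<in> S" "y = f x" by auto
    obtain k z where kz: "k \<in> span ?K" "\<And>w. w \<in> span ?K \<Longrightarrow> orthogonal z w" "x = k + z"
      using orthogonal_subspace_decomp_exists[of ?K x] by blast
    have k: "k \<in> ?K" using kz(1) unfolding span_eq_iff[THEN iffD2, OF K] .
    have z: "z = x - k" using kz by simp
    have "z \<in> S" using k x S by (auto simp: z subspace_diff)
    moreover have "orthogonal w z" if "w \<in> ?K" for w
      using kz(2)[OF span_base[OF that]] by (simp add: orthogonal_commute)
    ultimately have "z \<in> S'" by (auto simp: S'_def)
    moreover have "f z = y" using k x by (simp add: z linear_diff[OF f])
    ultimately show "y \<in> f ` S'" by auto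
  qed (auto simp: S'_def)
  have "dim (f ` S') = dim S'"
    using dim_image_eq[OF f, of S'] inj S' by (metis span_eq_iff)
  then show ?thesis using d im by simp
qed

text \<open>An orthonormal basis of \<open>S\<close> represents the functional \<open>B u\<close> on
  \<open>S\<close> by a vector \<open>T u\<close>. The annihilator of \<open>U\<close> in
  \<open>S\<close> is then the orthogonal complement of the image of \<open>U\<close> under
  \<open>T\<close>, and rank-nullity for \<open>T\<close> accounts for the vectors of
  \<open>U\<close> that annihilate \<open>S\<close>.\<close>

lemma dim_annihilator:
  fixes B :: "'a::euclidean_space \<Rightarrow> 'b::euclidean_space \<Rightarrow> real"
  assumes B: "bilinear B" and U: "subspace U" and S: "subspace S"
  shows "dim {x\<in>S. \<forall>u\<in>U. B u x = 0} + dim U = dim S + dim {u\<in>U. \<forall>x\<in>S. B u x = 0}"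
proof -
  obtain Bs where Bs: "Bs \<subseteq> S" "pairwise orthogonal Bs" "\<And>x. x \<in> Bs \<Longrightarrow> norm x = 1"
    "independent Bs" "card Bs = dim S" "span Bs = S"
    using orthonormal_basis_subspace[OF S] by metis
  have fin: "finite Bs" using Bs(4) independent_imp_finite by blast
  define T where "T u = (\<Sum>b\<in>Bs. B u b *\<^sub>R b)" for u
  have linB: "linear (B u)" "linear (\<lambda>u. B u x)" for u x
    using B by (auto simp: bilinear_def)
  have linT: "linear T"
    unfolding T_def
    by (intro linear_compose_sum ballI linearI)
       (auto simp: linear_add[OF linB(2)] linear_scale[OF linB(2)] scaleR_add_left)
  have TS: "T u \<in> S" for u
    unfolding T_def using Bs(1) S by (intro subspace_sum) (auto intro: subspace_scale)
  have Tb: "T u \<bullet> b = B u b" if b: "b \<in> Bs" for u b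
  proof -
    have "T u \<bullet> b = (\<Sum>c\<in>Bs. B u c * (c \<bullet> b))"
      unfolding T_def by (simp add: inner_sum_left)
    also have "\<dots> = (\<Sum>c\<in>Bs. if c = b then B u b else 0)"
    proof (rule sum.cong[OF refl])
      fix c assume c: "c \<in> Bs"
      show "B u c * (c \<bullet> b) = (if c = b then B u b else 0)"
        using Bs(2) Bs(3)[OF b] c b by (auto simp: pairwise_def orthogonal_def norm_eq_1)
    qed
    also have "\<dots> = B u b" using fin b by simp
    finally show ?thesis .
  qed
  have Tx: "T u \<bullet> x = B u x" if "x \<in> S" for u x
  proof -
    have "x \<in> span Bs" using that Bs by simp
    then show ?thesis
      by (induction rule: span_induct_alt)
         (auto simp: linear_0[OF linB(1)] linear_add[OF linB(1)] linear_scale[OF linB(1)]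
            Tb inner_add_right)
  qed
  have sTU: "subspace (T ` U)" using linT U by (rule linear_subspace_image)
  have "dim {y\<in>S. \<forall>x\<in>T ` U. orthogonal x y} + dim (T ` U) = dim S"
    using TS by (intro dim_subspace_orthogonal_to_vectors sTU S) auto
  moreover have "{y\<in>S. \<forall>x\<in>T ` U. orthogonal x y} = {x\<in>S. \<forall>u\<in>U. B u x = 0}"
    by (auto simp: orthogonal_def Tx)
  moreover have "{u\<in>U. T u = 0} = {u\<in>U. \<forall>x\<in>S. B u x = 0}"
  proof (intro Collect_cong conj_cong refl iffI ballI)
    fix u assume "\<forall>x\<in>S. B u x = 0"
    then have "T u \<bullet> T u = 0" using TS Tx by simp
    then show "T u = 0" by simp
  next
    fix u x assume "T u = 0" "x \<in> S"
    then show "B u x = 0" using Tx[of x u] by simp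
  qed
  ultimately show ?thesis using dim_kernel_image[OF linT U] by simp
qed

section \<open>Maximal positive subspaces\<close>

lemma pos_index_set_finite:
  "finite {dim U | U. subspace U \<and> U \<subseteq> S \<and> (\<forall>u\<in>U. u \<noteq> 0 \<longrightarrow> q u > (0::real))}"
  for S :: "'a::euclidean_space set"
  by (rule finite_subset[of _ "{..DIM('a)}"]) (auto simp: dim_subset_UNIV)

lemma pos_index_ge:
  assumes "subspace U" "U \<subseteq> S" "\<And>u. u \<in> U \<Longrightarrow> u \<noteq> 0 \<Longrightarrow> q u > 0"
  shows "dim U \<le> pos_index q S"
  unfolding pos_index_def using assms by (intro Max_ge pos_index_set_finite) auto

lemma pos_index_attained:
  assumes "0 \<in> S"
  obtains U where "subspace U" "U \<subseteq> S" "\<And>u. u \<in> U \<Longrightarrow> u \<noteq> 0 \<Longrightarrow> q u > 0" "dim U = pos_index q S"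
proof -
  let ?A = "{dim U | U. subspace U \<and> U \<subseteq> S \<and> (\<forall>u\<in>U. u \<noteq> 0 \<longrightarrow> q u > (0::real))}"
  have "dim {0::'a} \<in> ?A" using assms by (intro CollectI exI[of _ "{0}"]) auto
  then have "Max ?A \<in> ?A" by (intro Max_in pos_index_set_finite) auto
  then show ?thesis using that unfolding pos_index_def by auto
qed

lemma pos_index_cong:
  assumes "\<And>x. x \<in> S \<Longrightarrow> q x = q' x"
  shows "pos_index q S = pos_index q' S"
proof -
  have "(subspace U \<and> U \<subseteq> S \<and> (\<forall>u\<in>U. u \<noteq> 0 \<longrightarrow> q u > 0)) \<longleftrightarrow>
    (subspace U \<and> U \<subseteq> S \<and> (\<forall>u\<in>U. u \<noteq> 0 \<longrightarrow> q' u > 0))" for U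
    using assms by (auto simp: subset_iff)
  then show ?thesis unfolding pos_index_def by simp
qed

lemma neg_index_cong:
  assumes "\<And>x. x \<in> S \<Longrightarrow> q x = q' x"
  shows "neg_index q S = neg_index q' S"
  unfolding neg_index_def using assms by (intro pos_index_cong) auto

text \<open>A positive subspace meets a nonpositive one only in 0. The function \<open>q\<close> is
  arbitrary because the bound is also applied to \<open>triple_Q\<close> and to crossing forms,
  which are not given as bilinear forms.\<close>

lemma pos_index_add_nonpos_le:
  assumes S: "subspace S" and V: "subspace V" "V \<subseteq> S" "\<And>v. v \<in> V \<Longrightarrow> q v \<le> 0"
  shows "pos_index q S + dim V \<le> dim S"
proof -
  obtain U where U: "subspace U" "U \<subseteq> S" "\<And>u. u \<in> U \<Longrightarrow> u \<noteq> 0 \<Longrightarrow> q u > 0" "dim U = pos_index q S"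
    using pos_index_attained[of S q] subspace_0[OF S] by blast
  have "U \<inter> V \<subseteq> {0}" using U(3) V(3) by force
  then show ?thesis using dim_independent_sum_le[OF U(1) V(1) S U(2) V(2)] U(4) by simp
qed

lemma pos_index_eqI:
  assumes "subspace S" "subspace U" "U \<subseteq> S" "\<And>u. u \<in> U \<Longrightarrow> u \<noteq> 0 \<Longrightarrow> q u > 0"
    and "subspace V" "V \<subseteq> S" "\<And>v. v \<in> V \<Longrightarrow> q v \<le> 0" "dim S \<le> dim U + dim V"
  shows "pos_index q S = dim U"
proof -
  have "dim U \<le> pos_index q S" using assms by (intro pos_index_ge)
  moreover have "pos_index q S + dim V \<le> dim S" using assms by (intro pos_index_add_nonpos_le)
  ultimately show ?thesis using assms(8) by linarith
qed

section \<open>Inertia of symmetric bilinear forms\<close>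

definition sym_on :: "('a::euclidean_space \<Rightarrow> 'a \<Rightarrow> real) \<Rightarrow> 'a set \<Rightarrow> bool" where
  "sym_on B S \<longleftrightarrow> bilinear B \<and> subspace S \<and> (\<forall>x\<in>S. \<forall>y\<in>S. B x y = B y x)"

definition radical :: "('a::euclidean_space \<Rightarrow> 'a \<Rightarrow> real) \<Rightarrow> 'a set \<Rightarrow> 'a set" where
  "radical B S = {x\<in>S. \<forall>y\<in>S. B x y = 0}"

lemma sym_on_subset: "sym_on B S \<Longrightarrow> subspace T \<Longrightarrow> T \<subseteq> S \<Longrightarrow> sym_on B T"
  by (auto simp: sym_on_def)

lemma bilinear_uminus: "bilinear B \<Longrightarrow> bilinear (\<lambda>x y. - B x y :: real)"
  by (simp add: bilinear_def linear_compose_neg)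

lemma sym_on_uminus: "sym_on B S \<Longrightarrow> sym_on (\<lambda>x y. - B x y) S"
  by (simp add: sym_on_def bilinear_uminus)

lemma subspace_annihilator:
  assumes "bilinear B" "subspace S"
  shows "subspace {x\<in>S. \<forall>u\<in>U. B u x = (0::real)}"
  using assms by (auto simp: subspace_def bilinear_rzero bilinear_radd bilinear_rmul)

lemma subspace_annihilator_left:
  assumes "bilinear B" "subspace S"
  shows "subspace {x\<in>S. \<forall>u\<in>U. B x u = (0::real)}"
  using assms by (auto simp: subspace_def bilinear_lzero bilinear_ladd bilinear_lmul)

lemma subspace_radical: "sym_on B S \<Longrightarrow> subspace (radical B S)"
  unfolding radical_def by (intro subspace_annihilator_left) (auto simp: sym_on_def)

lemma bilinear_square_add:
  assumes "bilinear B" "B y x = B x y"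
  shows "B (x + y) (x + y) = B x x + 2 * B x y + (B y y :: real)"
  using assms by (simp add: bilinear_ladd bilinear_radd)

text \<open>\<open>U\<close> is a positive subspace of maximal dimension and \<open>V\<close> its
  \<open>B\<close>-annihilator. A vector \<open>v\<close> of \<open>V\<close> with
  \<open>B v v > 0\<close> could be added to \<open>U\<close>, contradicting maximality.\<close>

lemma pos_index_split:
  assumes B: "sym_on B S"
  obtains U V where "subspace U" "U \<subseteq> S" "\<And>u. u \<in> U \<Longrightarrow> u \<noteq> 0 \<Longrightarrow> B u u > 0"
    "subspace V" "V \<subseteq> S" "\<And>v. v \<in> V \<Longrightarrow> B v v \<le> 0"
    "\<And>u v. u \<in> U \<Longrightarrow> v \<in> V \<Longrightarrow> B u v = 0"
    "dim U + dim V = dim S" "dim U = form_index B S"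
    "V = {x\<in>S. \<forall>u\<in>U. B u x = 0}"
proof -
  have bl: "bilinear B" and S: "subspace S" and sym: "\<And>x y. x \<in> S \<Longrightarrow> y \<in> S \<Longrightarrow> B x y = B y x"
    using B by (auto simp: sym_on_def)
  obtain U where U: "subspace U" "U \<subseteq> S" "\<And>u. u \<in> U \<Longrightarrow> u \<noteq> 0 \<Longrightarrow> B u u > 0"
    "dim U = form_index B S"
    using pos_index_attained[of S "\<lambda>x. B x x"] subspace_0[OF S] by blast
  define V where "V = {x\<in>S. \<forall>u\<in>U. B u x = 0}"
  have V: "subspace V" unfolding V_def by (rule subspace_annihilator[OF bl S])
  have "{u\<in>U. \<forall>x\<in>S. B u x = 0} \<subseteq> {0}" using U by force
  then have "dim {u\<in>U. \<forall>x\<in>S. B u x = 0} = 0" by (simp add: dim_eq_0)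
  then have d: "dim U + dim V = dim S"
    using dim_annihilator[OF bl U(1) S] unfolding V_def by linarith
  have np: "B v v \<le> 0" if v: "v \<in> V" for v
  proof (rule ccontr)
    assume "\<not> B v v \<le> 0"
    then have pv: "B v v > 0" by simp
    have vS: "v \<in> S" and vU: "\<And>u. u \<in> U \<Longrightarrow> B u v = 0" using v by (auto simp: V_def)
    let ?U = "sum_space U (span {v})"
    have "v \<noteq> 0" using pv bilinear_rzero[OF bl] by auto
    have "dim ?U + dim (U \<inter> span {v}) = dim U + dim (span {v})"
      by (intro dim_sums_Int U subspace_span)
    moreover have "U \<inter> span {v} \<subseteq> {0}"
    proof
      fix x assume "x \<in> U \<inter> span {v}"
      then obtain c where c: "x = c *\<^sub>R v" "x \<in> U" by (auto simp: span_singleton)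
      then have "c * B v v = 0" using vU[of x] by (simp add: bilinear_lmul[OF bl])
      then show "x \<in> {0}" using pv c by simp
    qed
    then have "dim (U \<inter> span {v}) = 0" by (simp add: dim_eq_0)
    moreover have "dim (span {v}) = 1"
      using \<open>v \<noteq> 0\<close> by (simp add: dim_eq_card_independent)
    moreover have "dim ?U \<le> form_index B S"
    proof (rule pos_index_ge)
      show "subspace ?U" by (intro subspace_sums U subspace_span)
      show "?U \<subseteq> S" using U(2) vS S
        by (auto simp: span_singleton intro!: subspace_add subspace_scale)
      fix x assume "x \<in> ?U" "x \<noteq> 0"
      then obtain u c where x: "x = u + c *\<^sub>R v" "u \<in> U" by (auto simp: span_singleton)
      have uv: "B u v = 0" "B v u = 0" using vU x sym[of u v] U(2) vS by auto
      have e: "B x x = B u u + c\<^sup>2 * B v v"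
        using uv unfolding x by (simp add: bilinear_ladd[OF bl] bilinear_radd[OF bl]
          bilinear_lmul[OF bl] bilinear_rmul[OF bl] power2_eq_square)
      have u0: "B u u \<ge> 0" using U(3)[of u] x bilinear_rzero[OF bl] by (cases "u = 0") auto
      show "B x x > 0"
      proof (cases "u = 0")
        case True
        then have "c \<noteq> 0" using x \<open>x \<noteq> 0\<close> by auto
        then have "c\<^sup>2 * B v v > 0" using pv by simp
        then show ?thesis using e u0 by linarith
      next
        case False
        then have "B u u > 0" using U(3) x by auto
        moreover have "c\<^sup>2 * B v v \<ge> 0" using pv by simp
        ultimately show ?thesis using e by linarith
      qed
    qed
    ultimately show False using U(4) by linarith
  qed
  show ?thesis
    by (rule that[OF U(1-3) V _ np _ d U(4) V_def]) (auto simp: V_def)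
qed

lemma pos_index_nonpos_complement:
  assumes B: "sym_on B S"
  obtains V where "subspace V" "V \<subseteq> S" "\<And>v. v \<in> V \<Longrightarrow> B v v \<le> 0"
    "form_index B S + dim V = dim S"
proof (rule pos_index_split[OF B])
  fix U V assume "subspace V" "V \<subseteq> S" "\<And>v. v \<in> V \<Longrightarrow> B v v \<le> 0"
    "dim U + dim V = dim S" "dim U = form_index B S"
  then show ?thesis using that[of V] by simp
qed

text \<open>Splitting twice, by \<open>B\<close> on \<open>S\<close> and then by \<open>- B\<close>
  on the nonpositive part, leaves a subspace on which the quadratic form vanishes; by polarization
  it lies in the radical, so the three numbers add up to at least \<open>dim S\<close>. Conversely a
  negative subspace together with the radical is nonpositive and bounds the positive index. This is
  Sylvester's law of inertia.\<close>

lemma pos_neg_radical_dim: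
  assumes B: "sym_on B S"
  shows "form_index B S + neg_index (\<lambda>x. B x x) S + dim (radical B S) = dim S"
proof -
  have bl: "bilinear B" and S: "subspace S" and sym: "\<And>x y. x \<in> S \<Longrightarrow> y \<in> S \<Longrightarrow> B x y = B y x"
    using B by (auto simp: sym_on_def)
  obtain U V where UV: "subspace U" "U \<subseteq> S" "\<And>u. u \<in> U \<Longrightarrow> u \<noteq> 0 \<Longrightarrow> B u u > 0"
    "subspace V" "V \<subseteq> S" "\<And>v. v \<in> V \<Longrightarrow> B v v \<le> 0"
    "\<And>u v. u \<in> U \<Longrightarrow> v \<in> V \<Longrightarrow> B u v = 0"
    "dim U + dim V = dim S" "dim U = form_index B S"
    by (rule pos_index_split[OF B]) (rule that; assumption)
  have BV: "sym_on (\<lambda>x y. - B x y) V" using sym_on_uminus sym_on_subset B UV by blast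
  obtain U' V' where UV': "subspace U'" "U' \<subseteq> V" "\<And>u. u \<in> U' \<Longrightarrow> u \<noteq> 0 \<Longrightarrow> - B u u > 0"
    "subspace V'" "V' \<subseteq> V" "\<And>v. v \<in> V' \<Longrightarrow> - B v v \<le> 0"
    "\<And>u v. u \<in> U' \<Longrightarrow> v \<in> V' \<Longrightarrow> - B u v = 0"
    "dim U' + dim V' = dim V"
    by (rule pos_index_split[OF BV]) (rule that; assumption)
  have V'0: "B v v = 0" if "v \<in> V'" for v
    using UV'(5) UV'(6)[OF that] UV(6)[of v] that by auto
  have V'1: "B v w = 0" if "v \<in> V'" "w \<in> V'" for v w
  proof -
    have "B (v + w) (v + w) = 0" using that UV'(4) by (intro V'0 subspace_add)
    moreover have "B w v = B v w" using that UV'(5) UV(5) by (intro sym) auto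
    ultimately show ?thesis
      using that V'0 bilinear_square_add[OF bl] by simp
  qed
  have "V' \<subseteq> radical B S"
  proof
    fix v assume v: "v \<in> V'"
    then have vV: "v \<in> V" and vS: "v \<in> S" using UV'(5) UV(5) by auto
    have "B v y = 0" if y: "y \<in> S" for y
    proof -
      \<comment> \<open>The annihilator of \<open>v\<close> is a subspace containing
        \<open>U\<close>, \<open>U'\<close> and \<open>V'\<close>, which together span
        \<open>S\<close>.\<close>
      let ?Z = "{y\<in>S. \<forall>u\<in>{v}. B u y = 0}"
      have sZ: "subspace ?Z" by (rule subspace_annihilator[OF bl S])
      have uz: "U \<subseteq> ?Z" using UV(2,7) vV vS sym by force
      have "U' \<subseteq> ?Z" using UV'(2,7) UV(5) v vS sym by force
      moreover have "V' \<subseteq> ?Z" using V'1 v UV'(5) UV(5) by auto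
      ultimately have s: "sum_space U' V' \<subseteq> ?Z" by (rule sum_space_subset[OF sZ])
      have "sum_space U' V' \<subseteq> V" using UV(4) UV'(2,5) by (auto intro: subspace_add)
      moreover have "dim (sum_space U' V') = dim V"
      proof -
        have "U' \<inter> V' \<subseteq> {0}" using UV'(3) V'0 by force
        then have "dim (U' \<inter> V') = 0" by (simp add: dim_eq_0)
        then show ?thesis using dim_sums_Int[OF UV'(1,4)] UV'(8) by linarith
      qed
      ultimately have "sum_space U' V' = V"
        by (intro subspace_dim_equal subspace_sums UV UV') auto
      then have vz: "V \<subseteq> ?Z" using s by simp
      have "dim (sum_space U V) = dim S"
      proof -
        have "U \<inter> V \<subseteq> {0}" using UV(3,6) by force
        then have "dim (U \<inter> V) = 0" by (simp add: dim_eq_0)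
        then show ?thesis using dim_sums_Int[OF UV(1,4)] UV(8) by linarith
      qed
      moreover have "sum_space U V \<subseteq> S" using S UV(2,5) by (auto intro: subspace_add)
      ultimately have "sum_space U V = S"
        by (intro subspace_dim_equal subspace_sums UV S) auto
      moreover have "sum_space U V \<subseteq> ?Z" by (rule sum_space_subset[OF sZ uz vz])
      ultimately show ?thesis using y by auto
    qed
    then show "v \<in> radical B S" using vS by (auto simp: radical_def)
  qed
  then have r1: "dim V' \<le> dim (radical B S)" by (rule dim_subset)
  have r2: "dim U' \<le> neg_index (\<lambda>x. B x x) S"
    unfolding neg_index_def using UV' UV(5) by (intro pos_index_ge) auto
  obtain N where N: "subspace N" "N \<subseteq> S" "\<And>u. u \<in> N \<Longrightarrow> u \<noteq> 0 \<Longrightarrow> - B u u > 0"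
    "dim N = neg_index (\<lambda>x. B x x) S"
    using pos_index_attained[of S "\<lambda>x. - B x x"] subspace_0[OF S] unfolding neg_index_def by blast
  have rs: "subspace (radical B S)" by (rule subspace_radical[OF B])
  have "N \<inter> radical B S \<subseteq> {0}" using N(3) unfolding radical_def by force
  then have "dim (N \<inter> radical B S) = 0" by (simp add: dim_eq_0)
  then have "dim (sum_space N (radical B S)) = dim N + dim (radical B S)"
    using dim_sums_Int[OF N(1) rs] by linarith
  moreover have "form_index B S + dim (sum_space N (radical B S)) \<le> dim S"
  proof (rule pos_index_add_nonpos_le[OF S])
    show "subspace (sum_space N (radical B S))" by (intro subspace_sums N rs)
    show "sum_space N (radical B S) \<subseteq> S"
      using N(2) S by (auto simp: radical_def intro: subspace_add)
    fix v assume "v \<in> sum_space N (radical B S)"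
    then obtain x r where v: "v = x + r" "x \<in> N" "r \<in> radical B S" by auto
    then have "B r x = 0" "B x r = 0" "B r r = 0" using N(2) sym[of x r] by (auto simp: radical_def)
    then have "B v v = B x x" unfolding v(1) by (simp add: bilinear_ladd[OF bl] bilinear_radd[OF bl])
    also have "\<dots> \<le> 0" using N(3)[OF v(2)] bilinear_rzero[OF bl] by (cases "x = 0") auto
    finally show "B v v \<le> 0" .
  qed
  ultimately show ?thesis using r1 r2 UV(8,9) UV'(8) N(4) by linarith
qed

text \<open>\<open>F\<close> may meet its annihilator \<open>F'\<close>, so \<open>E\<close> need
  not be their direct sum, and the two dimension terms correct for this. One inequality is proved
  for \<open>B\<close> and for \<open>- B\<close>; since the radical of \<open>F'\<close> contains
  those of \<open>F\<close> and \<open>E\<close>, the inertia formulas for \<open>E\<close>,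
  \<open>F\<close> and \<open>F'\<close> leave no slack and turn it into an equality.\<close>

lemma pos_index_orthogonal_decomp:
  assumes B: "sym_on B E" and F: "subspace F" "F \<subseteq> E"
  defines "F' \<equiv> {x\<in>E. \<forall>f\<in>F. B f x = 0}"
  shows "form_index B E + dim (F \<inter> radical B E) =
    form_index B F + form_index B F' + dim (radical B F)"
proof -
  have bl: "bilinear B" and E: "subspace E" and sym: "\<And>x y. x \<in> E \<Longrightarrow> y \<in> E \<Longrightarrow> B x y = B y x"
    using B by (auto simp: sym_on_def)
  have F': "subspace F'" "F' \<subseteq> E" unfolding F'_def by (auto intro: subspace_annihilator[OF bl E])
  have "{f\<in>F. \<forall>x\<in>E. B f x = 0} = F \<inter> radical B E" using F by (auto simp: radical_def)
  then have dF': "dim F' + dim F = dim E + dim (F \<inter> radical B E)"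
    using dim_annihilator[OF bl F(1) E] unfolding F'_def by simp
  have rF: "radical B F = F \<inter> F'"
  proof -
    have "B x y = B y x" if "x \<in> F" "y \<in> F" for x y using that F(2) sym by blast
    then show ?thesis using F(2) by (auto simp: radical_def F'_def)
  qed
  \<comment> \<open>Nonpositive subspaces of \<open>F\<close> and of \<open>F'\<close> are
    \<open>C\<close>-orthogonal, so their sum is nonpositive, and they overlap at most in
    \<open>radical B F\<close>.\<close>
  have upper: "form_index C E + dim (F \<inter> radical B E) \<le>
      form_index C F + form_index C F' + dim (radical B F)"
    if C: "sym_on C E" and CB: "\<And>x y. x \<in> F \<Longrightarrow> y \<in> F' \<Longrightarrow> C x y = 0" for C
  proof -
    have blC: "bilinear C" and symC: "\<And>x y. x \<in> E \<Longrightarrow> y \<in> E \<Longrightarrow> C x y = C y x"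
      using C by (auto simp: sym_on_def)
    obtain V1 where V1: "subspace V1" "V1 \<subseteq> F" "\<And>v. v \<in> V1 \<Longrightarrow> C v v \<le> 0"
       "form_index C F + dim V1 = dim F"
      using pos_index_nonpos_complement[OF sym_on_subset[OF C F]] by blast
    obtain V2 where V2: "subspace V2" "V2 \<subseteq> F'" "\<And>v. v \<in> V2 \<Longrightarrow> C v v \<le> 0"
       "form_index C F' + dim V2 = dim F'"
      using pos_index_nonpos_complement[OF sym_on_subset[OF C F']] by blast
    have "V1 \<inter> V2 \<subseteq> radical B F" using V1 V2 rF by auto
    then have "dim (V1 \<inter> V2) \<le> dim (radical B F)" by (rule dim_subset)
    moreover have "form_index C E + dim (sum_space V1 V2) \<le> dim E"
    proof (rule pos_index_add_nonpos_le[OF E])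
      show "subspace (sum_space V1 V2)" by (intro subspace_sums V1 V2)
      show "sum_space V1 V2 \<subseteq> E"
        using V1(2) V2(2) F F' E by (auto intro!: subspace_add)
      fix v assume "v \<in> sum_space V1 V2"
      then obtain x y where v: "v = x + y" "x \<in> V1" "y \<in> V2" by auto
      have "C x y = 0" using v(2,3) V1(2) V2(2) by (intro CB) auto
      moreover have "C y x = C x y" using v V1 V2 F F' by (intro symC) auto
      ultimately have "C v v = C x x + C y y"
        unfolding v(1) by (simp add: bilinear_square_add[OF blC])
      then show "C v v \<le> 0" using V1(3)[OF v(2)] V2(3)[OF v(3)] by simp
    qed
    ultimately show ?thesis
      using dim_sums_Int[OF V1(1) V2(1)] dF' V1(4) V2(4) by linarith
  qed
  have u1: "form_index B E + dim (F \<inter> radical B E) \<le>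
      form_index B F + form_index B F' + dim (radical B F)"
    by (rule upper[OF B]) (auto simp: F'_def)
  have u2: "neg_index (\<lambda>x. B x x) E + dim (F \<inter> radical B E) \<le>
      neg_index (\<lambda>x. B x x) F + neg_index (\<lambda>x. B x x) F' + dim (radical B F)"
    using upper[OF sym_on_uminus[OF B]] unfolding neg_index_def by (auto simp: F'_def)
  have rE: "subspace (radical B E)" by (rule subspace_radical[OF B])
  have rFs: "subspace (radical B F)" by (rule subspace_radical[OF sym_on_subset[OF B F]])
  have "sum_space (radical B F) (radical B E) \<subseteq> radical B F'"
  proof safe
    fix x y assume x: "x \<in> radical B F" and y: "y \<in> radical B E"
    have y': "y \<in> F'" using y F(2) sym[of y] unfolding F'_def radical_def by force
    have x': "x \<in> F'" using x rF by auto
    have "B (x + y) z = 0" if z: "z \<in> F'" for z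
    proof -
      have "B x z = 0" using x z by (auto simp: F'_def radical_def)
      moreover have "B y z = 0" using y z by (auto simp: F'_def radical_def)
      ultimately show ?thesis by (simp add: bilinear_ladd[OF bl])
    qed
    then show "x + y \<in> radical B F'" using x' y' F' by (auto simp: radical_def intro: subspace_add)
  qed
  then have "dim (sum_space (radical B F) (radical B E)) \<le> dim (radical B F')" by (rule dim_subset)
  moreover have "radical B F \<inter> radical B E = F \<inter> radical B E"
    using F(2) by (auto simp: radical_def)
  ultimately have r: "dim (radical B F) + dim (radical B E) \<le> dim (radical B F') + dim (F \<inter> radical B E)"
    using dim_sums_Int[OF rFs rE] by simp
  show ?thesis
    using u1 u2 r dF' pos_neg_radical_dim[OF B] pos_neg_radical_dim[OF sym_on_subset[OF B F]]
      pos_neg_radical_dim[OF sym_on_subset[OF B F']] by linarith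
qed

text \<open>Since \<open>q 0 = 0\<close>, the map is injective on every subspace where the pulled
  back function is positive; conversely a positive subspace of the image lifts to the orthogonal
  complement of the kernel in its preimage.\<close>

lemma pos_index_linear_pullback:
  fixes g :: "'a::euclidean_space \<Rightarrow> 'b::euclidean_space"
  assumes g: "linear g" and S: "subspace S" and q0: "q 0 = (0::real)"
  shows "pos_index (\<lambda>x. q (g x)) S = pos_index q (g ` S)"
proof (rule antisym)
  obtain U where U: "subspace U" "U \<subseteq> S" "\<And>u. u \<in> U \<Longrightarrow> u \<noteq> 0 \<Longrightarrow> q (g u) > 0"
      "dim U = pos_index (\<lambda>x. q (g x)) S"
    using pos_index_attained[of S "\<lambda>x. q (g x)"] subspace_0[OF S] by blast
  have "inj_on g U"
    using U(3) q0 by (subst linear_inj_on_iff_eq_0[OF g U(1)]) force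
  then have "dim (g ` U) = dim U" using dim_image_eq[OF g, of U] U(1) by (metis span_eq_iff)
  moreover have "dim (g ` U) \<le> pos_index q (g ` S)"
  proof (rule pos_index_ge)
    show "subspace (g ` U)" using g U(1) by (rule linear_subspace_image)
    show "g ` U \<subseteq> g ` S" using U(2) by auto
    fix y assume "y \<in> g ` U" "y \<noteq> 0"
    then obtain u where "u \<in> U" "y = g u" "u \<noteq> 0" using linear_0[OF g] by auto
    then show "q y > 0" using U(3) by simp
  qed
  ultimately show "pos_index (\<lambda>x. q (g x)) S \<le> pos_index q (g ` S)" using U(4) by simp
next
  have "0 \<in> g ` S" using linear_0[OF g] subspace_0[OF S] by (metis imageI)
  then obtain U where U: "subspace U" "U \<subseteq> g ` S" "\<And>u. u \<in> U \<Longrightarrow> u \<noteq> 0 \<Longrightarrow> q u > 0"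
      "dim U = pos_index q (g ` S)"
    using pos_index_attained[of "g ` S" q] by blast
  let ?T = "{x\<in>S. g x \<in> U}" and ?K = "{x\<in>S. g x = 0}"
  have T: "subspace ?T" and K: "subspace ?K" using S g U(1)
    by (auto simp: subspace_def linear_add linear_scale linear_0)
  define T' where "T' = {y\<in>?T. \<forall>x\<in>?K. orthogonal x y}"
  have T': "subspace T'" using T unfolding T'_def subspace_def orthogonal_def
    by (auto simp: inner_right_distrib)
  have KT: "?K \<subseteq> ?T" using subspace_0[OF U(1)] by auto
  have "dim T' + dim ?K = dim ?T"
    unfolding T'_def by (rule dim_subspace_orthogonal_to_vectors[OF K T KT])
  moreover have "dim (g ` ?T) + dim {x\<in>?T. g x = 0} = dim ?T" by (rule dim_kernel_image[OF g T])
  moreover have "{x\<in>?T. g x = 0} = ?K" using subspace_0[OF U(1)] by auto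
  moreover have "g ` ?T = U" using U(2) by auto
  ultimately have d: "dim T' = dim U" by simp
  have "dim T' \<le> pos_index (\<lambda>x. q (g x)) S"
  proof (rule pos_index_ge[OF T'])
    show "T' \<subseteq> S" by (auto simp: T'_def)
    fix u assume u: "u \<in> T'" "u \<noteq> 0"
    have "g u \<noteq> 0" using u by (auto simp: T'_def orthogonal_def)
    then show "q (g u) > 0" using u U(3) by (auto simp: T'_def)
  qed
  then show "pos_index q (g ` S) \<le> pos_index (\<lambda>x. q (g x)) S" using d U(4) by simp
qed

lemma pos_index_Times:
  assumes B: "sym_on B S" and C: "sym_on C T"
  shows "pos_index (\<lambda>p. B (fst p) (fst p) + C (snd p) (snd p)) (S \<times> T) =
    form_index B S + form_index C T"
proof -
  obtain U V where UV: "subspace U" "U \<subseteq> S" "\<And>u. u \<in> U \<Longrightarrow> u \<noteq> 0 \<Longrightarrow> B u u > 0"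
    "subspace V" "V \<subseteq> S" "\<And>v. v \<in> V \<Longrightarrow> B v v \<le> 0"
    "dim U + dim V = dim S" "dim U = form_index B S"
    by (rule pos_index_split[OF B]) (rule that; assumption)
  obtain U' V' where UV': "subspace U'" "U' \<subseteq> T" "\<And>u. u \<in> U' \<Longrightarrow> u \<noteq> 0 \<Longrightarrow> C u u > 0"
    "subspace V'" "V' \<subseteq> T" "\<And>v. v \<in> V' \<Longrightarrow> C v v \<le> 0"
    "dim U' + dim V' = dim T" "dim U' = form_index C T"
    by (rule pos_index_split[OF C]) (rule that; assumption)
  have ge: "B u u \<ge> 0" if "u \<in> U" for u
    using UV(3)[OF that] B bilinear_rzero[of B] by (cases "u = 0") (auto simp: sym_on_def)
  have ge': "C u u \<ge> 0" if "u \<in> U'" for u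
    using UV'(3)[OF that] C bilinear_rzero[of C] by (cases "u = 0") (auto simp: sym_on_def)
  have S: "subspace S" "subspace T" using B C by (auto simp: sym_on_def)
  have "pos_index (\<lambda>p. B (fst p) (fst p) + C (snd p) (snd p)) (S \<times> T) = dim (U \<times> U')"
  proof (rule pos_index_eqI)
    show "subspace (S \<times> T)" "subspace (U \<times> U')" "subspace (V \<times> V')"
      by (intro subspace_Times S UV UV')+
    show "U \<times> U' \<subseteq> S \<times> T" "V \<times> V' \<subseteq> S \<times> T" using UV UV' by auto
    show "dim (S \<times> T) \<le> dim (U \<times> U') + dim (V \<times> V')"
      using UV UV' S by (simp add: dim_Times)
    show "B (fst v) (fst v) + C (snd v) (snd v) \<le> 0" if "v \<in> V \<times> V'" for v
      using that UV(6)[of "fst v"] UV'(6)[of "snd v"] by auto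
    show "B (fst u) (fst u) + C (snd u) (snd u) > 0" if u: "u \<in> U \<times> U'" "u \<noteq> 0" for u
    proof -
      have m: "fst u \<in> U" "snd u \<in> U'" using u by auto
      consider "fst u \<noteq> 0" | "snd u \<noteq> 0" using u(2) by (metis prod_eqI fst_zero snd_zero)
      then show ?thesis
      proof cases
        case 1 then show ?thesis using UV(3)[OF m(1)] ge'[OF m(2)] by linarith
      next
        case 2 then show ?thesis using UV'(3)[OF m(2)] ge[OF m(1)] by linarith
      qed
    qed
  qed
  then show ?thesis using UV UV' by (simp add: dim_Times)
qed

section \<open>Stability of the index under perturbation\<close>

lemma pos_def_coercive:
  fixes B :: "'a::euclidean_space \<Rightarrow> 'a \<Rightarrow> real"
  assumes bl: "bilinear B" and U: "subspace U" and pos: "\<And>u. u \<in> U \<Longrightarrow> u \<noteq> 0 \<Longrightarrow> B u u > 0"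
  obtains c where "c > 0" "\<And>u. u \<in> U \<Longrightarrow> B u u \<ge> c * (norm u)\<^sup>2"
proof (cases "U \<subseteq> {0}")
  case True
  show ?thesis
    by (rule that[of 1]) (use True bilinear_rzero[OF bl] in auto)
next
  case False
  let ?K = "U \<inter> sphere 0 1"
  have comp: "compact ?K" using closed_subspace[OF U] by (simp add: closed_Int_compact)
  obtain x where x: "x \<in> U" "x \<noteq> 0" using False by auto
  then have "x /\<^sub>R norm x \<in> ?K" using U by (auto intro: subspace_scale)
  then have ne: "?K \<noteq> {}" by blast
  have bb: "bounded_bilinear B" using bl bilinear_conv_bounded_bilinear by blast
  have "continuous_on ?K (\<lambda>u. B u u)"
    by (intro bounded_bilinear.continuous_on[OF bb] continuous_intros)
  from continuous_attains_inf[OF comp ne this]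
  obtain m where m: "m \<in> ?K" "\<And>u. u \<in> ?K \<Longrightarrow> B m m \<le> B u u" by blast
  show ?thesis
  proof (rule that[of "B m m"])
    show "B m m > 0" using m(1) by (intro pos) auto
    fix u assume u: "u \<in> U"
    show "B u u \<ge> B m m * (norm u)\<^sup>2"
    proof (cases "u = 0")
      case False
      have "u /\<^sub>R norm u \<in> ?K" using U u False by (auto intro: subspace_scale)
      then have "B m m \<le> B (u /\<^sub>R norm u) (u /\<^sub>R norm u)" by (rule m(2))
      also have "\<dots> = B u u / (norm u)\<^sup>2"
        by (simp add: bilinear_lmul[OF bl] bilinear_rmul[OF bl] power2_eq_square field_simps)
      finally show ?thesis using False by (simp add: field_simps)
    qed (simp add: bilinear_rzero[OF bl])
  qed
qed

text \<open>On a positive subspace of maximal dimension the form is coercive, and a perturbation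
  below half of the coercivity constant leaves it positive there. The index can therefore only rise
  nearby.\<close>

lemma pos_index_semicontinuous:
  assumes B: "bilinear B" "subspace S"
  obtains e where "e > 0" "\<And>q. (\<And>x. x \<in> S \<Longrightarrow> \<bar>q x - B x x\<bar> \<le> e * (norm x)\<^sup>2) \<Longrightarrow>
    form_index B S \<le> pos_index q S"
proof -
  obtain U where U: "subspace U" "U \<subseteq> S" "\<And>u. u \<in> U \<Longrightarrow> u \<noteq> 0 \<Longrightarrow> B u u > 0"
      "dim U = form_index B S"
    using pos_index_attained[of S "\<lambda>x. B x x"] subspace_0[OF B(2)] by blast
  obtain c where c: "c > 0" "\<And>u. u \<in> U \<Longrightarrow> B u u \<ge> c * (norm u)\<^sup>2"
    using pos_def_coercive[OF B(1) U(1)] U(3) by blast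
  show ?thesis
  proof (rule that[of "c / 2"])
    show "c / 2 > 0" using c by simp
    fix q assume q: "\<And>x. x \<in> S \<Longrightarrow> \<bar>q x - B x x\<bar> \<le> c / 2 * (norm x)\<^sup>2"
    have "dim U \<le> pos_index q S"
    proof (rule pos_index_ge[OF U(1,2)])
      fix u assume u: "u \<in> U" "u \<noteq> 0"
      have "c / 2 * (norm u)\<^sup>2 > 0" using c u by simp
      moreover have "u \<in> S" using U(2) u(1) by auto
      ultimately show "q u > 0" using q[of u] c(2)[OF u(1)] by linarith
    qed
    then show "form_index B S \<le> pos_index q S" using U by simp
  qed
qed

text \<open>Positive and negative index can both only rise under a small perturbation, and inertia
  fixes their sum once the nullity is fixed; hence neither of them changes.\<close>

lemma pos_index_locally_const:
  assumes B: "sym_on B S"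
  obtains e where "e > 0" "\<And>B'. sym_on B' S \<Longrightarrow> dim (radical B' S) = dim (radical B S) \<Longrightarrow>
    (\<And>x. x \<in> S \<Longrightarrow> \<bar>B' x x - B x x\<bar> \<le> e * (norm x)\<^sup>2) \<Longrightarrow>
    form_index B' S = form_index B S"
proof -
  have bl: "bilinear B" "subspace S" using B by (auto simp: sym_on_def)
  obtain e1 where e1: "e1 > 0" "\<And>q. (\<And>x. x \<in> S \<Longrightarrow> \<bar>q x - B x x\<bar> \<le> e1 * (norm x)\<^sup>2) \<Longrightarrow>
    form_index B S \<le> pos_index q S"
    using pos_index_semicontinuous[OF bl] by blast
  obtain e2 where e2: "e2 > 0" "\<And>q. (\<And>x. x \<in> S \<Longrightarrow> \<bar>q x - - B x x\<bar> \<le> e2 * (norm x)\<^sup>2) \<Longrightarrow>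
    pos_index (\<lambda>x. - B x x) S \<le> pos_index q S"
    using pos_index_semicontinuous[OF bilinear_uminus[OF bl(1)] bl(2)] by blast
  show ?thesis
  proof (rule that[of "min e1 e2"])
    show "min e1 e2 > 0" using e1 e2 by simp
    fix B' assume B': "sym_on B' S" "dim (radical B' S) = dim (radical B S)"
      and d: "\<And>x. x \<in> S \<Longrightarrow> \<bar>B' x x - B x x\<bar> \<le> min e1 e2 * (norm x)\<^sup>2"
    have d': "\<bar>B' x x - B x x\<bar> \<le> e1 * (norm x)\<^sup>2" "\<bar>- B' x x - - B x x\<bar> \<le> e2 * (norm x)\<^sup>2" if "x \<in> S" for x
    proof -
      have "min e1 e2 * (norm x)\<^sup>2 \<le> e1 * (norm x)\<^sup>2" "min e1 e2 * (norm x)\<^sup>2 \<le> e2 * (norm x)\<^sup>2"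
        by (intro mult_right_mono; simp)+
      then show "\<bar>B' x x - B x x\<bar> \<le> e1 * (norm x)\<^sup>2" "\<bar>- B' x x - - B x x\<bar> \<le> e2 * (norm x)\<^sup>2"
        using d[OF that] by linarith+
    qed
    have "form_index B S \<le> form_index B' S" by (rule e1(2)) (rule d')
    moreover have "neg_index (\<lambda>x. B x x) S \<le> neg_index (\<lambda>x. B' x x) S"
      unfolding neg_index_def by (rule e2(2)) (rule d'(2))
    ultimately show "form_index B' S = form_index B S"
      using pos_neg_radical_dim[OF B] pos_neg_radical_dim[OF B'(1)] B'(2) by linarith
  qed
qed

text \<open>The cross terms are of order \<open>\<tau>\<close>, so their square is dominated by the product of the
  diagonal terms, which is of order \<open>\<tau>\<close>.\<close>

lemma perturbed_form_pos:
  fixes B :: "'a::euclidean_space \<Rightarrow> 'a \<Rightarrow> real"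
  assumes bl: "bilinear B" and sym: "B k u = B u k"
    and c: "c > 0" "g > 0" "C \<ge> 0" and \<tau>: "\<tau> > 0" "4 * C\<^sup>2 * \<tau> < c * g"
    and u: "B u u \<ge> c / 2 * (norm u)\<^sup>2" and k: "B k k \<ge> \<tau> * (g / 2) * (norm k)\<^sup>2"
    and uk: "\<bar>B u k\<bar> \<le> C * \<tau> * norm u * norm k" and nz: "u \<noteq> 0 \<or> k \<noteq> 0"
  shows "B (u + k) (u + k) > 0"
proof -
  let ?a = "norm u" and ?b = "norm k"
  have e: "B (u + k) (u + k) = B u u + 2 * B u k + B k k"
    by (rule bilinear_square_add[OF bl sym])
  \<comment> \<open>Multiplying the lower bound by \<open>2 * c\<close> completes the square; the
    bound on \<tau> makes the remaining coefficient positive.\<close>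
  have "2 * c * (c / 2 * ?a\<^sup>2 - 2 * (C * \<tau> * ?a * ?b) + \<tau> * (g / 2) * ?b\<^sup>2)
    = (c * ?a - 2 * C * \<tau> * ?b)\<^sup>2 + \<tau> * (c * g - 4 * C\<^sup>2 * \<tau>) * ?b\<^sup>2"
    by (simp add: power2_eq_square algebra_simps)
  moreover have "(c * ?a - 2 * C * \<tau> * ?b)\<^sup>2 + \<tau> * (c * g - 4 * C\<^sup>2 * \<tau>) * ?b\<^sup>2 > 0"
  proof (cases "k = 0")
    case True
    then show ?thesis using nz c by simp
  next
    case False
    then have "\<tau> * (c * g - 4 * C\<^sup>2 * \<tau>) * ?b\<^sup>2 > 0" using \<tau> by simp
    then show ?thesis by (simp add: add_nonneg_pos)
  qed
  ultimately have "c / 2 * ?a\<^sup>2 - 2 * (C * \<tau> * ?a * ?b) + \<tau> * (g / 2) * ?b\<^sup>2 > 0"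
    using c(1) by (metis zero_less_mult_pos mult_pos_pos zero_less_numeral)
  then show ?thesis using e u k uk by linarith
qed

subsection \<open>Lagrangian projections and the cocycle identity\<close>

lemma bilinear_compose:
  assumes "bilinear B" "linear f" "linear g"
  shows "bilinear (\<lambda>x y. B (f x) (g y) :: real)"
  using assms unfolding bilinear_def
  by (auto intro: linear_compose[unfolded o_def, of _ "B _"]
      linear_compose[unfolded o_def, of _ "\<lambda>x. B x _"])

lemma bilinear_add: "bilinear B \<Longrightarrow> bilinear C \<Longrightarrow> bilinear (\<lambda>x y. B x y + C x y :: real)"
  by (simp add: bilinear_def linear_compose_add)

locale symplectic =
  fixes \<omega> :: "'v::euclidean_space \<Rightarrow> 'v \<Rightarrow> real"
  assumes symplectic_form: "symplectic_form \<omega>"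
begin

lemma bil: "bilinear \<omega>" and skew: "\<omega> x y = - \<omega> y x" and
  nondeg: "(\<And>y. \<omega> x y = 0) \<Longrightarrow> x = 0"
  using symplectic_form unfolding symplectic_form_def by blast+

lemmas omega_simps = bilinear_ladd[OF bil] bilinear_radd[OF bil] bilinear_lsub[OF bil]
  bilinear_rsub[OF bil] bilinear_lmul[OF bil] bilinear_rmul[OF bil] bilinear_lzero[OF bil]
  bilinear_rzero[OF bil] bilinear_lneg[OF bil] bilinear_rneg[OF bil]

lemma omega_self [simp]: "\<omega> x x = 0"
  using skew[of x x] by simp

lemma nondeg_right: "(\<And>y. \<omega> y x = 0) \<Longrightarrow> x = 0"
  using nondeg[of x] skew[of x] by simp

lemma omega_bounded: obtains K where "K > 0" "\<And>x y. \<bar>\<omega> x y\<bar> \<le> K * norm x * norm y"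
proof -
  obtain K where "K > 0" "\<forall>x y. norm (\<omega> x y) \<le> K * norm x * norm y"
    using bilinear_bounded_pos[OF bil] by blast
  then show ?thesis using that by auto
qed

lemma dim_omega_annihilator:
  assumes "subspace U"
  shows "dim {x. \<forall>u\<in>U. \<omega> u x = 0} + dim U = DIM('v)"
proof -
  have "{u\<in>U. \<forall>x\<in>UNIV. \<omega> u x = 0} \<subseteq> {0}" using nondeg by auto
  then have "dim {u\<in>U. \<forall>x\<in>UNIV. \<omega> u x = 0} = 0" by (simp add: dim_eq_0)
  then show ?thesis using dim_annihilator[OF bil assms subspace_UNIV] by simp
qed

lemma lagrangian_subspace: "lagrangian \<omega> L \<Longrightarrow> subspace L"
  and lagrangian_dim: "lagrangian \<omega> L \<Longrightarrow> 2 * dim L = DIM('v)"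
  and lagrangian_isotropic: "lagrangian \<omega> L \<Longrightarrow> x \<in> L \<Longrightarrow> y \<in> L \<Longrightarrow> \<omega> x y = 0"
  by (auto simp: lagrangian_def)

text \<open>The \<omega>-annihilator of \<open>L\<close> contains \<open>L\<close> and has the same
  dimension.\<close>

lemma lagrangian_maximal:
  assumes L: "lagrangian \<omega> L" and x: "\<And>y. y \<in> L \<Longrightarrow> \<omega> y x = 0"
  shows "x \<in> L"
proof -
  let ?A = "{x. \<forall>u\<in>L. \<omega> u x = 0}"
  have "subspace ?A" using subspace_annihilator[OF bil subspace_UNIV, of L] by simp
  moreover have "L \<subseteq> ?A" using L by (auto simp: lagrangian_def)
  moreover have "dim ?A = dim L"
    using dim_omega_annihilator[of L] L by (auto simp: lagrangian_def)
  ultimately have "L = ?A" using L by (intro subspace_dim_equal) (auto simp: lagrangian_def)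
  then show ?thesis using x by blast
qed

definition transversal :: "'v set \<Rightarrow> 'v set \<Rightarrow> bool" where
  "transversal W L \<longleftrightarrow> lagrangian \<omega> W \<and> lagrangian \<omega> L \<and> W \<inter> L = {0}"

lemma transversal_sym: "transversal W L \<Longrightarrow> transversal L W"
  by (auto simp: transversal_def)

lemma transversalI:
  "lagrangian \<omega> W \<Longrightarrow> lagrangian \<omega> L \<Longrightarrow> (\<And>x. x \<in> W \<Longrightarrow> x \<in> L \<Longrightarrow> x = 0) \<Longrightarrow> transversal W L"
  using subspace_0[OF lagrangian_subspace] unfolding transversal_def by blast

text \<open>Among the isotropic subspaces that meet \<open>L\<close> only in 0, one of maximal
  dimension is Lagrangian: otherwise its \<omega>-annihilator contains a vector outside
  \<open>X + L\<close>, which enlarges it.\<close>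

lemma transversal_exists:
  assumes L: "lagrangian \<omega> L"
  obtains W where "transversal W L"
proof -
  define A where "A = {dim X | X. subspace X \<and> (\<forall>x\<in>X. \<forall>y\<in>X. \<omega> x y = 0) \<and> X \<inter> L \<subseteq> {0}}"
  have fin: "finite A" unfolding A_def
    by (rule finite_subset[of _ "{..DIM('v)}"]) (auto simp: dim_subset_UNIV)
  have "dim {0::'v} \<in> A" unfolding A_def by (intro CollectI exI[of _ "{0}"]) auto
  then have "Max A \<in> A" by (intro Max_in fin) auto
  then obtain X where X: "subspace X" "\<And>x y. x \<in> X \<Longrightarrow> y \<in> X \<Longrightarrow> \<omega> x y = 0" "X \<inter> L \<subseteq> {0}"
    "dim X = Max A" unfolding A_def by auto
  have sL: "subspace L" using L by (rule lagrangian_subspace)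
  let ?P = "{x. \<forall>u\<in>X. \<omega> u x = 0}"
  have "dim X + dim L \<le> DIM('v)"
    using dim_independent_sum_le[OF X(1) sL subspace_UNIV _ _ X(3)] by simp
  then have le: "dim X \<le> dim L" using lagrangian_dim[OF L] by simp
  have "dim L \<le> dim X"
  proof (rule ccontr)
    assume "\<not> dim L \<le> dim X"
    then have lt: "dim X < dim L" by simp
    have dP: "dim ?P + dim X = DIM('v)" by (rule dim_omega_annihilator[OF X(1)])
    \<comment> \<open>\<open>?P\<close> meets \<open>X + L\<close> exactly in \<open>X + ?Q\<close>,
      whose dimension is at most that of \<open>L\<close>, whereas \<open>?P\<close> has dimension
      \<open>DIM('v) - dim X\<close>, which is larger when \<open>dim X < dim L\<close>.\<close>
    let ?Q = "{x\<in>L. \<forall>u\<in>X. \<omega> u x = 0}"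
    have sQ: "subspace ?Q" by (rule subspace_annihilator[OF bil sL])
    have "{u\<in>X. \<forall>x\<in>L. \<omega> u x = 0} \<subseteq> X \<inter> L"
    proof safe
      fix u assume "\<forall>x\<in>L. \<omega> u x = 0"
      then show "u \<in> L" using skew[of _ u] by (intro lagrangian_maximal[OF L]) simp
    qed
    then have "{u\<in>X. \<forall>x\<in>L. \<omega> u x = 0} \<subseteq> {0}" using X(3) by (rule order_trans)
    then have "dim {u\<in>X. \<forall>x\<in>L. \<omega> u x = 0} = 0" by (simp add: dim_eq_0)
    then have dQ: "dim ?Q + dim X = dim L" using dim_annihilator[OF bil X(1) sL] by simp
    have "dim (sum_space X ?Q) + dim (X \<inter> ?Q) = dim X + dim ?Q" by (rule dim_sums_Int[OF X(1) sQ])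
    then have "dim (sum_space X ?Q) < dim ?P"
      using dP dQ lagrangian_dim[OF L] lt by linarith
    then have "\<not> ?P \<subseteq> sum_space X ?Q" using dim_subset[of ?P "sum_space X ?Q"] by linarith
    then obtain v where v: "v \<in> ?P" "v \<notin> sum_space X ?Q" by blast
    have nv: "v \<noteq> x + l" if "x \<in> X" "l \<in> L" for x l
    proof
      assume e: "v = x + l"
      have "\<omega> u l = 0" if u: "u \<in> X" for u
      proof -
        have "\<omega> u v = 0" using v(1) u by auto
        then show ?thesis using e X(2)[OF u \<open>x \<in> X\<close>] by (simp add: omega_simps)
      qed
      then have "l \<in> ?Q" using that by auto
      then show False using v(2) e that by blast
    qed
    let ?Y = "sum_space X (span {v})"
    have vX: "v \<notin> X" using nv[of v 0] subspace_0[OF sL] by auto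
    have "dim ?Y \<in> A" unfolding A_def
    proof (intro CollectI exI[of _ ?Y] conjI refl ballI)
      show "subspace ?Y" by (intro subspace_sums X subspace_span)
      fix y z assume "y \<in> ?Y" "z \<in> ?Y"
      then obtain x c x' c' where yz: "y = x + c *\<^sub>R v" "z = x' + c' *\<^sub>R v" "x \<in> X" "x' \<in> X"
        by (auto simp: span_singleton)
      have "\<omega> x v = 0" "\<omega> x' v = 0" "\<omega> x x' = 0" using v(1) yz X(2) by auto
      then show "\<omega> y z = 0" using skew[of v x'] by (simp add: yz omega_simps)
    next
      show "?Y \<inter> L \<subseteq> {0}"
      proof
        fix y assume y: "y \<in> ?Y \<inter> L"
        then obtain x c where e: "y = x + c *\<^sub>R v" "x \<in> X" by (auto simp: span_singleton)
        have "c = 0"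
        proof (rule ccontr)
          assume c: "c \<noteq> 0"
          have "v = (- inverse c) *\<^sub>R x + inverse c *\<^sub>R y" using c e by (simp add: algebra_simps)
          moreover have "(- inverse c) *\<^sub>R x \<in> X" "inverse c *\<^sub>R y \<in> L"
            using e y X(1) sL by (auto intro: subspace_scale subspace_neg)
          ultimately show False using nv by blast
        qed
        then show "y \<in> {0}" using e y X(3) by auto
      qed
    qed
    then have "dim ?Y \<le> dim X" using X(4) fin by simp
    moreover have "X \<subseteq> ?Y" by (force intro: span_zero)
    ultimately have "X = ?Y" by (intro subspace_dim_equal X subspace_sums subspace_span) auto
    moreover have "v \<in> ?Y" using subspace_0[OF X(1)] span_base[of v "{v}"] by force
    ultimately show False using vX by blast
  qed
  then have "dim X = dim L" using le by simp
  then have "lagrangian \<omega> X" using X lagrangian_dim[OF L] by (auto simp: lagrangian_def)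
  moreover have "X \<inter> L = {0}" using X(1,3) sL subspace_0 by blast
  ultimately show ?thesis using that L by (auto simp: transversal_def)
qed

section \<open>Projections along a transversal Lagrangian\<close>

definition proj :: "'v set \<Rightarrow> 'v set \<Rightarrow> 'v \<Rightarrow> 'v" where
  "proj W L x = (THE y. y \<in> L \<and> x - y \<in> W)"

context
  fixes W L assumes tr: "transversal W L"
begin

lemma transversal_lagrangian: "lagrangian \<omega> W" "lagrangian \<omega> L"
  and transversal_subspace: "subspace W" "subspace L"
  and transversal_Int: "x \<in> W \<Longrightarrow> x \<in> L \<Longrightarrow> x = 0"
  using tr by (auto simp: transversal_def lagrangian_subspace)

lemma proj_unique: "y \<in> L \<Longrightarrow> x - y \<in> W \<Longrightarrow> proj W L x = y"
  unfolding proj_def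
proof (rule the_equality)
  fix z assume y: "y \<in> L" "x - y \<in> W" and z: "z \<in> L \<and> x - z \<in> W"
  have "z - y \<in> L" using y z transversal_subspace by (simp add: subspace_diff)
  moreover have "(x - y) - (x - z) \<in> W"
    using subspace_diff[OF transversal_subspace(1) y(2), of "x - z"] z by blast
  ultimately show "z = y" using transversal_Int[of "z - y"] by simp
qed simp

lemma transversal_sum: "sum_space L W = UNIV"
proof (rule subspace_dim_equal)
  show "subspace (sum_space L W)" using transversal_subspace by (intro subspace_sums)
  have "dim (sum_space L W) + dim (L \<inter> W) = dim L + dim W"
    using transversal_subspace by (intro dim_sums_Int)
  moreover have "dim (L \<inter> W) = 0" using transversal_Int by (auto simp: dim_eq_0)
  ultimately show "dim (UNIV :: 'v set) \<le> dim (sum_space L W)"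
    using lagrangian_dim[OF transversal_lagrangian(1)] lagrangian_dim[OF transversal_lagrangian(2)]
    by simp
qed auto

lemma proj_in: "proj W L x \<in> L" and proj_diff_in: "x - proj W L x \<in> W"
proof -
  have "x \<in> sum_space L W" using transversal_sum by simp
  then obtain y w where "x = y + w" "y \<in> L" "w \<in> W" by blast
  then have "y \<in> L" "x - y \<in> W" by auto
  moreover from this have "proj W L x = y" by (rule proj_unique)
  ultimately show "proj W L x \<in> L" "x - proj W L x \<in> W" by auto
qed

lemma proj_id: "x \<in> L \<Longrightarrow> proj W L x = x"
  using transversal_subspace by (intro proj_unique) (auto simp: subspace_0)

lemma proj_zero: "x \<in> W \<Longrightarrow> proj W L x = 0"
  using transversal_subspace by (intro proj_unique) (auto simp: subspace_0)

lemma linear_proj: "linear (proj W L)"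
proof (rule linearI)
  fix x y c
  have "(x + y) - (proj W L x + proj W L y) = (x - proj W L x) + (y - proj W L y)" by simp
  also have "\<dots> \<in> W" by (intro subspace_add transversal_subspace proj_diff_in)
  finally show "proj W L (x + y) = proj W L x + proj W L y"
    by (intro proj_unique subspace_add transversal_subspace proj_in)
  have "c *\<^sub>R x - c *\<^sub>R proj W L x = c *\<^sub>R (x - proj W L x)" by (simp add: scaleR_diff_right)
  also have "\<dots> \<in> W" by (intro subspace_scale transversal_subspace proj_diff_in)
  finally show "proj W L (c *\<^sub>R x) = c *\<^sub>R proj W L x"
    by (intro proj_unique subspace_scale transversal_subspace proj_in)
qed

lemma proj_bounded: obtains K where "K > 0" "\<And>x. norm (proj W L x) \<le> K * norm x"
  using linear_bounded_pos[OF linear_proj] by blast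

text \<open>\<omega> vanishes on two vectors of \<open>L\<close> and on two vectors of
  \<open>W\<close>. In other words, the projection and its \<omega>-adjoint add up to the
  identity.\<close>

lemma omega_proj: "\<omega> x (proj W L y) + \<omega> (proj W L x) y = \<omega> x y"
proof -
  let ?P = "proj W L"
  have "\<omega> (x - ?P x) (y - ?P y) = 0"
    by (intro lagrangian_isotropic[OF transversal_lagrangian(1)] proj_diff_in)
  moreover have "\<omega> (?P x) (?P y) = 0"
    by (intro lagrangian_isotropic[OF transversal_lagrangian(2)] proj_in)
  ultimately show ?thesis by (simp add: omega_simps)
qed

lemma omega_proj_skew: "\<omega> x (proj W L y) - \<omega> y (proj W L x) = \<omega> x y"
  using omega_proj[of x y] skew[of "proj W L x" y] by simp

lemma bilinear_proj: "bilinear (\<lambda>x y. \<omega> x (proj W L y))"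
  using bilinear_compose[OF bil linear_ident linear_proj] by simp

text \<open>The failure of symmetry is exactly \<open>\<omega> x y\<close>, which vanishes on a
  Lagrangian \<open>C\<close>. This is why \<open>sym_on\<close> asks for symmetry on the subspace
  only.\<close>

lemma sym_on_proj:
  assumes C: "lagrangian \<omega> C"
  shows "sym_on (\<lambda>x y. \<omega> x (proj W L y)) C"
  unfolding sym_on_def
proof (intro conjI ballI bilinear_proj lagrangian_subspace[OF C])
  fix x y assume "x \<in> C" "y \<in> C"
  then have "\<omega> x y = 0" using lagrangian_isotropic[OF C] by simp
  then show "\<omega> x (proj W L y) = \<omega> y (proj W L x)" using omega_proj_skew[of x y] by simp
qed

text \<open>For \<open>x\<close> in the radical, its projection is \<omega>-orthogonal to
  \<open>C\<close> and hence in \<open>C\<close> by maximality; then both components of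
  \<open>x\<close> lie in \<open>C\<close>.\<close>

lemma radical_proj:
  assumes C: "lagrangian \<omega> C"
  shows "radical (\<lambda>x y. \<omega> x (proj W L y)) C = sum_space (C \<inter> L) (C \<inter> W)"
proof (intro equalityI subsetI)
  let ?P = "proj W L"
  have sym: "\<omega> x (?P y) = \<omega> y (?P x)" if "x \<in> C" "y \<in> C" for x y
    using sym_on_proj[OF C] that by (auto simp: sym_on_def)
  {
    fix x assume x: "x \<in> radical (\<lambda>x y. \<omega> x (?P y)) C"
    then have xC: "x \<in> C" by (simp add: radical_def)
    have "?P x \<in> C"
      by (rule lagrangian_maximal[OF C]) (use x xC sym in \<open>auto simp: radical_def\<close>)
    then have "?P x \<in> C \<inter> L" "x - ?P x \<in> C \<inter> W"
      using proj_in proj_diff_in xC lagrangian_subspace[OF C] by (auto intro: subspace_diff)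
    moreover have "x = ?P x + (x - ?P x)" by simp
    ultimately show "x \<in> sum_space (C \<inter> L) (C \<inter> W)" by blast
  }
  {
    fix x assume "x \<in> sum_space (C \<inter> L) (C \<inter> W)"
    then obtain y w where x: "x = y + w" "y \<in> C" "y \<in> L" "w \<in> C" "w \<in> W" by blast
    then have xC: "x \<in> C" using lagrangian_subspace[OF C] by (auto intro: subspace_add)
    have "?P x = y" using x by (intro proj_unique) auto
    then have "\<omega> x (?P z) = 0" if "z \<in> C" for z
      using sym[OF xC that] lagrangian_isotropic[OF C that x(2)] by simp
    then show "x \<in> radical (\<lambda>x y. \<omega> x (?P y)) C" using xC by (auto simp: radical_def)
  }
qed

lemma dim_Int_sum:
  assumes C: "subspace C" and M: "subspace M" "M \<subseteq> L"
  shows "dim (sum_space (C \<inter> M) (C \<inter> W)) = dim (C \<inter> M) + dim (C \<inter> W)"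
proof -
  have "(C \<inter> M) \<inter> (C \<inter> W) \<subseteq> {0}" using transversal_Int M(2) by auto
  then have "dim ((C \<inter> M) \<inter> (C \<inter> W)) = 0" by (simp add: dim_eq_0)
  moreover have "dim (sum_space (C \<inter> M) (C \<inter> W)) + dim ((C \<inter> M) \<inter> (C \<inter> W)) = dim (C \<inter> M) + dim (C \<inter> W)"
    using C M(1) transversal_subspace by (intro dim_sums_Int subspace_inter)
  ultimately show ?thesis by linarith
qed

lemma dim_radical_proj:
  assumes C: "lagrangian \<omega> C"
  shows "dim (radical (\<lambda>x y. \<omega> x (proj W L y)) C) = dim (C \<inter> L) + dim (C \<inter> W)"
  unfolding radical_proj[OF C]
  using dim_Int_sum[OF lagrangian_subspace[OF C] transversal_subspace(2)] by simp

end

lemma proj_swap: "transversal W L \<Longrightarrow> proj L W x = x - proj W L x"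
  by (rule proj_unique[OF transversal_sym]) (auto simp: proj_in proj_diff_in)

section \<open>Chart indices and the triple index\<close>

definition chart_index :: "'v set \<Rightarrow> 'v set \<Rightarrow> 'v set \<Rightarrow> nat" where
  "chart_index C W L = pos_index (\<lambda>x. \<omega> x (proj W L x)) C"

text \<open>Exchanging kernel and image replaces the projection by its complement, and
  \<open>\<omega> x x = 0\<close>, so the form on \<open>C\<close> changes sign. Inertia then
  relates the two indices.\<close>

lemma chart_index_swap:
  assumes tr: "transversal W L" and C: "lagrangian \<omega> C"
  shows "chart_index C W L + chart_index C L W + dim (C \<inter> L) + dim (C \<inter> W) = dim C"
proof -
  have "chart_index C L W = neg_index (\<lambda>x. \<omega> x (proj W L x)) C"
    unfolding chart_index_def neg_index_def
    by (intro pos_index_cong) (simp add: proj_swap[OF tr] omega_simps)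
  then show ?thesis
    using pos_neg_radical_dim[OF sym_on_proj[OF tr C]] dim_radical_proj[OF tr C]
    unfolding chart_index_def by simp
qed

text \<open>Two decompositions differ by a vector of \<open>\<beta> \<inter> \<gamma>\<close>, which
  is \<omega>-orthogonal to both spaces, so the choice made by \<open>SOME\<close> does not
  matter.\<close>

lemma triple_Q_eq:
  assumes B: "lagrangian \<omega> \<beta>" "lagrangian \<omega> \<gamma>" and y: "y \<in> \<beta>" "z \<in> \<gamma>"
  shows "triple_Q \<omega> \<beta> \<gamma> (y + z) = \<omega> y z"
proof -
  let ?S = "SOME (y', z'). y' \<in> \<beta> \<and> z' \<in> \<gamma> \<and> y + z = y' + z'"
  have "case ?S of (y', z') \<Rightarrow> y' \<in> \<beta> \<and> z' \<in> \<gamma> \<and> y + z = y' + z'"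
    by (rule someI[of _ "(y, z)"]) (use y in simp)
  then obtain y' z' where S: "?S = (y', z')" and e: "y' \<in> \<beta>" "z' \<in> \<gamma>" "y + z = y' + z'"
    by (cases ?S) auto
  have "y - y' = z' - z" using e(3) by (simp add: algebra_simps)
  moreover have b: "y - y' \<in> \<beta>" and "z' - z \<in> \<gamma>"
    using y e B by (auto intro: subspace_diff dest: lagrangian_subspace)
  ultimately have "y - y' \<in> \<beta>" "y - y' \<in> \<gamma>" by simp_all
  then have "\<omega> (y - y') y' = 0" "\<omega> (y - y') z' = 0"
    using B e y lagrangian_isotropic by blast+
  then have "\<omega> y (y' + z') = \<omega> y' (y' + z')" by (simp add: omega_simps)
  moreover have "\<omega> y (y' + z') = \<omega> y z"
    unfolding e(3)[symmetric] by (simp add: omega_simps)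
  moreover have "\<omega> y' (y' + z') = \<omega> y' z'" by (simp add: omega_simps)
  ultimately show ?thesis unfolding triple_Q_def S by simp
qed

text \<open>\<open>A\<close> is isotropic, so \<open>triple_Q\<close> vanishes on
  \<open>(A \<inter> B) + (A \<inter> C)\<close>; the dimension of this space absorbs the two
  correction terms of the triple index. Hypothesis (2) of the theorem says that the bound is
  attained.\<close>

lemma triple_index_le:
  assumes L: "lagrangian \<omega> A" "lagrangian \<omega> B" "lagrangian \<omega> C"
  shows "triple_index \<omega> A B C \<le> int (dim A) - int (dim (A \<inter> B))"
proof -
  let ?S = "A \<inter> sum_space B C" and ?Z = "sum_space (A \<inter> B) (A \<inter> C)"
  have s: "subspace A" "subspace B" "subspace C" using L by (auto dest: lagrangian_subspace)
  have sS: "subspace ?S" using s by (intro subspace_inter subspace_sums)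
  have "pos_index (triple_Q \<omega> B C) ?S + dim ?Z \<le> dim ?S"
  proof (rule pos_index_add_nonpos_le[OF sS])
    show "subspace ?Z" using s by (intro subspace_sums subspace_inter)
    show "?Z \<subseteq> ?S" using s(1) by (auto intro: subspace_add)
    fix v assume "v \<in> ?Z"
    then obtain y z where v: "v = y + z" "y \<in> A" "y \<in> B" "z \<in> A" "z \<in> C" by auto
    then show "triple_Q \<omega> B C v \<le> 0"
      using lagrangian_isotropic[OF L(1)] by (simp add: triple_Q_eq[OF L(2,3)])
  qed
  moreover have "dim ?S \<le> dim A" by (rule dim_subset) auto
  moreover have "dim ?Z + dim ((A \<inter> B) \<inter> (A \<inter> C)) = dim (A \<inter> B) + dim (A \<inter> C)"
    using s by (intro dim_sums_Int subspace_inter)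
  moreover have "(A \<inter> B) \<inter> (A \<inter> C) = A \<inter> B \<inter> C" by auto
  ultimately show ?thesis unfolding triple_index_def by simp
qed

text \<open>Each projection form fails to be symmetric by the same amount
  \<open>\<omega> x y\<close>, so the difference is symmetric on the whole space, with no reference
  to a third Lagrangian.\<close>

definition diff_form :: "'v set \<Rightarrow> 'v set \<Rightarrow> 'v set \<Rightarrow> 'v \<Rightarrow> 'v \<Rightarrow> real" where
  "diff_form X A B x y = \<omega> x (proj X A y - proj X B y)"

context
  fixes X A B assumes A: "transversal X A" and B: "transversal X B"
begin

lemma sym_on_diff_form: "sym_on (diff_form X A B) UNIV"
  unfolding sym_on_def
proof (intro conjI ballI subspace_UNIV)
  have "linear (\<lambda>y. proj X A y - proj X B y)"
    by (intro linear_compose_sub linear_proj A B)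
  then show "bilinear (diff_form X A B)"
    unfolding diff_form_def by (rule bilinear_compose[OF bil linear_ident])
  show "diff_form X A B x y = diff_form X A B y x" for x y
    using omega_proj_skew[OF A, of x y] omega_proj_skew[OF B, of x y]
    by (simp add: diff_form_def omega_simps)
qed

text \<open>By nondegeneracy of \<omega> the radical is the set where the two projections agree. As
  \<open>X\<close> is Lagrangian, the nullity can vary only with
  \<open>dim (A \<inter> B)\<close>.\<close>

lemma radical_diff_form: "radical (diff_form X A B) UNIV = sum_space (A \<inter> B) X"
proof (intro equalityI subsetI)
  have sym: "diff_form X A B x y = diff_form X A B y x" for x y
    using sym_on_diff_form by (simp add: sym_on_def)
  {
    fix x assume "x \<in> radical (diff_form X A B) UNIV"
    then have "\<omega> y (proj X A x - proj X B x) = 0" for y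
      using sym[of x y] by (simp add: radical_def diff_form_def)
    then have "proj X A x = proj X B x" using nondeg_right by fastforce
    then have "proj X A x \<in> A \<inter> B" using proj_in[OF A, of x] proj_in[OF B, of x] by simp
    moreover have "x - proj X A x \<in> X" by (rule proj_diff_in[OF A])
    moreover have "x = proj X A x + (x - proj X A x)" by simp
    ultimately show "x \<in> sum_space (A \<inter> B) X" by blast
  }
  {
    fix x assume "x \<in> sum_space (A \<inter> B) X"
    then obtain a w where x: "x = a + w" "a \<in> A" "a \<in> B" "w \<in> X" by blast
    have "proj X A x = a" "proj X B x = a" using x by (auto intro: proj_unique[OF A] proj_unique[OF B])
    then have "diff_form X A B y x = 0" for y by (simp add: diff_form_def omega_simps)
    then show "x \<in> radical (diff_form X A B) UNIV" using sym by (simp add: radical_def)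
  }
qed

lemma dim_radical_diff_form:
  "dim (radical (diff_form X A B) UNIV) = dim (A \<inter> B) + dim X"
  unfolding radical_diff_form
  using dim_Int_sum[OF A subspace_UNIV, of "A \<inter> B"] transversal_subspace[OF A] transversal_subspace[OF B]
  by (simp add: subspace_inter)

text \<open>On the sum of \<open>V\<close> and \<open>C\<close>, the form \<open>(v, c) \<mapsto> diff_form v v + \<omega> c (P\<^sub>B c)\<close> restricts to
  \<open>\<omega> c (P\<^sub>A c)\<close> on the diagonal copy of \<open>C\<close>, and to a pullback of \<open>triple_Q\<close> on the orthogonal
  complement of that diagonal.\<close>

theorem triple_index_cocycle:
  assumes C: "lagrangian \<omega> C"
  shows "int (chart_index C X A) - int (chart_index C X B) + triple_index \<omega> A B C =
    int (form_index (diff_form X A B) UNIV)"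
proof -
  let ?PA = "proj X A" and ?PB = "proj X B" and ?R = "diff_form X A B"
  let ?p = "\<lambda>x y. \<omega> x (?PB y)"
  define \<Phi> where "\<Phi> p q = ?R (fst p) (fst q) + ?p (snd p) (snd q)" for p q :: "'v \<times> 'v"
  define E where "E = (UNIV :: 'v set) \<times> C"
  define d where "d = (\<lambda>c::'v. (c, c))"
  define F where "F = d ` C"
  define F' where "F' = {x\<in>E. \<forall>f\<in>F. \<Phi> f x = 0}"
  have sC: "subspace C" by (rule lagrangian_subspace[OF C])
  have sym: "sym_on ?R UNIV" "sym_on ?p C" by (rule sym_on_diff_form, rule sym_on_proj[OF B C])
  have blR: "bilinear ?R" using sym(1) by (simp add: sym_on_def)
  have sE: "subspace E" unfolding E_def by (intro subspace_Times subspace_UNIV sC)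
  have bl\<Phi>: "bilinear \<Phi>"
    unfolding \<Phi>_def
    by (intro bilinear_add bilinear_compose[OF blR] bilinear_compose[OF bilinear_proj[OF B]]
        linear_fst linear_snd)
  have sym\<Phi>: "sym_on \<Phi> E"
    using bl\<Phi> sE sym unfolding sym_on_def \<Phi>_def E_def by auto
  have ld: "linear d" unfolding d_def by (rule linearI) auto
  have injd: "inj_on d S" for S by (auto simp: d_def inj_on_def)
  have dimd: "dim (d ` S) = dim S" for S
    by (rule dim_image_eq[OF ld injd])
  have sF: "subspace F" unfolding F_def by (rule linear_subspace_image[OF ld sC])
  have FE: "F \<subseteq> E" by (auto simp: F_def E_def d_def)
  have \<Phi>d: "\<Phi> (d c) q = \<omega> c (?PA (fst q) - ?PB (fst q) + ?PB (snd q))" for c q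
    by (simp add: \<Phi>_def d_def diff_form_def omega_simps)
  have main: "form_index \<Phi> E + dim (F \<inter> radical \<Phi> E) =
    form_index \<Phi> F + form_index \<Phi> F' + dim (radical \<Phi> F)"
    unfolding F'_def by (rule pos_index_orthogonal_decomp[OF sym\<Phi> sF FE])
  have 1: "form_index \<Phi> E = form_index ?R UNIV + chart_index C X B"
    unfolding \<Phi>_def E_def chart_index_def by (rule pos_index_Times[OF sym])
  have 2: "form_index \<Phi> F = chart_index C X A"
  proof -
    have "pos_index (\<lambda>c. \<Phi> (d c) (d c)) C = form_index \<Phi> F"
      unfolding F_def by (rule pos_index_linear_pullback[OF ld sC]) (simp add: bilinear_lzero[OF bl\<Phi>])
    moreover have "\<Phi> (d c) (d c) = \<omega> c (?PA c)" for c unfolding \<Phi>d by (simp add: d_def)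
    ultimately show ?thesis by (simp add: chart_index_def)
  qed
  have 3: "dim (radical \<Phi> F) = dim (C \<inter> A) + dim (C \<inter> X)"
  proof -
    have "radical \<Phi> F = d ` radical (\<lambda>x y. \<omega> x (?PA y)) C"
      unfolding radical_def F_def by (auto simp: \<Phi>d) (auto simp: d_def)
    then show ?thesis by (simp add: dimd dim_radical_proj[OF A C])
  qed
  have 4: "dim (F \<inter> radical \<Phi> E) = dim (A \<inter> B \<inter> C) + dim (C \<inter> X)"
  proof -
    \<comment> \<open>Testing against vectors with one zero component separates the two summands of
      \<Phi>.\<close>
    have m: "c \<in> radical ?R UNIV \<and> c \<in> radical ?p C" if c: "c \<in> C" "d c \<in> radical \<Phi> E" for c
    proof -
      have "\<Phi> (d c) (v, 0) = 0" for v using c subspace_0[OF sC] by (auto simp: radical_def E_def)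
      then have "?R c v = 0" for v
        by (simp add: \<Phi>_def d_def proj_zero[OF B subspace_0[OF transversal_subspace(1)[OF B]]] omega_simps)
      moreover have "\<Phi> (d c) (0, v) = 0" if "v \<in> C" for v using c that by (auto simp: radical_def E_def)
      then have "?p c v = 0" if "v \<in> C" for v
        using that by (simp add: \<Phi>_def d_def bilinear_rzero[OF blR])
      ultimately show ?thesis using c by (auto simp: radical_def)
    qed
    have "F \<inter> radical \<Phi> E = d ` (radical ?R UNIV \<inter> radical ?p C)"
    proof (intro equalityI subsetI)
      fix z assume "z \<in> F \<inter> radical \<Phi> E"
      then show "z \<in> d ` (radical ?R UNIV \<inter> radical ?p C)" using m by (auto simp: F_def)
    next
      fix z assume "z \<in> d ` (radical ?R UNIV \<inter> radical ?p C)"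
      then show "z \<in> F \<inter> radical \<Phi> E"
        by (auto simp: F_def E_def radical_def \<Phi>_def d_def)
    qed
    also have "radical ?R UNIV \<inter> radical ?p C = sum_space (C \<inter> (A \<inter> B)) (C \<inter> X)"
      unfolding radical_diff_form radical_proj[OF B C]
    proof (intro equalityI subsetI)
      fix x assume "x \<in> sum_space (A \<inter> B) X \<inter> sum_space (C \<inter> B) (C \<inter> X)"
      then obtain a w b z where x: "x = a + w" "a \<in> A" "a \<in> B" "w \<in> X"
        and x': "x = b + z" "b \<in> C" "b \<in> B" "z \<in> C" "z \<in> X" by blast
      have "?PB x = a" using x by (intro proj_unique[OF B]) auto
      moreover have "?PB x = b" using x' by (intro proj_unique[OF B]) auto
      ultimately show "x \<in> sum_space (C \<inter> (A \<inter> B)) (C \<inter> X)" using x x' by blast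
    qed blast
    also have "dim (d ` sum_space (C \<inter> (A \<inter> B)) (C \<inter> X)) = dim (C \<inter> (A \<inter> B)) + dim (C \<inter> X)"
      unfolding dimd
      using transversal_subspace[OF A] transversal_subspace[OF B]
      by (intro dim_Int_sum[OF A sC] subspace_inter) auto
    finally show ?thesis by (simp add: Int_commute Int_left_commute)
  qed
  have 5: "form_index \<Phi> F' = pos_index (triple_Q \<omega> B C) (A \<inter> sum_space B C)"
  proof -
    \<comment> \<open>For \<open>(v, c)\<close> in \<open>F'\<close> the vector \<open>?PA v\<close>
      splits as \<open>(?PB v - ?PB c) + (?PA v - ?PB v + ?PB c)\<close>, with parts in
      \<open>B\<close> and in \<open>C\<close>, so \<open>g\<close> takes values in the domain of
      \<open>triple_Q\<close>. Surjectivity comes from the pairs \<open>(a, c)\<close> with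
      \<open>a = b + c\<close>.\<close>
    define g where "g p = ?PA (fst p)" for p :: "'v \<times> 'v"
    have lg: "linear g" unfolding g_def
      using linear_compose[OF linear_fst linear_proj[OF A]] by (simp add: o_def)
    have sF': "subspace F'" unfolding F'_def by (rule subspace_annihilator[OF bl\<Phi> sE])
    have LB: "lagrangian \<omega> B" by (rule transversal_lagrangian(2)[OF B])
    have sB: "subspace B" by (rule lagrangian_subspace[OF LB])
    \<comment> \<open>Orthogonality to the diagonal copy of \<open>C\<close> means membership in
      \<open>C\<close>, because \<open>C\<close> equals its \<omega>-annihilator.\<close>
    have F'C: "p \<in> F' \<longleftrightarrow> snd p \<in> C \<and> ?PA (fst p) - ?PB (fst p) + ?PB (snd p) \<in> C" for p
      unfolding F'_def E_def F_def
      by (cases p) (auto simp: \<Phi>d intro: lagrangian_maximal[OF C] lagrangian_isotropic[OF C])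
    have im: "g ` F' = A \<inter> sum_space B C"
    proof (intro equalityI subsetI)
      fix a assume "a \<in> g ` F'"
      then obtain p where p: "p \<in> F'" "a = ?PA (fst p)" by (auto simp: g_def)
      let ?b = "?PB (fst p) - ?PB (snd p)"
      have "?b \<in> B" by (intro subspace_diff sB proj_in[OF B])
      moreover have "a - ?b \<in> C" using p F'C[of p] by (simp add: algebra_simps)
      moreover have "a = ?b + (a - ?b)" by simp
      ultimately have "a \<in> sum_space B C" by blast
      then show "a \<in> A \<inter> sum_space B C" using p proj_in[OF A] by simp
    next
      fix a assume "a \<in> A \<inter> sum_space B C"
      then obtain b c where a: "a \<in> A" "a = b + c" "b \<in> B" "c \<in> C" by blast
      have "?PB c = ?PB (a - b)" using a by simp
      also have "\<dots> = ?PB a - b" using a(3) by (simp only: linear_diff[OF linear_proj[OF B]] proj_id[OF B])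
      finally have "?PA a - ?PB a + ?PB c = c" using a by (simp add: proj_id[OF A])
      then have "(a, c) \<in> F'" using F'C[of "(a, c)"] a by simp
      moreover have "g (a, c) = a" using a by (simp add: g_def proj_id[OF A])
      ultimately show "a \<in> g ` F'" by (metis imageI)
    qed
    have q: "\<Phi> p p = triple_Q \<omega> B C (g p)" if "p \<in> F'" for p
    proof -
      obtain v c where p: "p = (v, c)" by (cases p)
      let ?a = "?PA v" and ?b = "?PB c - ?PB v"
      have c: "c \<in> C" "?a + ?b \<in> C" using that F'C[of p] by (auto simp: p algebra_simps)
      have bB: "?b \<in> B" by (intro subspace_diff sB proj_in[OF B])
      have "?a = - ?b + (?a + ?b)" by simp
      then have "triple_Q \<omega> B C ?a = \<omega> (- ?b) (?a + ?b)"
        using triple_Q_eq[OF LB C subspace_neg[OF sB bB] c(2)] by simp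
      also have "\<dots> = - \<omega> ?b ?a - \<omega> ?b ?b"
        by (simp only: bilinear_lneg[OF bil] bilinear_radd[OF bil] minus_add_distrib add_uminus_conv_diff)
      also have "\<dots> = \<omega> ?a ?b" by (simp only: skew[of ?b ?a] omega_self minus_minus diff_0_right)
      finally have t: "triple_Q \<omega> B C (g p) = \<omega> ?a ?b" by (simp add: g_def p)
      have va: "?PB v = ?PB ?a"
      proof -
        have "?PB (v - ?a) = 0" by (intro proj_zero[OF B] proj_diff_in[OF A])
        then show ?thesis by (simp add: linear_diff[OF linear_proj[OF B]])
      qed
      have "\<omega> (v - ?a) (?a - ?PB v) = 0"
      proof -
        have "?PB v - ?a = (v - ?a) - (v - ?PB v)" by simp
        also have "\<dots> \<in> X" by (intro subspace_diff transversal_subspace(1)[OF A] proj_diff_in A B)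
        finally have "?a - ?PB v \<in> X" using subspace_neg[OF transversal_subspace(1)[OF A]] by fastforce
        then show ?thesis
          using lagrangian_isotropic[OF transversal_lagrangian(1)[OF A]] proj_diff_in[OF A] by blast
      qed
      then have R: "?R v v = - \<omega> ?a (?PB v)" by (simp add: diff_form_def omega_simps)
      \<comment> \<open>This difference lies in \<open>C\<close> and in \<open>X\<close>, so it is
        \<omega>-orthogonal to \<open>c\<close> and to \<open>c - ?PB c\<close>, hence to
        \<open>?PB c\<close>; when paired with \<open>?PB c\<close>, the vector \<open>c\<close> may
        be replaced by \<open>?a + ?b\<close>.\<close>
      have cx: "c - (?a + ?b) \<in> C \<inter> X"
      proof -
        have "c - (?a + ?b) = (c - ?PB c) - (?a - ?PB ?a)" using va by simp
        also have "\<dots> \<in> X" by (intro subspace_diff transversal_subspace(1)[OF A] proj_diff_in B)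
        finally show ?thesis using c sC by (auto intro: subspace_diff)
      qed
      then have "\<omega> (c - (?a + ?b)) (?PB c) = 0"
      proof -
        have "\<omega> (c - (?a + ?b)) c = 0" using lagrangian_isotropic[OF C] cx c by blast
        moreover have "\<omega> (c - (?a + ?b)) (c - ?PB c) = 0"
          using lagrangian_isotropic[OF transversal_lagrangian(1)[OF B]] cx proj_diff_in[OF B] by blast
        ultimately show ?thesis by (simp add: omega_simps)
      qed
      then have "\<omega> c (?PB c) = \<omega> ?a (?PB c) + \<omega> ?b (?PB c)" by (simp add: omega_simps)
      moreover have "\<omega> ?b (?PB c) = 0" by (intro lagrangian_isotropic[OF LB] bB proj_in[OF B])
      ultimately have "\<Phi> p p = - \<omega> ?a (?PB v) + \<omega> ?a (?PB c)" using R by (simp add: \<Phi>_def p)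
      then show ?thesis using t by (simp add: omega_simps)
    qed
    have "triple_Q \<omega> B C (0 + 0) = 0"
      by (subst triple_Q_eq[OF LB C subspace_0[OF sB] subspace_0[OF sC]]) (simp add: omega_simps)
    then have "pos_index (\<lambda>x. triple_Q \<omega> B C (g x)) F' = pos_index (triple_Q \<omega> B C) (g ` F')"
      by (intro pos_index_linear_pullback[OF lg sF']) simp
    then show ?thesis using pos_index_cong[of F' "\<lambda>x. \<Phi> x x"] q im by simp
  qed
  have "A \<inter> C = C \<inter> A" by auto
  then show ?thesis using main 1 2 3 4 5 unfolding triple_index_def by simp
qed

end

end

subsection \<open>Continuity of projections in the gap topology\<close>

text \<open>The gap metric compares unit balls only; scaling extends it to all vectors, and the
  nearest point exists since subspaces are closed.\<close>

lemma subspace_dist_approx: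
  assumes L: "subspace L" and M: "subspace M" and x: "x \<in> L"
  obtains y where "y \<in> M" "norm (x - y) \<le> subspace_dist L M * norm x"
proof (cases "x = 0")
  case True
  then show ?thesis using that[of 0] subspace_0[OF M] by simp
next
  case False
  let ?u = "x /\<^sub>R norm x"
  have u: "?u \<in> L \<inter> cball 0 1" using x L False by (auto intro: subspace_scale)
  have M0: "M \<noteq> {}" using subspace_0[OF M] by auto
  have bdd: "bdd_above ((\<lambda>x. infdist x M) ` (L \<inter> cball 0 1))"
  proof (rule bdd_aboveI2)
    fix z assume "z \<in> L \<inter> cball 0 1"
    then show "infdist z M \<le> 1" using infdist_le2[OF subspace_0[OF M], of z 1] by simp
  qed
  have "infdist ?u M \<le> (SUP x\<in>L \<inter> cball 0 1. infdist x M)" by (rule cSUP_upper[OF u bdd])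
  also have "\<dots> \<le> subspace_dist L M" by (simp add: subspace_dist_def)
  finally have i: "infdist ?u M \<le> subspace_dist L M" .
  obtain y where y: "y \<in> M" "infdist ?u M = dist ?u y"
    using infdist_attains_inf[OF closed_subspace[OF M] M0] by blast
  show ?thesis
  proof (rule that[of "norm x *\<^sub>R y"])
    show "norm x *\<^sub>R y \<in> M" using y M by (auto intro: subspace_scale)
    have "x - norm x *\<^sub>R y = norm x *\<^sub>R (?u - y)" using False by (simp add: scaleR_diff_right)
    then have "norm (x - norm x *\<^sub>R y) = norm x * dist ?u y" by (simp add: dist_norm)
    then show "norm (x - norm x *\<^sub>R y) \<le> subspace_dist L M * norm x"
      using i y(2) by (simp add: mult.commute mult_left_mono)
  qed
qed

context symplectic
begin

text \<open>The projection \<open>P\<close> onto \<open>L0\<close> along \<open>W\<close> almost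
  fixes the vectors of a nearby \<open>L\<close>, so it kills no nonzero one, which is
  transversality. For \<open>y = proj W L x\<close> one has \<open>P y = P x\<close>, so
  \<open>y\<close> is close to \<open>P x\<close>.\<close>

lemma proj_continuous:
  assumes tr: "transversal W L0" and e: "e > 0"
  obtains d where "d > 0" "\<And>L. lagrangian \<omega> L \<Longrightarrow> subspace_dist L L0 < d \<Longrightarrow> transversal W L"
    "\<And>L x. lagrangian \<omega> L \<Longrightarrow> subspace_dist L L0 < d \<Longrightarrow> norm (proj W L x - proj W L0 x) \<le> e * norm x"
proof -
  let ?P = "proj W L0"
  obtain K where K: "K > 0" "\<And>x. norm (?P x) \<le> K * norm x" using proj_bounded[OF tr] by blast
  define c where "c = K + 1"
  have c: "c > 0" using K by (simp add: c_def)
  \<comment> \<open>\<open>c\<close> bounds the identity minus the projection. The first bound gives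
    \<open>c * d \<le> 1 / 2\<close>, hence transversality and
    \<open>norm y \<le> 2 * norm (P x)\<close>; the second makes the final error at most
    \<open>e * norm x\<close>.\<close>
  define d where "d = min (1 / (2 * c)) (e / (2 * K * c))"
  have d: "d > 0" "c * d \<le> 1 / 2" "2 * K * (c * d) \<le> e"
  proof -
    show "d > 0" using c K e by (simp add: d_def)
    have "d \<le> 1 / (2 * c)" "d \<le> e / (2 * K * c)" by (auto simp: d_def)
    then show "c * d \<le> 1 / 2" "2 * K * (c * d) \<le> e" using c K by (auto simp: field_simps)
  qed
  have key: "norm (?P y - y) \<le> c * d * norm y"
    if L: "lagrangian \<omega> L" "subspace_dist L L0 < d" and y: "y \<in> L" for L y
  proof -
    obtain z where z: "z \<in> L0" "norm (y - z) \<le> subspace_dist L L0 * norm y"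
      using subspace_dist_approx[OF lagrangian_subspace[OF L(1)] transversal_subspace(2)[OF tr] y] by blast
    have "subspace_dist L L0 * norm y \<le> d * norm y" using L(2) by (intro mult_right_mono) auto
    then have z2: "norm (y - z) \<le> d * norm y" using z(2) by simp
    have "?P y - y = ?P (y - z) - (y - z)"
      using z(1) by (simp add: linear_diff[OF linear_proj[OF tr]] proj_id[OF tr])
    then have "norm (?P y - y) \<le> norm (?P (y - z)) + norm (y - z)" by (metis norm_triangle_ineq4)
    also have "\<dots> \<le> c * norm (y - z)" using K(2)[of "y - z"] by (simp add: c_def algebra_simps)
    also have "\<dots> \<le> c * (d * norm y)" using z2 c by (intro mult_left_mono) auto
    finally show ?thesis by (simp add: mult.assoc)
  qed
  have tr': "transversal W L" if L: "lagrangian \<omega> L" "subspace_dist L L0 < d" for L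
  proof (rule transversalI[OF transversal_lagrangian(1)[OF tr] L(1)])
    fix x assume x: "x \<in> W" "x \<in> L"
    have "norm x \<le> c * d * norm x" using key[OF L x(2)] proj_zero[OF tr x(1)] by simp
    also have "\<dots> \<le> 1 / 2 * norm x" using d by (intro mult_right_mono) auto
    finally show "x = 0" by simp
  qed
  show ?thesis
  proof (rule that[OF d(1) tr'])
    fix L x assume L: "lagrangian \<omega> L" "subspace_dist L L0 < d"
    let ?y = "proj W L x"
    have t: "transversal W L" by (rule tr'[OF L])
    have "?P (x - ?y) = 0" by (rule proj_zero[OF tr proj_diff_in[OF t]])
    then have e1: "?P ?y = ?P x" by (simp add: linear_diff[OF linear_proj[OF tr]])
    then have n: "norm (?P x - ?y) \<le> c * d * norm ?y" using key[OF L proj_in[OF t]] by metis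
    also have "\<dots> \<le> 1 / 2 * norm ?y" using d by (intro mult_right_mono) auto
    finally have "norm ?y \<le> 2 * norm (?P x)"
      using norm_triangle_sub[of ?y "?P x"] by (simp add: norm_minus_commute)
    also have "\<dots> \<le> 2 * (K * norm x)" using K(2) by simp
    finally have "c * d * norm ?y \<le> c * d * (2 * (K * norm x))" using c d by (intro mult_left_mono) auto
    also have "\<dots> = 2 * K * (c * d) * norm x" by simp
    also have "\<dots> \<le> e * norm x" using d by (intro mult_right_mono) auto
    finally show "norm (?y - ?P x) \<le> e * norm x" using n by (simp add: norm_minus_commute)
  qed
qed

text \<open>All three Lagrangians may move, because one application moves \<open>X\<close> with the
  pair fixed and the other moves the pair with \<open>X\<close> fixed.\<close>

lemma pos_index_diff_form_locally_const:
  assumes A: "transversal X A" and B: "transversal X B"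
  obtains e where "e > 0"
    "\<And>X' A' B'. transversal X' A' \<Longrightarrow> transversal X' B' \<Longrightarrow> dim (A' \<inter> B') = dim (A \<inter> B) \<Longrightarrow>
      (\<And>x. norm ((proj X' A' x - proj X' B' x) - (proj X A x - proj X B x)) \<le> e * norm x) \<Longrightarrow>
      form_index (diff_form X' A' B') UNIV = form_index (diff_form X A B) UNIV"
proof -
  obtain e where e: "e > 0" "\<And>B'. sym_on B' UNIV \<Longrightarrow>
      dim (radical B' UNIV) = dim (radical (diff_form X A B) UNIV) \<Longrightarrow>
      (\<And>x. x \<in> UNIV \<Longrightarrow> \<bar>B' x x - diff_form X A B x x\<bar> \<le> e * (norm x)\<^sup>2) \<Longrightarrow>
      form_index B' UNIV = form_index (diff_form X A B) UNIV"
    using pos_index_locally_const[OF sym_on_diff_form[OF A B]] by blast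
  obtain K where K: "K > 0" "\<And>x y. \<bar>\<omega> x y\<bar> \<le> K * norm x * norm y" using omega_bounded by blast
  show ?thesis
  proof (rule that[of "e / K"])
    show "e / K > 0" using e K by simp
    fix X' A' B' assume t: "transversal X' A'" "transversal X' B'" "dim (A' \<inter> B') = dim (A \<inter> B)"
      and n: "\<And>x. norm ((proj X' A' x - proj X' B' x) - (proj X A x - proj X B x)) \<le> e / K * norm x"
    show "form_index (diff_form X' A' B') UNIV = form_index (diff_form X A B) UNIV"
    proof (rule e(2)[OF sym_on_diff_form[OF t(1,2)]])
      have "2 * dim X' = DIM('v)" "2 * dim X = DIM('v)"
        using t(1) A by (auto intro: lagrangian_dim simp: transversal_def)
      then show "dim (radical (diff_form X' A' B') UNIV) = dim (radical (diff_form X A B) UNIV)"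
        by (simp add: dim_radical_diff_form[OF t(1,2)] dim_radical_diff_form[OF A B] t(3))
      fix x
      let ?z = "(proj X' A' x - proj X' B' x) - (proj X A x - proj X B x)"
      have "diff_form X' A' B' x x - diff_form X A B x x = \<omega> x ?z"
        by (simp add: diff_form_def omega_simps)
      then have "\<bar>diff_form X' A' B' x x - diff_form X A B x x\<bar> \<le> K * norm x * norm ?z" using K by simp
      also have "\<dots> \<le> K * norm x * (e / K * norm x)" using n K by (intro mult_left_mono) auto
      also have "\<dots> = e * (norm x)\<^sup>2" using K by (simp add: power2_eq_square)
      finally show "\<bar>diff_form X' A' B' x x - diff_form X A B x x\<bar> \<le> e * (norm x)\<^sup>2" .
    qed
  qed
qed

text \<open>The cocycle identity is applied with the moving \<open>L\<close> in the role of
  \<open>X\<close> and with \<open>W\<close>, \<open>W'\<close> as the pair. Then the triple index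
  and \<open>dim (W \<inter> W')\<close> do not depend on \<open>L\<close>, and after exchanging the
  roles in the chart indices the terms \<open>dim (C \<inter> L)\<close> cancel.\<close>

lemma chart_index_diff_locally_const:
  assumes C: "lagrangian \<omega> C" and W: "transversal W L0" and W': "transversal W' L0"
  obtains d where "d > 0" "\<And>L. lagrangian \<omega> L \<Longrightarrow> subspace_dist L L0 < d \<Longrightarrow>
    int (chart_index C W L) - int (chart_index C W' L) =
    int (chart_index C W L0) - int (chart_index C W' L0)"
proof -
  have t: "transversal L0 W" "transversal L0 W'" using W W' by (auto intro: transversal_sym)
  obtain e where e: "e > 0"
    "\<And>X' A' B'. transversal X' A' \<Longrightarrow> transversal X' B' \<Longrightarrow> dim (A' \<inter> B') = dim (W \<inter> W') \<Longrightarrow>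
      (\<And>x. norm ((proj X' A' x - proj X' B' x) - (proj L0 W x - proj L0 W' x)) \<le> e * norm x) \<Longrightarrow>
      form_index (diff_form X' A' B') UNIV = form_index (diff_form L0 W W') UNIV"
    using pos_index_diff_form_locally_const[OF t] by blast
  obtain d1 where d1: "d1 > 0" "\<And>L. lagrangian \<omega> L \<Longrightarrow> subspace_dist L L0 < d1 \<Longrightarrow> transversal W L"
    "\<And>L x. lagrangian \<omega> L \<Longrightarrow> subspace_dist L L0 < d1 \<Longrightarrow> norm (proj W L x - proj W L0 x) \<le> e / 2 * norm x"
    using proj_continuous[OF W, of "e / 2"] e(1) by auto
  obtain d2 where d2: "d2 > 0" "\<And>L. lagrangian \<omega> L \<Longrightarrow> subspace_dist L L0 < d2 \<Longrightarrow> transversal W' L"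
    "\<And>L x. lagrangian \<omega> L \<Longrightarrow> subspace_dist L L0 < d2 \<Longrightarrow> norm (proj W' L x - proj W' L0 x) \<le> e / 2 * norm x"
    using proj_continuous[OF W', of "e / 2"] e(1) by auto
  show ?thesis
  proof (rule that[of "min d1 d2"])
    show "min d1 d2 > 0" using d1 d2 by simp
    fix L assume L: "lagrangian \<omega> L" "subspace_dist L L0 < min d1 d2"
    have L1: "transversal W L" "transversal W' L" using L d1 d2 by auto
    have L2: "transversal L W" "transversal L W'" using L1 by (auto intro: transversal_sym)
    have "form_index (diff_form L W W') UNIV = form_index (diff_form L0 W W') UNIV"
    proof (rule e(2)[OF L2 refl])
      fix x
      have "(proj L W x - proj L W' x) - (proj L0 W x - proj L0 W' x) =
        (proj W' L x - proj W' L0 x) - (proj W L x - proj W L0 x)"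
        using L1 W W' by (simp add: proj_swap)
      then have "norm ((proj L W x - proj L W' x) - (proj L0 W x - proj L0 W' x)) \<le>
        norm (proj W' L x - proj W' L0 x) + norm (proj W L x - proj W L0 x)"
        by (metis norm_triangle_ineq4)
      also have "\<dots> \<le> e / 2 * norm x + e / 2 * norm x" using L by (intro add_mono d1 d2) auto
      finally show "norm ((proj L W x - proj L W' x) - (proj L0 W x - proj L0 W' x)) \<le> e * norm x"
        by simp
    qed
    then show "int (chart_index C W L) - int (chart_index C W' L) =
      int (chart_index C W L0) - int (chart_index C W' L0)"
      using triple_index_cocycle[OF L2 C] triple_index_cocycle[OF t C]
        chart_index_swap[OF L1(1) C] chart_index_swap[OF L1(2) C]
        chart_index_swap[OF W C] chart_index_swap[OF W' C] by linarith
  qed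
qed

end

subsection \<open>Primitives of the chart indices\<close>

context symplectic
begin

abbreviation offset :: "'v set \<Rightarrow> 'v set \<Rightarrow> ('a \<Rightarrow> 'v set) \<Rightarrow> ('a \<Rightarrow> int) \<Rightarrow> 'a \<Rightarrow> int" where
  "offset C W H M p \<equiv> M p - int (chart_index C W (H p))"

text \<open>The increment of a primitive along a path is the Maslov index of the path with respect to
  \<open>C\<close>.\<close>

definition primitive :: "'v set \<Rightarrow> 'a::metric_space set \<Rightarrow> ('a \<Rightarrow> 'v set) \<Rightarrow> ('a \<Rightarrow> int) \<Rightarrow> bool" where
  "primitive C D H M \<longleftrightarrow> (\<forall>p\<in>D. \<forall>W. transversal W (H p) \<longrightarrow> (\<exists>d>0. \<forall>q\<in>D. dist q p < d \<longrightarrow>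
     offset C W H M q = offset C W H M p))"

lemma primitiveD:
  assumes "primitive C D H M" "p \<in> D" "transversal W (H p)"
  obtains d where "d > 0" "\<And>q. q \<in> D \<Longrightarrow> dist q p < d \<Longrightarrow>
    offset C W H M q = offset C W H M p"
  using assms unfolding primitive_def by blast

text \<open>Near every point both primitives equal the same chart index up to constants, so their
  difference is locally constant.\<close>

lemma primitive_diff_const:
  assumes M: "primitive C D H M" "primitive C D H M'" and D: "connected D"
    and H: "\<And>p. p \<in> D \<Longrightarrow> lagrangian \<omega> (H p)" and pq: "p \<in> D" "q \<in> D"
  shows "M p - M' p = M q - M' q"
proof (rule connected_local_const[OF D pq, of "\<lambda>x. M x - M' x"], intro ballI)
  fix a assume a: "a \<in> D"
  obtain W where W: "transversal W (H a)" using transversal_exists[OF H[OF a]] .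
  obtain d where d: "d > 0" "\<And>q. q \<in> D \<Longrightarrow> dist q a < d \<Longrightarrow>
    offset C W H M q = offset C W H M a"
    using primitiveD[OF M(1) a W] by blast
  obtain d' where d': "d' > 0" "\<And>q. q \<in> D \<Longrightarrow> dist q a < d' \<Longrightarrow>
    offset C W H M' q = offset C W H M' a"
    using primitiveD[OF M(2) a W] by blast
  show "\<forall>\<^sub>F b in at a within D. M a - M' a = M b - M' b"
    unfolding eventually_at
  proof (intro exI[of _ "min d d'"] conjI ballI impI)
    show "0 < min d d'" using d d' by simp
    fix b assume "b \<in> D" "b \<noteq> a \<and> dist b a < min d d'"
    then show "M a - M' a = M b - M' b" using d(2)[of b] d'(2)[of b] by simp
  qed
qed

lemma primitive_subset: "primitive C D H M \<Longrightarrow> D' \<subseteq> D \<Longrightarrow> primitive C D' H M"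
  unfolding primitive_def by (meson subsetD)

lemma primitive_cong:
  assumes "primitive C D H M" "\<And>p. p \<in> D \<Longrightarrow> H p = H' p"
  shows "primitive C D H' M"
  using assms unfolding primitive_def by simp

lemma primitive_compose:
  assumes M: "primitive C D H M" and g: "continuous_on D' g" "g ` D' \<subseteq> D"
  shows "primitive C D' (\<lambda>x. H (g x)) (\<lambda>x. M (g x))"
  unfolding primitive_def
proof (intro ballI allI impI)
  fix p W assume p: "p \<in> D'" and W: "transversal W (H (g p))"
  obtain d where d: "d > 0" "\<And>q. q \<in> D \<Longrightarrow> dist q (g p) < d \<Longrightarrow>
    offset C W H M q = M (g p) - int (chart_index C W (H (g p)))"
    using primitiveD[OF M _ W] p g(2) by blast
  obtain d' where "d' > 0" "\<And>q. q \<in> D' \<Longrightarrow> dist q p < d' \<Longrightarrow> dist (g q) (g p) < d"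
    using g(1) p d(1) unfolding continuous_on_iff by metis
  then show "\<exists>d>0. \<forall>q\<in>D'. dist q p < d \<longrightarrow> M (g q) - int (chart_index C W (H (g q))) =
      M (g p) - int (chart_index C W (H (g p)))"
    using d(2) g(2) by (intro exI[of _ d']) blast
qed

text \<open>On the connected overlap the two primitives differ by a constant, by which
  \<open>M2\<close> is shifted. Since both sets are closed, a point outside one of them has a
  neighbourhood missing it, so the two sets can be treated separately.\<close>

lemma primitive_glue:
  assumes M: "primitive C D1 H M1" "primitive C D2 H M2"
    and D: "closed D1" "closed D2" "connected (D1 \<inter> D2)"
    and H: "\<And>p. p \<in> D1 \<Longrightarrow> lagrangian \<omega> (H p)"
  obtains M where "primitive C (D1 \<union> D2) H M"
proof -
  obtain k where k: "\<And>p. p \<in> D1 \<inter> D2 \<Longrightarrow> M1 p - M2 p = k"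
  proof (cases "D1 \<inter> D2 = {}")
    case False
    then obtain p0 where p0: "p0 \<in> D1 \<inter> D2" by auto
    show ?thesis
    proof (rule that[of "M1 p0 - M2 p0"])
      fix p assume p: "p \<in> D1 \<inter> D2"
      have "primitive C (D1 \<inter> D2) H M1" "primitive C (D1 \<inter> D2) H M2"
        using M by (auto intro: primitive_subset)
      then show "M1 p - M2 p = M1 p0 - M2 p0"
        by (rule primitive_diff_const[OF _ _ D(3) _ p p0]) (use H in auto)
    qed
  qed (use that in blast)
  define M where "M p = (if p \<in> D1 then M1 p else M2 p + k)" for p
  have M2: "M p = M2 p + k" if "p \<in> D2" for p using k[of p] that by (auto simp: M_def)
  have half: "\<exists>d>0. \<forall>q\<in>D'. dist q p < d \<longrightarrow> offset C W H M q =
      offset C W H M p"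
    if D': "D' = D1 \<or> D' = D2" and W: "transversal W (H p)" for p W D'
  proof (cases "p \<in> D'")
    case True
    show ?thesis using D'
    proof
      assume d1: "D' = D1"
      obtain d where d: "d > 0" "\<And>q. q \<in> D1 \<Longrightarrow> dist q p < d \<Longrightarrow>
        offset C W H M1 q = offset C W H M1 p"
        using primitiveD[OF M(1) _ W] True d1 by blast
      show ?thesis
      proof (intro exI[of _ d] conjI d(1) ballI impI)
        fix q assume "q \<in> D'" "dist q p < d"
        then show "offset C W H M q = offset C W H M p"
          using d(2)[of q] True d1 by (simp add: M_def)
      qed
    next
      assume d2: "D' = D2"
      obtain d where d: "d > 0" "\<And>q. q \<in> D2 \<Longrightarrow> dist q p < d \<Longrightarrow>
        offset C W H M2 q = offset C W H M2 p"
        using primitiveD[OF M(2) _ W] True d2 by blast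
      show ?thesis
      proof (intro exI[of _ d] conjI d(1) ballI impI)
        fix q assume "q \<in> D'" "dist q p < d"
        then show "offset C W H M q = offset C W H M p"
          using d(2)[of q] M2[of q] M2[of p] True d2 by simp
      qed
    qed
  next
    case False
    have "closed D'" using D D' by auto
    then obtain d where "d > 0" "ball p d \<subseteq> - D'"
      using False open_contains_ball[of "- D'"] by (auto simp: open_Compl)
    then show ?thesis by (intro exI[of _ d]) (auto simp: dist_commute subset_iff)
  qed
  have "primitive C (D1 \<union> D2) H M"
    unfolding primitive_def
  proof (intro ballI allI impI)
    fix p W assume W: "transversal W (H p)"
    obtain d1 where d1: "d1 > 0" "\<forall>q\<in>D1. dist q p < d1 \<longrightarrow> offset C W H M q =
      offset C W H M p" using half[OF _ W] by blast
    obtain d2 where d2: "d2 > 0" "\<forall>q\<in>D2. dist q p < d2 \<longrightarrow> offset C W H M q =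
      offset C W H M p" using half[OF _ W] by blast
    show "\<exists>d>0. \<forall>q\<in>D1 \<union> D2. dist q p < d \<longrightarrow> offset C W H M q =
      offset C W H M p"
      using d1 d2 by (intro exI[of _ "min d1 d2"]) auto
  qed
  then show ?thesis using that by blast
qed

text \<open>A chart at \<open>p\<close> stays a chart nearby, and its index is itself a primitive
  there: any other chart index differs from it by a locally constant amount.\<close>

lemma primitive_local:
  assumes C: "lagrangian \<omega> C" and H: "\<And>p. p \<in> D \<Longrightarrow> lagrangian \<omega> (H p)"
    and cont: "subspace_continuous_on D H" and p: "p \<in> D"
  obtains r M where "r > 0" "primitive C (D \<inter> ball p r) H M"
proof -
  obtain W where W: "transversal W (H p)" using transversal_exists[OF H[OF p]] .
  obtain d where d: "d > 0" "\<And>L. lagrangian \<omega> L \<Longrightarrow> subspace_dist L (H p) < d \<Longrightarrow> transversal W L"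
    using proj_continuous[OF W, of 1] by (metis zero_less_one)
  obtain r where r: "r > 0" "\<And>q. q \<in> D \<Longrightarrow> dist q p < r \<Longrightarrow> subspace_dist (H q) (H p) < d"
    using cont p d(1) unfolding subspace_continuous_on_def by metis
  have "primitive C (D \<inter> ball p r) H (\<lambda>q. int (chart_index C W (H q)))"
    unfolding primitive_def
  proof (intro ballI allI impI)
    fix q W' assume q: "q \<in> D \<inter> ball p r" and W': "transversal W' (H q)"
    have Wq: "transversal W (H q)"
      using q by (intro d(2) H r(2)) (auto simp: dist_commute)
    obtain e where e: "e > 0" "\<And>L. lagrangian \<omega> L \<Longrightarrow> subspace_dist L (H q) < e \<Longrightarrow>
      int (chart_index C W L) - int (chart_index C W' L) =
      int (chart_index C W (H q)) - int (chart_index C W' (H q))"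
      using chart_index_diff_locally_const[OF C Wq W'] by blast
    obtain s where s: "s > 0" "\<And>x. x \<in> D \<Longrightarrow> dist x q < s \<Longrightarrow> subspace_dist (H x) (H q) < e"
      using cont q e(1) unfolding subspace_continuous_on_def by (metis IntD1)
    show "\<exists>d>0. \<forall>x\<in>D \<inter> ball p r. dist x q < d \<longrightarrow>
      int (chart_index C W (H x)) - int (chart_index C W' (H x)) =
      int (chart_index C W (H q)) - int (chart_index C W' (H q))"
      by (intro exI[of _ s] conjI s(1) ballI impI e(2) H s(2)) auto
  qed
  then show ?thesis using that r(1) by blast
qed

text \<open>Bisection in one coordinate is nested in bisection in the other. Overlaps of
  subrectangles are convex, hence connected, as gluing requires.\<close>

lemma primitive_rectangle:
  fixes H :: "real \<times> real \<Rightarrow> 'v set"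
  assumes C: "lagrangian \<omega> C" and ab: "a \<le> b" "a' \<le> b'"
    and H: "\<And>p. p \<in> {a..b} \<times> {a'..b'} \<Longrightarrow> lagrangian \<omega> (H p)"
    and cont: "subspace_continuous_on ({a..b} \<times> {a'..b'}) H"
  obtains M where "primitive C ({a..b} \<times> {a'..b'}) H M"
proof -
  define D where "D = {a..b} \<times> {a'..b'}"
  let ?R = "\<lambda>s1 s2 t1 t2. D \<inter> ({s1..s2} \<times> {t1..t2})"
  let ?P = "\<lambda>s1 s2 t1 t2. \<exists>M. primitive C (?R s1 s2 t1 t2) H M"
  have glue: "\<exists>M. primitive C (D1 \<union> D2) H M"
    if ex: "\<exists>M. primitive C D1 H M" "\<exists>M. primitive C D2 H M" "closed D1" "closed D2"
      "connected (D1 \<inter> D2)" "D1 \<subseteq> D" for D1 D2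
  proof -
    obtain M1 M2 where "primitive C D1 H M1" "primitive C D2 H M2" using ex(1,2) by blast
    moreover have "lagrangian \<omega> (H p)" if "p \<in> D1" for p using that ex(6) H by (auto simp: D_def)
    ultimately obtain M where "primitive C (D1 \<union> D2) H M"
      using primitive_glue[of C D1 H M1 D2 M2] ex(3-5) by blast
    then show ?thesis by blast
  qed
  have closed: "closed (?R s1 s2 t1 t2)" for s1 s2 t1 t2
    unfolding D_def by (intro closed_Int closed_Times closed_atLeastAtMost)
  have conn: "connected (?R s1 s2 t1 t2 \<inter> ?R s1' s2' t1' t2')" for s1 s2 t1 t2 s1' s2' t1' t2'
    unfolding D_def by (intro convex_connected convex_Int convex_Times convex_real_interval)
  have "?P a b a' b'"
    using ab(1)
  proof (induction rule: Bolzano)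
    case (trans s1 s2 s3)
    have "?R s1 s3 a' b' = ?R s1 s2 a' b' \<union> ?R s2 s3 a' b'" using trans(3,4) by auto
    then show ?case using glue[OF trans(1,2) closed closed conn] by auto
  next
    case (local s)
    \<comment> \<open>The inner bisection carries the width \<open>d\<close> along, since one width
      must serve the whole interval of the second coordinate.\<close>
    have "\<exists>d>0. \<forall>s1 s2. s1 \<le> s \<and> s \<le> s2 \<and> s2 - s1 < d \<longrightarrow> ?P s1 s2 a' b'"
      using ab(2)
    proof (induction rule: Bolzano)
      case (trans t1 t2 t3)
      obtain d1 where d1: "d1 > 0" "\<And>s1 s2. s1 \<le> s \<and> s \<le> s2 \<and> s2 - s1 < d1 \<Longrightarrow> ?P s1 s2 t1 t2"
        using trans(1) by blast
      obtain d2 where d2: "d2 > 0" "\<And>s1 s2. s1 \<le> s \<and> s \<le> s2 \<and> s2 - s1 < d2 \<Longrightarrow> ?P s1 s2 t2 t3"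
        using trans(2) by blast
      show ?case
      proof (intro exI[of _ "min d1 d2"] conjI allI impI)
        show "min d1 d2 > 0" using d1 d2 by simp
        fix s1 s2 assume s: "s1 \<le> s \<and> s \<le> s2 \<and> s2 - s1 < min d1 d2"
        have "?R s1 s2 t1 t3 = ?R s1 s2 t1 t2 \<union> ?R s1 s2 t2 t3" using trans(3,4) by auto
        moreover have "?P s1 s2 t1 t2" "?P s1 s2 t2 t3" using s d1(2)[of s1 s2] d2(2)[of s1 s2] by auto
        ultimately show "?P s1 s2 t1 t3" using glue[OF _ _ closed closed conn, of s1 s2 t1 t2 s1 s2 t2 t3] by auto
      qed
    next
      case (local t)
      have st: "(s, t) \<in> D" using local \<open>a \<le> s\<close> \<open>s \<le> b\<close> by (auto simp: D_def)
      obtain r M where r: "r > 0" "primitive C (D \<inter> ball (s, t) r) H M"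
        using primitive_local[OF C H cont, folded D_def, OF _ st] by blast
      show ?case
      proof (rule exI[of _ "r / 2"], intro conjI allI impI)
        show "r / 2 > 0" using r by simp
        fix t1 t2 assume t: "t1 \<le> t \<and> t \<le> t2 \<and> t2 - t1 < r / 2"
        show "\<exists>d>0. \<forall>s1 s2. s1 \<le> s \<and> s \<le> s2 \<and> s2 - s1 < d \<longrightarrow> ?P s1 s2 t1 t2"
        proof (intro exI[of _ "r / 2"] conjI allI impI)
          show "r / 2 > 0" using r by simp
          fix s1 s2 assume s: "s1 \<le> s \<and> s \<le> s2 \<and> s2 - s1 < r / 2"
          have "?R s1 s2 t1 t2 \<subseteq> D \<inter> ball (s, t) r"
          proof
            fix p assume pR: "p \<in> ?R s1 s2 t1 t2"
            then obtain x y where p: "p = (x, y)" "s1 \<le> x" "x \<le> s2" "t1 \<le> y" "y \<le> t2" by auto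
            have "dist (s, t) p \<le> dist s x + dist t y"
              unfolding p dist_Pair_Pair by (rule sqrt_sum_squares_le_sum) auto
            also have "\<dots> < r" using p s t by (auto simp: dist_real_def)
            finally show "p \<in> D \<inter> ball (s, t) r" using pR by simp
          qed
          then show "?P s1 s2 t1 t2" using primitive_subset[OF r(2)] by blast
        qed
      qed
    qed
    then show ?case by blast
  qed
  then show ?thesis using that by (auto simp: D_def)
qed

text \<open>The path is viewed as a rectangle that is constant in the first coordinate.\<close>

lemma primitive_interval:
  fixes l :: "real \<Rightarrow> 'v set"
  assumes C: "lagrangian \<omega> C" and ab: "a \<le> b" and l: "\<And>t. t \<in> {a..b} \<Longrightarrow> lagrangian \<omega> (l t)"
    and cont: "subspace_continuous_on {a..b} l"
  obtains M where "primitive C {a..b} l M"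
proof -
  have "subspace_continuous_on ({0..1::real} \<times> {a..b}) (\<lambda>p. l (snd p))"
    unfolding subspace_continuous_on_def
  proof (intro ballI allI impI)
    fix p and e :: real assume p: "p \<in> {0..1::real} \<times> {a..b}" "e > 0"
    then obtain d where d: "d > 0" "\<forall>q\<in>{a..b}. dist q (snd p) < d \<longrightarrow> subspace_dist (l q) (l (snd p)) < e"
      using cont unfolding subspace_continuous_on_def mem_Times_iff by blast
    have "dist (snd q) (snd p) < d" if "dist q p < d" for q :: "real \<times> real"
      using dist_snd_le[of q p] that by simp
    then show "\<exists>d>0. \<forall>q\<in>{0..1} \<times> {a..b}. dist q p < d \<longrightarrow> subspace_dist (l (snd q)) (l (snd p)) < e"
      using d by (intro exI[of _ d]) (auto simp: mem_Times_iff)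
  qed
  then obtain M where M: "primitive C ({0..1::real} \<times> {a..b}) (\<lambda>p. l (snd p)) M"
    using primitive_rectangle[OF C zero_le_one ab, of "\<lambda>p. l (snd p)"] l
    unfolding mem_Times_iff by blast
  have "primitive C {a..b} (\<lambda>t. l (snd (0::real, t))) (\<lambda>t. M (0, t))"
    by (rule primitive_compose[OF M]) (auto intro!: continuous_intros)
  then show ?thesis using that by simp
qed

text \<open>A primitive on the rectangle restricts to primitives on horizontal and vertical lines.
  Along the two edges with fixed endpoints the Lagrangian is constant, where 0 is a primitive as
  well, so the values there do not change. Gap continuity of \<open>l'\<close> is extracted too,
  because the crossing lemmas assume it beside \<open>lag_C1\<close>.\<close>

lemma primitive_homotopy:
  assumes C: "lagrangian \<omega> C" and ab: "a \<le> b" and hom: "lag_homotopic \<omega> a b l l'"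
    and M: "primitive C {a..b} l M"
  obtains M' where "primitive C {a..b} l' M'" "M' b - M' a = M b - M a"
    "subspace_continuous_on {a..b} l'"
proof -
  obtain H where H0: "\<forall>p\<in>{0..1::real} \<times> {a..b}. lagrangian \<omega> (H p)"
    "subspace_continuous_on ({0..1} \<times> {a..b}) H"
    "\<forall>t\<in>{a..b}. H (0, t) = l t \<and> H (1, t) = l' t"
    "\<forall>s\<in>{0..1}. H (s, a) = l a \<and> H (s, b) = l b"
    using hom unfolding lag_homotopic_def by blast
  have H: "\<And>p. p \<in> {0..1::real} \<times> {a..b} \<Longrightarrow> lagrangian \<omega> (H p)"
    "subspace_continuous_on ({0..1} \<times> {a..b}) H"
    "\<And>t. t \<in> {a..b} \<Longrightarrow> H (0, t) = l t" "\<And>t. t \<in> {a..b} \<Longrightarrow> H (1, t) = l' t"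
    "\<And>s. s \<in> {0..1} \<Longrightarrow> H (s, a) = l a" "\<And>s. s \<in> {0..1} \<Longrightarrow> H (s, b) = l b"
    using H0 by blast+
  obtain F where F: "primitive C ({0..1} \<times> {a..b}) H F"
    using primitive_rectangle[OF C zero_le_one ab H(1,2)] by blast
  have sl: "primitive C {a..b} (\<lambda>t. H (s, t)) (\<lambda>t. F (s, t))" if "s \<in> {0..1}" for s
    by (rule primitive_compose[OF F]) (use that in \<open>auto intro!: continuous_intros\<close>)
  have edge: "F (1, t) = F (0, t)" if t: "t \<in> {a..b}" "\<And>s. s \<in> {0..1} \<Longrightarrow> H (s, t) = L" for t L
  proof -
    have 1: "primitive C {0..1} (\<lambda>s. H (s, t)) (\<lambda>s. F (s, t))"
      by (rule primitive_compose[OF F]) (use t in \<open>auto intro!: continuous_intros\<close>)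
    have 2: "primitive C {0..1} (\<lambda>s. H (s, t)) (\<lambda>s. 0)"
      unfolding primitive_def using t(2) by (auto intro: exI[of _ 1])
    have "F (1, t) - 0 = F (0, t) - 0"
    proof (rule primitive_diff_const[OF 1 2])
      show "lagrangian \<omega> (H (s, t))" if "s \<in> {0..1}" for s using that t(1) by (intro H(1)) simp
    qed auto
    then show ?thesis by simp
  qed
  have "primitive C {a..b} l (\<lambda>t. F (0, t))"
    by (rule primitive_cong[OF sl]) (use H(3) in auto)
  then have "F (0, b) - M b = F (0, a) - M a"
    by (rule primitive_diff_const[OF _ M]) (use ab H(1)[of "(0, _)"] H(3) in auto)
  moreover have "F (1, a) = F (0, a)" by (rule edge) (use ab H(5) in auto)
  moreover have "F (1, b) = F (0, b)" by (rule edge) (use ab H(6) in auto)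
  ultimately have e: "F (1, b) - F (1, a) = M b - M a" by simp
  have "subspace_continuous_on {a..b} l'"
    unfolding subspace_continuous_on_def
  proof (intro ballI allI impI)
    fix t and e :: real assume t: "t \<in> {a..b}" "e > 0"
    then obtain d where d: "d > 0"
      "\<forall>q\<in>{0..1} \<times> {a..b}. dist q (1, t) < d \<longrightarrow> subspace_dist (H q) (H (1, t)) < e"
      using H(2) unfolding subspace_continuous_on_def by fastforce
    show "\<exists>d>0. \<forall>q\<in>{a..b}. dist q t < d \<longrightarrow> subspace_dist (l' q) (l' t) < e"
    proof (intro exI[of _ d] conjI d(1) ballI impI)
      fix q assume q: "q \<in> {a..b}" "dist q t < d"
      then have "subspace_dist (H (1, q)) (H (1, t)) < e"
        using d(2) by (auto simp: dist_Pair_Pair)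
      then show "subspace_dist (l' q) (l' t) < e" using H(4) q t by simp
    qed
  qed
  moreover have "primitive C {a..b} l' (\<lambda>t. F (1, t))"
    by (rule primitive_cong[OF sl]) (use H(4) in auto)
  ultimately show ?thesis using that e by blast
qed

end

subsection \<open>Crossing forms\<close>

lemma pos_index_zero_space [simp]: "pos_index q {0} = 0"
proof (rule pos_index_attained[of "{0}" q])
  fix U :: "'a set" assume "U \<subseteq> {0}" "dim U = pos_index q {0}"
  then show ?thesis using dim_subset[of U "{0}"] by simp
qed simp

lemma neg_index_zero_space [simp]: "neg_index q {0} = 0"
  by (simp add: neg_index_def)

context symplectic
begin

lemma eventually_proj:
  fixes l :: "'a::metric_space \<Rightarrow> 'v set"
  assumes W: "transversal W (l t0)" and t0: "t0 \<in> S" and l: "\<And>t. t \<in> S \<Longrightarrow> lagrangian \<omega> (l t)"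
    and cont: "subspace_continuous_on S l" and e: "e > 0"
  shows "\<forall>\<^sub>F t in at t0 within S. t \<in> S \<and> transversal W (l t) \<and>
    (\<forall>x. norm (proj W (l t) x - proj W (l t0) x) \<le> e * norm x)"
proof -
  obtain d where d: "d > 0" "\<And>L. lagrangian \<omega> L \<Longrightarrow> subspace_dist L (l t0) < d \<Longrightarrow> transversal W L"
    "\<And>L x. lagrangian \<omega> L \<Longrightarrow> subspace_dist L (l t0) < d \<Longrightarrow> norm (proj W L x - proj W (l t0) x) \<le> e * norm x"
    using proj_continuous[OF W e] by blast
  obtain r where r: "r > 0" "\<And>q. q \<in> S \<Longrightarrow> dist q t0 < r \<Longrightarrow> subspace_dist (l q) (l t0) < d"
    using cont t0 d(1) unfolding subspace_continuous_on_def by metis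
  show ?thesis unfolding eventually_at
    by (intro exI[of _ r] conjI r(1) ballI allI impI d(2,3) l r(2)) auto
qed

context
  fixes l :: "real \<Rightarrow> 'v set" and a b :: real
  assumes ab: "a < b" and C1: "lag_C1 \<omega> l a b" and cont: "subspace_continuous_on {a..b} l"
begin

lemma path_lagrangian: "t \<in> {a..b} \<Longrightarrow> lagrangian \<omega> (l t)"
  using C1 unfolding lag_C1_def by blast

text \<open>The coefficients of \<open>v\<close> in the frame are kept fixed while the frame
  moves.\<close>

lemma frame_curve:
  assumes t0: "t0 \<in> {a..b}" and v: "v \<in> l t0"
  obtains u u' where "\<And>t. t \<in> {a..b} \<Longrightarrow> u t \<in> l t" "u t0 = v"
    "(u has_vector_derivative u') (at t0 within {a..b})"
proof -
  let ?P = "\<lambda>v. \<exists>u u'. (\<forall>t\<in>{a..b}. u t \<in> l t) \<and> u t0 = v \<and>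
    (u has_vector_derivative u') (at t0 within {a..b})"
  obtain F where F: "\<And>t. t \<in> {a..b} \<Longrightarrow> l t = span (F t ` {..<DIM('v) div 2})"
    "\<And>i. C1_on_interval a b (\<lambda>t. F t i)"
    using C1 unfolding lag_C1_def by blast
  have "v \<in> span (F t0 ` {..<DIM('v) div 2})" using v F(1)[OF t0] by simp
  then have "?P v"
  proof (induction rule: span_induct_alt)
    case base
    show ?case
      by (intro exI[of _ "\<lambda>_. 0"] exI[of _ 0])
        (auto intro: subspace_0[OF lagrangian_subspace[OF path_lagrangian]])
  next
    case (step c x y)
    obtain i where i: "i < DIM('v) div 2" "x = F t0 i" using step(1) by auto
    obtain f' where f': "((\<lambda>t. F t i) has_vector_derivative f') (at t0 within {a..b})"
      using F(2)[of i] t0 unfolding C1_on_interval_def by blast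
    obtain u u' where u: "\<forall>t\<in>{a..b}. u t \<in> l t" "u t0 = y"
      "(u has_vector_derivative u') (at t0 within {a..b})" using step(2) by blast
    show ?case
    proof (intro exI[of _ "\<lambda>t. c *\<^sub>R F t i + u t"] exI[of _ "c *\<^sub>R f' + u'"] conjI ballI)
      show "c *\<^sub>R F t i + u t \<in> l t" if "t \<in> {a..b}" for t
      proof -
        have "F t i \<in> l t" unfolding F(1)[OF that] using i by (intro span_base) auto
        then show ?thesis using that u(1) lagrangian_subspace[OF path_lagrangian[OF that]]
          by (intro subspace_add subspace_scale) auto
      qed
      show "c *\<^sub>R F t0 i + u t0 = c *\<^sub>R x + y" using i u by simp
      show "((\<lambda>t. c *\<^sub>R F t i + u t) has_vector_derivative c *\<^sub>R f' + u') (at t0 within {a..b})"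
        by (intro has_vector_derivative_add u(3)
            bounded_linear.has_vector_derivative[OF bounded_linear_scaleR_right f'])
    qed
  qed
  then show ?thesis using that by blast
qed

text \<open>Curves through the projected basis vectors combine to a linear family \<open>U t\<close>
  with values in \<open>l t\<close>, which the projection at time \<open>t\<close> fixes. Therefore
  \<open>P_t v = U t v - P_t (U t v - v)\<close>, whose derivative at \<open>t0\<close> is
  \<open>U' v - P_t0 (U' v)\<close>, and linearity in \<open>v\<close> makes the error uniform in
  \<open>v\<close>.\<close>

lemma proj_derivative:
  assumes t0: "t0 \<in> {a..b}" and W: "transversal W (l t0)"
  obtains D where "linear D" "\<And>e. e > 0 \<Longrightarrow> \<forall>\<^sub>F t in at t0 within {a..b}. transversal W (l t) \<and>
    (\<forall>v\<in>l t0. norm (proj W (l t) v - v - (t - t0) *\<^sub>R D v) \<le> e * \<bar>t - t0\<bar> * norm v)"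
proof -
  let ?F = "at t0 within {a..b}" and ?P = "\<lambda>t. proj W (l t)"
  have "\<exists>u u'. (\<forall>t\<in>{a..b}. u t \<in> l t) \<and> u t0 = ?P t0 i \<and> (u has_vector_derivative u') ?F" for i
    using frame_curve[OF t0 proj_in[OF W]] by metis
  then obtain u u' where u: "\<And>i t. t \<in> {a..b} \<Longrightarrow> u i t \<in> l t" "\<And>i. u i t0 = ?P t0 i"
    "\<And>i. (u i has_vector_derivative u' i) ?F" by metis
  define U where "U t v = (\<Sum>i\<in>Basis. (v \<bullet> i) *\<^sub>R u i t)" for t v
  define U' where "U' v = (\<Sum>i\<in>Basis. (v \<bullet> i) *\<^sub>R u' i)" for v
  define D where "D v = U' v - ?P t0 (U' v)" for v
  have lP: "linear (?P t0)" by (rule linear_proj[OF W])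
  have lU': "linear U'" unfolding U'_def
    by (rule linearI) (auto simp: inner_add_left scaleR_add_left sum.distrib scaleR_sum_right)
  have lD: "linear D" unfolding D_def
    using linear_compose[OF lU' lP] lU' by (intro linear_compose_sub) (auto simp: o_def)
  have Ul: "U t v \<in> l t" if "t \<in> {a..b}" for t v
    unfolding U_def using u(1)[OF that] lagrangian_subspace[OF path_lagrangian[OF that]]
    by (intro subspace_sum subspace_scale) auto
  have U0: "U t0 v = ?P t0 v" for v
  proof -
    have "?P t0 v = ?P t0 (\<Sum>i\<in>Basis. (v \<bullet> i) *\<^sub>R i)" by (simp add: euclidean_representation)
    also have "\<dots> = U t0 v" unfolding U_def u(2) by (simp add: linear_sum[OF lP] linear_scale[OF lP])
    finally show ?thesis by simp
  qed
  obtain K where K: "K > 0" "\<And>x. norm (?P t0 x) \<le> K * norm x" using proj_bounded[OF W] by blast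
  obtain B where B: "B > 0" "\<And>x. norm (U' x) \<le> B * norm x" using linear_bounded_pos[OF lU'] by blast
  let ?N = "real DIM('v)"
  have "\<forall>\<^sub>F t in ?F. transversal W (l t) \<and>
    (\<forall>v\<in>l t0. norm (?P t v - v - (t - t0) *\<^sub>R D v) \<le> e * \<bar>t - t0\<bar> * norm v)" if e: "e > 0" for e
  proof -
    \<comment> \<open>\<open>c\<close> collects the error sources: the remainder of
      \<open>U\<close>, summed over the basis and enlarged by the factor \<open>K + 2\<close>, and
      the motion of the projection on \<open>U' v\<close>.\<close>
    define c where "c = ?N * (K + 2) + B"
    have c: "c > 0" using K B by (simp add: c_def add_nonneg_pos)
    define \<eta> where "\<eta> = min 1 (e / c)"
    have \<eta>: "\<eta> > 0" "\<eta> \<le> 1" "\<eta> * c \<le> e"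
    proof -
      show "\<eta> > 0" "\<eta> \<le> 1" using e c by (auto simp: \<eta>_def)
      have "\<eta> \<le> e / c" by (simp add: \<eta>_def)
      then show "\<eta> * c \<le> e" using c by (simp add: pos_le_divide_eq)
    qed
    have "\<forall>\<^sub>F t in ?F. norm (u i t - ?P t0 i - (t - t0) *\<^sub>R u' i) \<le> \<eta> * norm (t - t0)" for i
      using u(3)[of i] \<eta>(1) u(2)[of i]
      unfolding has_vector_derivative_def has_derivative_within_alt2 by auto
    then have "\<forall>\<^sub>F t in ?F. \<forall>i\<in>Basis. norm (u i t - ?P t0 i - (t - t0) *\<^sub>R u' i) \<le> \<eta> * norm (t - t0)"
      by (intro eventually_ball_finite) auto
    moreover have "\<forall>\<^sub>F t in ?F. t \<in> {a..b} \<and> transversal W (l t) \<and>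
        (\<forall>x. norm (?P t x - ?P t0 x) \<le> \<eta> * norm x)"
      by (rule eventually_proj[OF W t0 path_lagrangian cont \<eta>(1)])
    ultimately show ?thesis
    proof eventually_elim
      case (elim t)
      then have t: "t \<in> {a..b}" and tr: "transversal W (l t)"
        and near: "\<And>x. norm (?P t x - ?P t0 x) \<le> \<eta> * norm x"
        and ui: "\<And>i. i \<in> Basis \<Longrightarrow> norm (u i t - ?P t0 i - (t - t0) *\<^sub>R u' i) \<le> \<eta> * \<bar>t - t0\<bar>"
        by auto
      let ?\<tau> = "\<bar>t - t0\<bar>"
      have Pb: "norm (?P t x) \<le> (K + 1) * norm x" for x
      proof -
        have "norm (?P t x) \<le> norm (?P t0 x) + norm (?P t x - ?P t0 x)"
          by (metis add.commute norm_triangle_sub)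
        also have "\<dots> \<le> K * norm x + 1 * norm x"
          using K(2)[of x] near[of x] mult_right_mono[OF \<eta>(2) norm_ge_zero, of x] by linarith
        finally show ?thesis by (simp add: algebra_simps)
      qed
      show ?case
      proof (intro conjI tr ballI)
        fix v assume v: "v \<in> l t0"
        have U0v: "U t0 v = v" using U0 proj_id[OF W v] by simp
        define r where "r = U t v - v - (t - t0) *\<^sub>R U' v"
        have "r = (\<Sum>i\<in>Basis. (v \<bullet> i) *\<^sub>R (u i t - ?P t0 i - (t - t0) *\<^sub>R u' i))"
        proof -
          have "r = U t v - U t0 v - (t - t0) *\<^sub>R U' v" by (simp add: r_def U0v)
          then show ?thesis unfolding U_def U'_def u(2)
            by (simp add: scaleR_diff_right sum_subtractf scaleR_sum_right mult.commute)
        qed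
        then have "norm r \<le> (\<Sum>i\<in>(Basis::'v set). norm ((v \<bullet> i) *\<^sub>R (u i t - ?P t0 i - (t - t0) *\<^sub>R u' i)))"
          by (simp only: norm_sum)
        also have "\<dots> \<le> (\<Sum>i\<in>(Basis::'v set). norm v * (\<eta> * ?\<tau>))"
        proof (rule sum_mono)
          fix i :: 'v assume i: "i \<in> Basis"
          show "norm ((v \<bullet> i) *\<^sub>R (u i t - ?P t0 i - (t - t0) *\<^sub>R u' i)) \<le> norm v * (\<eta> * ?\<tau>)"
            unfolding norm_scaleR
            by (intro mult_mono ui i) (auto simp: Basis_le_norm[OF i])
        qed
        finally have r: "norm r \<le> ?N * \<eta> * ?\<tau> * norm v" by (simp add: mult_ac)
        have lPt: "linear (?P t)" by (rule linear_proj[OF tr])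
        have "?P t v = U t v - ?P t (U t v - v)"
          using proj_id[OF tr Ul[OF t]] by (simp add: linear_diff[OF lPt])
        also have "U t v - v = (t - t0) *\<^sub>R U' v + r" by (simp add: r_def)
        also have "?P t ((t - t0) *\<^sub>R U' v + r) = (t - t0) *\<^sub>R ?P t (U' v) + ?P t r"
          by (simp add: linear_add[OF lPt] linear_scale[OF lPt])
        finally have "?P t v - v - (t - t0) *\<^sub>R D v =
          r - (?P t r + (t - t0) *\<^sub>R (?P t (U' v) - ?P t0 (U' v)))"
          unfolding D_def r_def by (simp add: algebra_simps)
        then have "norm (?P t v - v - (t - t0) *\<^sub>R D v) \<le>
          norm r + norm (?P t r + (t - t0) *\<^sub>R (?P t (U' v) - ?P t0 (U' v)))"
          by (metis norm_triangle_ineq4)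
        also have "\<dots> \<le> norm r + (norm (?P t r) + norm ((t - t0) *\<^sub>R (?P t (U' v) - ?P t0 (U' v))))"
          by (intro add_left_mono norm_triangle_ineq)
        also have "\<dots> \<le> norm r + ((K + 1) * norm r + ?\<tau> * (\<eta> * (B * norm v)))"
        proof (intro add_mono order_refl Pb)
          have "norm (?P t (U' v) - ?P t0 (U' v)) \<le> \<eta> * norm (U' v)" by (rule near)
          also have "\<dots> \<le> \<eta> * (B * norm v)" using B \<eta> by (intro mult_left_mono) auto
          finally show "norm ((t - t0) *\<^sub>R (?P t (U' v) - ?P t0 (U' v))) \<le> ?\<tau> * (\<eta> * (B * norm v))"
            by (simp add: mult_left_mono)
        qed
        also have "\<dots> = (K + 2) * norm r + ?\<tau> * (\<eta> * (B * norm v))" by (simp add: algebra_simps)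
        also have "\<dots> \<le> (K + 2) * (?N * \<eta> * ?\<tau> * norm v) + ?\<tau> * (\<eta> * (B * norm v))"
          using K by (intro add_right_mono mult_left_mono r) auto
        also have "\<dots> = (\<eta> * c) * (?\<tau> * norm v)" by (simp add: c_def algebra_simps)
        also have "\<dots> \<le> e * (?\<tau> * norm v)" using \<eta> by (intro mult_right_mono) auto
        finally show "norm (?P t v - v - (t - t0) *\<^sub>R D v) \<le> e * ?\<tau> * norm v" by (simp add: mult.assoc)
      qed
    qed
  qed
  then show ?thesis using that[OF lD] by blast
qed

lemma not_bot: "t0 \<in> {a..b} \<Longrightarrow> at t0 within {a..b} \<noteq> bot"
  using ab by (simp add: trivial_limit_within islimpt_Icc)

text \<open>Differentiating \<open>\<omega> (u t) (P\<^sub>t v) = 0\<close> shows that the derivative does not depend on the chart.\<close>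

lemma crossing_form_derivative:
  assumes t0: "t0 \<in> {a..b}" and W: "transversal W (l t0)" and v: "v \<in> l t0"
    and D: "\<And>e. e > 0 \<Longrightarrow> \<forall>\<^sub>F t in at t0 within {a..b}. transversal W (l t) \<and>
      (\<forall>v\<in>l t0. norm (proj W (l t) v - v - (t - t0) *\<^sub>R D v) \<le> e * \<bar>t - t0\<bar> * norm v)"
  shows "((\<lambda>t. proj W (l t) v) has_vector_derivative D v) (at t0 within {a..b})"
    and "\<lbrakk>\<And>t. t \<in> {a..b} \<Longrightarrow> u t \<in> l t; u t0 = v; (u has_vector_derivative u') (at t0 within {a..b})\<rbrakk>
      \<Longrightarrow> \<omega> v (D v) = \<omega> v u'"
proof -
  let ?F = "at t0 within {a..b}" and ?p = "\<lambda>t. proj W (l t) v"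
  show der: "(?p has_vector_derivative D v) ?F"
    unfolding has_vector_derivative_def has_derivative_within_alt2
  proof (intro conjI allI impI bounded_linear_scaleR_left)
    fix e :: real assume e: "e > 0"
    then have "e / (norm v + 1) > 0" by (simp add: add_nonneg_pos)
    from D[OF this] show "\<forall>\<^sub>F t in ?F. norm (?p t - ?p t0 - (t - t0) *\<^sub>R D v) \<le> e * norm (t - t0)"
    proof eventually_elim
      case (elim t)
      then have "norm (?p t - v - (t - t0) *\<^sub>R D v) \<le> e / (norm v + 1) * \<bar>t - t0\<bar> * norm v"
        using v by blast
      also have "\<dots> = e * \<bar>t - t0\<bar> * (norm v / (norm v + 1))" by simp
      also have "\<dots> \<le> e * \<bar>t - t0\<bar> * 1"
        using e by (intro mult_left_mono) (auto simp: divide_le_eq add_nonneg_pos)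
      finally show ?case by (simp add: proj_id[OF W v])
    qed
  qed
  assume u: "\<And>t. t \<in> {a..b} \<Longrightarrow> u t \<in> l t" "u t0 = v" "(u has_vector_derivative u') ?F"
  have bb: "bounded_bilinear \<omega>" using bil bilinear_conv_bounded_bilinear by blast
  have 1: "((\<lambda>t. \<omega> (u t) (?p t)) has_vector_derivative \<omega> (u t0) (D v) + \<omega> u' (?p t0)) ?F"
    by (rule bounded_bilinear.has_vector_derivative[OF bb u(3) der])
  obtain d where d: "d > 0" "\<And>t. t \<in> {a..b} \<Longrightarrow> t \<noteq> t0 \<Longrightarrow> dist t t0 < d \<Longrightarrow> transversal W (l t)"
    using D[OF zero_less_one] unfolding eventually_at by blast
  have z: "\<omega> (u t) (?p t) = 0" if t: "t \<in> {a..b}" "dist t t0 < d" for t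
  proof -
    have "transversal W (l t)" using d(2)[OF t(1)] W t by (cases "t = t0") auto
    then show ?thesis using lagrangian_isotropic[OF path_lagrangian[OF t(1)] u(1)[OF t(1)] proj_in] by blast
  qed
  have "((\<lambda>t. \<omega> (u t) (?p t)) has_vector_derivative 0) ?F"
    by (rule has_vector_derivative_transform_within[OF has_vector_derivative_const d(1) t0])
      (use z in auto)
  then have "\<omega> (u t0) (D v) + \<omega> u' (?p t0) = 0"
    using vector_derivative_unique_within[OF not_bot[OF t0] 1] by simp
  then show "\<omega> v (D v) = \<omega> v u'" using u(2) skew[of u' v] by (simp add: proj_id[OF W v])
qed

text \<open>Near \<open>t0\<close> the vector \<open>w t\<close> of the definition is
  \<open>proj W (l t) v - v\<close>. Its derivative may be replaced by that of any curve in the path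
  through \<open>v\<close>, which removes the dependence on the chosen \<open>W\<close>.\<close>

lemma crossing_form_eq:
  assumes t0: "t0 \<in> {a..b}"
    and u: "\<And>t. t \<in> {a..b} \<Longrightarrow> u t \<in> l t" "(u has_vector_derivative u') (at t0 within {a..b})"
  shows "crossing_form \<omega> l C a b t0 (u t0) = \<omega> (u t0) u'"
proof -
  let ?F = "at t0 within {a..b}" and ?v = "u t0"
  define W where "W = (SOME W. lagrangian \<omega> W \<and> W \<inter> l t0 = {0})"
  have "\<exists>W. lagrangian \<omega> W \<and> W \<inter> l t0 = {0}"
    using transversal_exists[OF path_lagrangian[OF t0]] unfolding transversal_def by metis
  then have "lagrangian \<omega> W \<and> W \<inter> l t0 = {0}" unfolding W_def by (rule someI_ex)
  then have W: "transversal W (l t0)" using path_lagrangian[OF t0] by (simp add: transversal_def)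
  obtain D where D: "linear D" "\<And>e. e > 0 \<Longrightarrow> \<forall>\<^sub>F t in ?F. transversal W (l t) \<and>
    (\<forall>v\<in>l t0. norm (proj W (l t) v - v - (t - t0) *\<^sub>R D v) \<le> e * \<bar>t - t0\<bar> * norm v)"
    using proj_derivative[OF t0 W] by blast
  have v: "?v \<in> l t0" by (rule u(1)[OF t0])
  note der = crossing_form_derivative[OF t0 W v D(2)]
  define w where "w t = (THE w. w \<in> W \<and> ?v + w \<in> l t)" for t
  have w: "w t = proj W (l t) ?v - ?v" if tr: "transversal W (l t)" for t
    unfolding w_def
  proof (rule the_equality)
    have "proj W (l t) ?v - ?v \<in> W"
      using subspace_neg[OF transversal_subspace(1)[OF tr] proj_diff_in[OF tr, of ?v]] by simp
    then show "proj W (l t) ?v - ?v \<in> W \<and> ?v + (proj W (l t) ?v - ?v) \<in> l t"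
      using proj_in[OF tr] by simp
    fix z assume z: "z \<in> W \<and> ?v + z \<in> l t"
    then have "?v - (?v + z) \<in> W" using subspace_neg[OF transversal_subspace(1)[OF tr]] by simp
    then have "proj W (l t) ?v = ?v + z" using z by (intro proj_unique[OF tr]) auto
    then show "z = proj W (l t) ?v - ?v" by simp
  qed
  have bb: "bounded_bilinear \<omega>" using bil bilinear_conv_bounded_bilinear by blast
  have d0: "((\<lambda>t. \<omega> ?v (proj W (l t) ?v - ?v)) has_vector_derivative \<omega> ?v (D ?v - 0)) ?F"
    by (intro bounded_linear.has_vector_derivative[OF bounded_bilinear.bounded_linear_right[OF bb]]
        has_vector_derivative_diff der(1) has_vector_derivative_const)
  \<comment> \<open>Away from \<open>t0\<close> the chart may fail and \<open>w t\<close> is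
    unspecified, so the comparison is restricted to a neighbourhood.\<close>
  obtain d where d: "d > 0" "\<And>t. t \<in> {a..b} \<Longrightarrow> t \<noteq> t0 \<Longrightarrow> dist t t0 < d \<Longrightarrow> transversal W (l t)"
    using D(2)[OF zero_less_one] unfolding eventually_at by blast
  have d1: "((\<lambda>t. \<omega> ?v (w t)) has_vector_derivative \<omega> ?v (D ?v)) ?F"
  proof (rule has_vector_derivative_transform_within[OF d0[unfolded diff_0_right] d(1) t0])
    fix t assume t: "t \<in> {a..b}" "dist t t0 < d"
    have "transversal W (l t)" using d(2)[OF t(1)] W t by (cases "t = t0") auto
    then show "\<omega> ?v (proj W (l t) ?v - ?v) = \<omega> ?v (w t)" by (simp add: w)
  qed
  have "(THE D. ((\<lambda>t. \<omega> ?v (w t)) has_real_derivative D) ?F) = \<omega> ?v (D ?v)"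
  proof (rule the_equality)
    show "((\<lambda>t. \<omega> ?v (w t)) has_real_derivative \<omega> ?v (D ?v)) ?F"
      using d1 by (simp add: has_real_derivative_iff_has_vector_derivative)
    show "D' = \<omega> ?v (D ?v)" if "((\<lambda>t. \<omega> ?v (w t)) has_real_derivative D') ?F" for D'
      using that vector_derivative_unique_within[OF not_bot[OF t0] _ d1]
      by (simp add: has_real_derivative_iff_has_vector_derivative)
  qed
  then have "crossing_form \<omega> l C a b t0 ?v = \<omega> ?v (D ?v)"
    unfolding crossing_form_def Let_def W_def[symmetric] w_def[symmetric] .
  then show ?thesis using der(2)[of u u'] u by simp
qed

end

end

section \<open>Jump of the chart index at a regular crossing\<close>

context symplectic
begin

context
  fixes l :: "real \<Rightarrow> 'v set" and a b t0 :: real and C W :: "'v set"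
  assumes ab: "a < b" and C1: "lag_C1 \<omega> l a b" and cont: "subspace_continuous_on {a..b} l"
    and t0: "t0 \<in> {a..b}" and C: "lagrangian \<omega> C" and W: "transversal W (l t0)"
begin

text \<open>One statement for both sides of \<open>t0\<close> and both signs of the form.\<close>

lemma chart_form_index_lower_bound:
  fixes \<epsilon> \<sigma> :: real
  assumes D: "linear D" "\<And>e. e > 0 \<Longrightarrow> \<forall>\<^sub>F t in at t0 within {a..b}. transversal W (l t) \<and>
      (\<forall>v\<in>l t0. norm (proj W (l t) v - v - (t - t0) *\<^sub>R D v) \<le> e * \<bar>t - t0\<bar> * norm v)"
    and signs: "\<epsilon> = 1 \<or> \<epsilon> = -1" "\<sigma> = 1 \<or> \<sigma> = -1"
  shows "\<forall>\<^sub>F t in at t0 within {a..b}. \<sigma> * (t - t0) > 0 \<longrightarrow>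
    pos_index (\<lambda>x. \<epsilon> * \<omega> x (proj W (l t0) x)) C + pos_index (\<lambda>x. \<epsilon> * \<sigma> * \<omega> x (D x)) (l t0 \<inter> C)
    \<le> pos_index (\<lambda>x. \<epsilon> * \<omega> x (proj W (l t) x)) C"
proof -
  let ?F = "at t0 within {a..b}" and ?P = "\<lambda>t. proj W (l t)" and ?K = "l t0 \<inter> C"
  have sC: "subspace C" by (rule lagrangian_subspace[OF C])
  have sK: "subspace ?K" by (intro subspace_inter sC transversal_subspace(2)[OF W])
  have blP: "bilinear (\<lambda>x y. \<epsilon> * \<omega> x (?P t y))" if "transversal W (l t)" for t
    using bilinear_compose[OF bil linear_ident linear_compose[OF linear_proj[OF that] linear_scaleR[of \<epsilon>]]]
    by (simp add: omega_simps o_def)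
  have blD: "bilinear (\<lambda>x y. \<epsilon> * \<sigma> * \<omega> x (D y))"
    using bilinear_compose[OF bil linear_ident linear_compose[OF D(1) linear_scaleR[of "\<epsilon> * \<sigma>"]]]
    by (simp add: omega_simps o_def)
  \<comment> \<open>On \<open>U\<close> the form is positive at time \<open>t0\<close> and stays so.
    On \<open>N\<close>, a part of \<open>l t0\<close>, the form at \<open>t0\<close> vanishes and
    the first order term decides. The two spaces are independent, and their sum turns out to be
    positive at time \<open>t\<close>.\<close>
  obtain U where U: "subspace U" "U \<subseteq> C" "\<And>u. u \<in> U \<Longrightarrow> u \<noteq> 0 \<Longrightarrow> \<epsilon> * \<omega> u (?P t0 u) > 0"
     "dim U = pos_index (\<lambda>x. \<epsilon> * \<omega> x (?P t0 x)) C"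
    using pos_index_attained[of C "\<lambda>x. \<epsilon> * \<omega> x (?P t0 x)"] subspace_0[OF sC] by blast
  obtain N where N: "subspace N" "N \<subseteq> ?K" "\<And>u. u \<in> N \<Longrightarrow> u \<noteq> 0 \<Longrightarrow> \<epsilon> * \<sigma> * \<omega> u (D u) > 0"
     "dim N = pos_index (\<lambda>x. \<epsilon> * \<sigma> * \<omega> x (D x)) ?K"
    using pos_index_attained[of ?K "\<lambda>x. \<epsilon> * \<sigma> * \<omega> x (D x)"] subspace_0[OF sK] by blast
  obtain c where c: "c > 0" "\<And>u. u \<in> U \<Longrightarrow> \<epsilon> * \<omega> u (?P t0 u) \<ge> c * (norm u)\<^sup>2"
    using pos_def_coercive[OF blP[OF W] U(1)] U(3) by blast
  obtain g where g: "g > 0" "\<And>u. u \<in> N \<Longrightarrow> \<epsilon> * \<sigma> * \<omega> u (D u) \<ge> g * (norm u)\<^sup>2"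
    using pos_def_coercive[OF blD N(1)] N(3) by blast
  obtain k where k: "k > 0" "\<And>x y. \<bar>\<omega> x y\<bar> \<le> k * norm x * norm y" using omega_bounded by blast
  obtain B where B: "B > 0" "\<And>x. norm (D x) \<le> B * norm x" using linear_bounded_pos[OF D(1)] by blast
  \<comment> \<open>This makes the remainder at most half of the first order term on
    \<open>N\<close>.\<close>
  define e where "e = min 1 (g / (2 * k))"
  have e: "e > 0" "e \<le> 1" "k * e \<le> g / 2"
  proof -
    show "e > 0" "e \<le> 1" using g k by (auto simp: e_def)
    have "e \<le> g / (2 * k)" by (simp add: e_def)
    then show "k * e \<le> g / 2" using k by (simp add: field_simps)
  qed
  \<comment> \<open>\<open>c'\<close> bounds the cross terms between \<open>U\<close> and
    \<open>N\<close> per unit of time, with \<open>B\<close> from the derivative and 1 from the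
    remainder.\<close>
  define c' where "c' = k * (B + 1)"
  have c': "c' > 0" using k B by (simp add: c'_def)
  have UN: "U \<inter> N \<subseteq> {0}"
  proof
    fix x assume x: "x \<in> U \<inter> N"
    then have "x \<in> l t0" using N(2) by auto
    then have "\<omega> x (?P t0 x) = 0" by (simp add: proj_id[OF W])
    then show "x \<in> {0}" using U(3)[of x] x by auto
  qed
  have abs\<epsilon>: "\<bar>\<epsilon> * x\<bar> = \<bar>x\<bar>" for x using signs(1) by (auto simp: abs_mult)
  have "c / (2 * k) > 0" using c k by simp
  then have ev1: "\<forall>\<^sub>F t in ?F. t \<in> {a..b} \<and> transversal W (l t) \<and>
      (\<forall>x. norm (?P t x - ?P t0 x) \<le> c / (2 * k) * norm x)"
    by (intro eventually_proj[where l = l] W t0 path_lagrangian[OF ab C1 cont] cont)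
  \<comment> \<open>The threshold is taken from the smallness condition on \<tau> in
    \<open>perturbed_form_pos\<close>.\<close>
  have "c * g / (4 * c'\<^sup>2 + 1) > 0" using c g by (simp add: add_nonneg_pos)
  then have ev2: "\<forall>\<^sub>F t in ?F. \<bar>t - t0\<bar> < c * g / (4 * c'\<^sup>2 + 1)"
    unfolding eventually_at by (intro exI[of _ "c * g / (4 * c'\<^sup>2 + 1)"]) (auto simp: dist_real_def)
  from D(2)[OF e(1)] ev1 ev2 show ?thesis
  proof eventually_elim
    case (elim t)
    then have tr: "transversal W (l t)"
      and d: "\<And>v. v \<in> l t0 \<Longrightarrow> norm (?P t v - v - (t - t0) *\<^sub>R D v) \<le> e * \<bar>t - t0\<bar> * norm v"
      and near: "\<And>x. norm (?P t x - ?P t0 x) \<le> c / (2 * k) * norm x"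
      and small: "\<bar>t - t0\<bar> < c * g / (4 * c'\<^sup>2 + 1)" by auto
    show ?case
    proof
      assume \<sigma>: "\<sigma> * (t - t0) > 0"
      let ?\<tau> = "\<bar>t - t0\<bar>"
      have \<tau>: "?\<tau> > 0" "\<sigma> * (t - t0) = ?\<tau>" "\<sigma> * ?\<tau> = t - t0" using \<sigma> signs(2) by auto
      have "4 * c'\<^sup>2 * ?\<tau> \<le> (4 * c'\<^sup>2 + 1) * ?\<tau>" by (simp add: algebra_simps)
      also have "\<dots> < c * g"
      proof -
        have "4 * c'\<^sup>2 + 1 > 0" by (simp add: add_nonneg_pos)
        then show ?thesis using small by (simp add: pos_less_divide_eq mult.commute)
      qed
      finally have sm: "4 * c'\<^sup>2 * ?\<tau> < c * g" .
      let ?B = "\<lambda>x y. \<epsilon> * \<omega> x (?P t y)"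
      have pos: "?B (u + n) (u + n) > 0" if u: "u \<in> U" and n: "n \<in> N" and nz: "u \<noteq> 0 \<or> n \<noteq> 0" for u n
      proof (rule perturbed_form_pos[OF blP[OF tr] _ c(1) g(1) less_imp_le[OF c'] \<tau>(1) sm _ _ _ nz])
        have nK: "n \<in> l t0" "n \<in> C" and uC: "u \<in> C" using u n U(2) N(2) by auto
        show "?B n u = ?B u n" using sym_on_proj[OF tr C] uC nK by (auto simp: sym_on_def)
        have "\<bar>\<omega> u (?P t u) - \<omega> u (?P t0 u)\<bar> = \<bar>\<omega> u (?P t u - ?P t0 u)\<bar>" by (simp add: omega_simps)
        also have "\<dots> \<le> k * norm u * norm (?P t u - ?P t0 u)" by (rule k(2))
        also have "\<dots> \<le> k * norm u * (c / (2 * k) * norm u)" using k near by (intro mult_left_mono) auto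
        also have "\<dots> = c / 2 * (norm u)\<^sup>2" using k by (simp add: power2_eq_square)
        finally have "\<bar>\<epsilon> * \<omega> u (?P t u) - \<epsilon> * \<omega> u (?P t0 u)\<bar> \<le> c / 2 * (norm u)\<^sup>2"
          using abs\<epsilon>[of "\<omega> u (?P t u) - \<omega> u (?P t0 u)"] by (simp add: right_diff_distrib)
        then show "?B u u \<ge> c / 2 * (norm u)\<^sup>2" using c(2)[OF u] by linarith
        let ?r = "?P t n - n - (t - t0) *\<^sub>R D n"
        have r: "norm ?r \<le> e * ?\<tau> * norm n" by (rule d[OF nK(1)])
        have Pn: "\<omega> x (?P t n) = (t - t0) * \<omega> x (D n) + \<omega> x ?r" if "x \<in> C" for x
          using lagrangian_isotropic[OF C that nK(2)] by (simp add: omega_simps)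
        have "\<epsilon> * \<omega> n (?P t n) = ?\<tau> * (\<epsilon> * \<sigma> * \<omega> n (D n)) + \<epsilon> * \<omega> n ?r"
        proof -
          have "\<epsilon> * \<omega> n (?P t n) = \<epsilon> * ((\<sigma> * ?\<tau>) * \<omega> n (D n) + \<omega> n ?r)"
            by (simp only: Pn[OF nK(2)] \<tau>(3))
          then show ?thesis by (simp only: distrib_left mult_ac)
        qed
        moreover have "?\<tau> * (\<epsilon> * \<sigma> * \<omega> n (D n)) \<ge> ?\<tau> * (g * (norm n)\<^sup>2)"
          using g(2)[OF n] by (intro mult_left_mono) auto
        moreover have "\<bar>\<epsilon> * \<omega> n ?r\<bar> \<le> ?\<tau> * (g / 2) * (norm n)\<^sup>2"
        proof -
          have "\<bar>\<epsilon> * \<omega> n ?r\<bar> \<le> k * norm n * norm ?r" unfolding abs\<epsilon> by (rule k(2))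
          also have "\<dots> \<le> k * norm n * (e * ?\<tau> * norm n)" using k r by (intro mult_left_mono) auto
          also have "\<dots> = (k * e) * (?\<tau> * (norm n)\<^sup>2)" by (simp add: power2_eq_square)
          also have "\<dots> \<le> g / 2 * (?\<tau> * (norm n)\<^sup>2)" using e by (intro mult_right_mono) auto
          finally show ?thesis by (simp add: mult_ac)
        qed
        ultimately show "?B n n \<ge> ?\<tau> * (g / 2) * (norm n)\<^sup>2" by (simp add: abs_le_iff algebra_simps)
        have "norm (?P t n - n) = norm (?r + (t - t0) *\<^sub>R D n)" by simp
        also have "\<dots> \<le> norm ?r + ?\<tau> * norm (D n)" by (metis norm_triangle_ineq norm_scaleR)
        also have "\<dots> \<le> 1 * ?\<tau> * norm n + ?\<tau> * (B * norm n)"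
        proof (intro add_mono mult_left_mono B(2))
          show "norm ?r \<le> 1 * ?\<tau> * norm n"
            using r mult_right_mono[OF e(2), of "?\<tau> * norm n"] by (simp add: mult.assoc)
        qed auto
        also have "\<dots> = (B + 1) * ?\<tau> * norm n" by (simp add: algebra_simps)
        finally have bd: "norm (?P t n - n) \<le> (B + 1) * ?\<tau> * norm n" .
        have "\<bar>?B u n\<bar> = \<bar>\<omega> u (?P t n - n)\<bar>"
          unfolding abs\<epsilon> using lagrangian_isotropic[OF C uC nK(2)] by (simp add: omega_simps)
        also have "\<dots> \<le> k * norm u * norm (?P t n - n)" by (rule k(2))
        also have "\<dots> \<le> k * norm u * ((B + 1) * ?\<tau> * norm n)" using k bd by (intro mult_left_mono) auto
        finally show "\<bar>?B u n\<bar> \<le> c' * ?\<tau> * norm u * norm n" by (simp add: c'_def mult_ac)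
      qed
      have "dim (sum_space U N) \<le> form_index ?B C"
      proof (rule pos_index_ge)
        show "subspace (sum_space U N)" by (intro subspace_sums U N)
        show "sum_space U N \<subseteq> C" using U(2) N(2) by (intro sum_space_subset sC) auto
        fix x assume "x \<in> sum_space U N" "x \<noteq> 0"
        then obtain u n where "x = u + n" "u \<in> U" "n \<in> N" by blast
        moreover from this have "u \<noteq> 0 \<or> n \<noteq> 0" using \<open>x \<noteq> 0\<close> by auto
        ultimately show "?B x x > 0" using pos by blast
      qed
      moreover have "dim (U \<inter> N) = 0" using UN by (simp add: dim_eq_0)
      ultimately show "pos_index (\<lambda>x. \<epsilon> * \<omega> x (?P t0 x)) C + pos_index (\<lambda>x. \<epsilon> * \<sigma> * \<omega> x (D x)) ?K
        \<le> form_index ?B C"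
        using dim_sums_Int[OF U(1) N(1)] U(4) N(4) by linarith
    qed
  qed
qed

text \<open>To the right of \<open>t0\<close> the positive index gains at least the positive index
  of the crossing form and the negative index at least its negative index; to the left the roles are
  exchanged. For a nondegenerate crossing form the two gains exhaust
  \<open>dim (l t0 \<inter> C)\<close>, the nullity that can be lost, so both are exact and the
  intersection becomes trivial.\<close>

lemma chart_index_jump:
  assumes reg: "qf_nondegenerate (crossing_form \<omega> l C a b t0) (l t0 \<inter> C)"
  obtains d where "d > 0"
    "\<And>t. t \<in> {a..b} \<Longrightarrow> t0 < t \<Longrightarrow> t < t0 + d \<Longrightarrow> l t \<inter> C = {0} \<and>
      chart_index C W (l t) = chart_index C W (l t0) + pos_index (crossing_form \<omega> l C a b t0) (l t0 \<inter> C)"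
    "\<And>t. t \<in> {a..b} \<Longrightarrow> t0 - d < t \<Longrightarrow> t < t0 \<Longrightarrow> l t \<inter> C = {0} \<and>
      chart_index C W (l t) = chart_index C W (l t0) + neg_index (crossing_form \<omega> l C a b t0) (l t0 \<inter> C)"
proof -
  let ?F = "at t0 within {a..b}" and ?P = "\<lambda>t. proj W (l t)" and ?K = "l t0 \<inter> C"
  let ?cf = "crossing_form \<omega> l C a b t0"
  obtain D where D: "linear D" "\<And>e. e > 0 \<Longrightarrow> \<forall>\<^sub>F t in ?F. transversal W (l t) \<and>
      (\<forall>v\<in>l t0. norm (?P t v - v - (t - t0) *\<^sub>R D v) \<le> e * \<bar>t - t0\<bar> * norm v)"
    using proj_derivative[OF ab C1 cont t0 W] by blast
  have cf: "?cf v = \<omega> v (D v)" if v: "v \<in> l t0" for v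
  proof -
    obtain u u' where u: "\<And>t. t \<in> {a..b} \<Longrightarrow> u t \<in> l t" "u t0 = v" "(u has_vector_derivative u') ?F"
      using frame_curve[OF ab C1 cont t0 v] by blast
    have "?cf (u t0) = \<omega> (u t0) u'" by (rule crossing_form_eq[OF ab C1 cont t0 u(1,3)])
    then show ?thesis
      using crossing_form_derivative(2)[OF ab C1 cont t0 W v D(2) u] u(2) by simp
  qed
  have sC: "subspace C" by (rule lagrangian_subspace[OF C])
  have sK: "subspace ?K" by (intro subspace_inter sC transversal_subspace(2)[OF W])
  have bb: "bounded_bilinear \<omega>" using bil bilinear_conv_bounded_bilinear by blast
  \<comment> \<open>Differentiating the symmetry of the projection forms on \<open>C\<close> at
    \<open>t0\<close> gives the symmetry of the derivative on the intersection.\<close>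
  have symK: "\<omega> x (D y) = \<omega> y (D x)" if "x \<in> ?K" "y \<in> ?K" for x y
  proof -
    have d: "((\<lambda>t. \<omega> p (?P t q)) has_vector_derivative \<omega> p (D q)) ?F" if "q \<in> ?K" for p q
      using that by (intro bounded_linear.has_vector_derivative[OF bounded_bilinear.bounded_linear_right[OF bb]]
         crossing_form_derivative(1)[OF ab C1 cont t0 W _ D(2)]) auto
    obtain r where r: "r > 0" "\<And>t. t \<in> {a..b} \<Longrightarrow> t \<noteq> t0 \<Longrightarrow> dist t t0 < r \<Longrightarrow> transversal W (l t)"
      using D(2)[OF zero_less_one] unfolding eventually_at by blast
    have "((\<lambda>t. \<omega> y (?P t x)) has_vector_derivative \<omega> x (D y)) ?F"
    proof (rule has_vector_derivative_transform_within[OF d r(1) t0])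
      show "y \<in> ?K" by fact
      fix t assume t: "t \<in> {a..b}" "dist t t0 < r"
      have "transversal W (l t)" using r(2)[OF t(1)] W t by (cases "t = t0") auto
      then show "\<omega> x (?P t y) = \<omega> y (?P t x)" using sym_on_proj[OF _ C] that by (auto simp: sym_on_def)
    qed
    then show ?thesis
      using vector_derivative_unique_within[OF not_bot[OF ab C1 cont t0]] d[OF that(1), of y] by blast
  qed
  let ?G = "\<lambda>x y. \<omega> x (D y)"
  have blD: "bilinear ?G" by (rule bilinear_compose[OF bil linear_ident D(1)])
  have symG: "sym_on ?G ?K" using blD sK symK by (simp add: sym_on_def)
  have "radical ?G ?K \<subseteq> {0}"
  proof
    fix u assume u: "u \<in> radical ?G ?K"
    then have uK: "u \<in> ?K" by (simp add: radical_def)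
    have "?cf (u + v) - ?cf u - ?cf v = 0" if v: "v \<in> ?K" for v
    proof -
      have "u + v \<in> l t0" using uK v transversal_subspace(2)[OF W] by (auto intro: subspace_add)
      moreover have "?G u v = 0" using u v by (simp add: radical_def)
      moreover have "?G v u = ?G u v" by (rule symK[OF v uK])
      ultimately show ?thesis
        using uK v bilinear_square_add[OF blD, of v u] by (simp add: cf)
    qed
    then show "u \<in> {0}" using reg uK unfolding qf_nondegenerate_def by blast
  qed
  then have "dim (radical ?G ?K) = 0" by (simp add: dim_eq_0)
  then have G: "form_index ?G ?K + neg_index (\<lambda>x. ?G x x) ?K = dim ?K"
    using pos_neg_radical_dim[OF symG] by linarith
  have pcf: "pos_index ?cf ?K = form_index ?G ?K" by (rule pos_index_cong) (simp add: cf)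
  have ncf: "neg_index ?cf ?K = neg_index (\<lambda>x. ?G x x) ?K" by (rule neg_index_cong) (simp add: cf)
  have tot: "chart_index C W (l t) + neg_index (\<lambda>x. \<omega> x (?P t x)) C + dim (C \<inter> l t) + dim (C \<inter> W) = dim C"
    if "transversal W (l t)" for t
    using pos_neg_radical_dim[OF sym_on_proj[OF that C]] dim_radical_proj[OF that C]
    unfolding chart_index_def by simp
  have LB: "\<forall>\<^sub>F t in ?F. \<sigma> * (t - t0) > 0 \<longrightarrow>
    pos_index (\<lambda>x. \<epsilon> * \<omega> x (?P t0 x)) C + pos_index (\<lambda>x. \<epsilon> * \<sigma> * \<omega> x (D x)) ?K
    \<le> pos_index (\<lambda>x. \<epsilon> * \<omega> x (?P t x)) C"
    if "\<epsilon> = 1 \<or> \<epsilon> = -1" "\<sigma> = 1 \<or> \<sigma> = -1" for \<epsilon> \<sigma> :: real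
    by (rule chart_form_index_lower_bound[OF D(1) _ that]) (rule D(2))
  have ev: "\<forall>\<^sub>F t in ?F. transversal W (l t)" using D(2)[OF zero_less_one] by eventually_elim auto
  \<comment> \<open>By \<open>tot\<close>, both indices together can gain at most
    \<open>dim ?K\<close>; lower bounds that add up to it are exact.\<close>
  have concl: "l t \<inter> C = {0} \<and> chart_index C W (l t) = chart_index C W (l t0) + p"
    if tr: "transversal W (l t)" and pq: "p + q = dim ?K"
      and p: "chart_index C W (l t0) + p \<le> chart_index C W (l t)"
      and q: "neg_index (\<lambda>x. \<omega> x (?P t0 x)) C + q \<le> neg_index (\<lambda>x. \<omega> x (?P t x)) C" for t p q
  proof -
    have "dim (C \<inter> l t0) = dim ?K" by (simp only: Int_commute)
    then have *: "dim (C \<inter> l t) = 0 \<and> chart_index C W (l t) = chart_index C W (l t0) + p"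
      using tot[OF W] tot[OF tr] p q pq by (intro conjI) linarith+
    then have "C \<inter> l t \<subseteq> {0}" by (simp add: dim_eq_0)
    moreover have "0 \<in> C \<inter> l t" using subspace_0[OF sC] subspace_0[OF transversal_subspace(2)[OF tr]] by simp
    ultimately show ?thesis using * by blast
  qed
  have ni: "neg_index (\<lambda>x. \<omega> x (?P t x)) C = pos_index (\<lambda>x. - \<omega> x (?P t x)) C"
    "neg_index (\<lambda>x. ?G x x) ?K = pos_index (\<lambda>x. - ?G x x) ?K" for t
    by (auto simp: neg_index_def)
  have "\<forall>\<^sub>F t in ?F. (t - t0 > 0 \<longrightarrow> l t \<inter> C = {0} \<and>
      chart_index C W (l t) = chart_index C W (l t0) + pos_index ?cf ?K) \<and>
    (t - t0 < 0 \<longrightarrow> l t \<inter> C = {0} \<and>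
      chart_index C W (l t) = chart_index C W (l t0) + neg_index ?cf ?K)"
    using ev LB[OF disjI1 disjI1, OF refl refl] LB[OF disjI2 disjI1, OF refl refl]
      LB[OF disjI1 disjI2, OF refl refl] LB[OF disjI2 disjI2, OF refl refl]
  proof eventually_elim
    case (elim t)
    show ?case
    proof (intro conjI impI)
      assume t: "t - t0 > 0"
      show "l t \<inter> C = {0}" "chart_index C W (l t) = chart_index C W (l t0) + pos_index ?cf ?K"
        using concl[OF elim(1) G] elim(2,3) t pcf ni by (simp_all add: chart_index_def)
    next
      assume t: "t - t0 < 0"
      show "l t \<inter> C = {0}" "chart_index C W (l t) = chart_index C W (l t0) + neg_index ?cf ?K"
        using concl[OF elim(1), of "neg_index (\<lambda>x. ?G x x) ?K" "form_index ?G ?K"] G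
          elim(4,5) t ncf ni by (simp_all add: chart_index_def)
    qed
  qed
  then obtain d where d: "d > 0" "\<And>t. t \<in> {a..b} \<Longrightarrow> t \<noteq> t0 \<Longrightarrow> dist t t0 < d \<Longrightarrow>
     (t - t0 > 0 \<longrightarrow> l t \<inter> C = {0} \<and>
      chart_index C W (l t) = chart_index C W (l t0) + pos_index ?cf ?K) \<and>
    (t - t0 < 0 \<longrightarrow> l t \<inter> C = {0} \<and>
      chart_index C W (l t) = chart_index C W (l t0) + neg_index ?cf ?K)"
    unfolding eventually_at by blast
  show ?thesis
  proof (rule that[OF d(1)])
    fix t assume "t \<in> {a..b}" "t0 < t" "t < t0 + d"
    then show "l t \<inter> C = {0} \<and> chart_index C W (l t) = chart_index C W (l t0) + pos_index ?cf ?K"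
      using d(2)[of t] by (simp add: dist_real_def)
  next
    fix t assume "t \<in> {a..b}" "t0 - d < t" "t < t0"
    then show "l t \<inter> C = {0} \<and> chart_index C W (l t) = chart_index C W (l t0) + neg_index ?cf ?K"
      using d(2)[of t] by (simp add: dist_real_def)
  qed
qed

end

text \<open>On each side of any time there is an interval without crossings on which the primitive
  has jumped by one index of the crossing form. Bisection sums up these jumps.\<close>

lemma maslov_regular_eq_primitive:
  assumes ab: "a < b" and C1: "lag_C1 \<omega> l a b" and cont: "subspace_continuous_on {a..b} l"
    and C: "lagrangian \<omega> C" and reg: "regular_crossings \<omega> l C a b" and M: "primitive C {a..b} l M"
  shows "maslov_regular \<omega> C l a b = M b - M a"
proof -
  let ?q = "crossing_form \<omega> l C a b"
  define jr where "jr t = int (pos_index (?q t) (l t \<inter> C))" for t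
  define jl where "jl t = int (neg_index (?q t) (l t \<inter> C))" for t
  let ?X = "\<lambda>x y. {t. x < t \<and> t < y \<and> is_crossing l C t}"
  have nocross: "jr t = 0" "jl t = 0" if "\<not> is_crossing l C t" for t
    using that by (auto simp: jr_def jl_def is_crossing_def)
  \<comment> \<open>The right jump counts at the left end and the left jump at the right end, so
    joining two intervals at \<open>y\<close> produces exactly the term \<open>jr y - jl y\<close>
    of an interior crossing. Finiteness is part of the claim since a sum over an infinite set is
    0.\<close>
  let ?Q = "\<lambda>x y. a \<le> x \<longrightarrow> x < y \<longrightarrow> y \<le> b \<longrightarrow> finite (?X x y) \<and>
    M y - M x = jr x + (\<Sum>t\<in>?X x y. jr t - jl t) - jl y"
  have "\<forall>x0 y0. x0 = a \<longrightarrow> y0 = b \<longrightarrow> ?Q x0 y0"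
  proof -
    have jump: "\<exists>d>0. (\<forall>t\<in>{a..b}. t0 < t \<longrightarrow> t < t0 + d \<longrightarrow> \<not> is_crossing l C t \<and> M t = M t0 + jr t0) \<and>
        (\<forall>t\<in>{a..b}. t0 - d < t \<longrightarrow> t < t0 \<longrightarrow> \<not> is_crossing l C t \<and> M t = M t0 + jl t0)"
      if t0: "t0 \<in> {a..b}" for t0
    proof -
      obtain W where W: "transversal W (l t0)" using transversal_exists[OF path_lagrangian[OF ab C1 cont t0]] .
      have nd: "qf_nondegenerate (?q t0) (l t0 \<inter> C)"
      proof (cases "is_crossing l C t0")
        case True
        then show ?thesis using reg t0 by (simp add: regular_crossings_def)
      next
        case False
        then show ?thesis by (simp add: is_crossing_def qf_nondegenerate_def)
      qed
      obtain d1 where d1: "d1 > 0"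
        "\<And>t. t \<in> {a..b} \<Longrightarrow> t0 < t \<Longrightarrow> t < t0 + d1 \<Longrightarrow> l t \<inter> C = {0} \<and>
          chart_index C W (l t) = chart_index C W (l t0) + pos_index (?q t0) (l t0 \<inter> C)"
        "\<And>t. t \<in> {a..b} \<Longrightarrow> t0 - d1 < t \<Longrightarrow> t < t0 \<Longrightarrow> l t \<inter> C = {0} \<and>
          chart_index C W (l t) = chart_index C W (l t0) + neg_index (?q t0) (l t0 \<inter> C)"
        using chart_index_jump[OF ab C1 cont t0 C W nd] by blast
      obtain d2 where d2: "d2 > 0" "\<And>t. t \<in> {a..b} \<Longrightarrow> dist t t0 < d2 \<Longrightarrow>
        offset C W l M t = offset C W l M t0"
        using primitiveD[OF M t0 W] by blast
      show ?thesis
      proof (intro exI[of _ "min d1 d2"] conjI ballI impI)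
        show "min d1 d2 > 0" using d1 d2 by simp
      next
        fix t assume t: "t \<in> {a..b}" "t0 < t" "t < t0 + min d1 d2"
        then show "\<not> is_crossing l C t" using d1(2)[of t] by (simp add: is_crossing_def)
        have "t < t0 + d1" "dist t t0 < d2" using t by (auto simp: dist_real_def)
        then show "M t = M t0 + jr t0" using d1(2)[of t] d2(2)[of t] t by (simp add: jr_def)
      next
        fix t assume t: "t \<in> {a..b}" "t0 - min d1 d2 < t" "t < t0"
        then show "\<not> is_crossing l C t" using d1(3)[of t] by (simp add: is_crossing_def)
        have "t0 - d1 < t" "dist t t0 < d2" using t by (auto simp: dist_real_def)
        then show "M t = M t0 + jl t0" using d1(3)[of t] d2(2)[of t] t by (simp add: jl_def)
      qed
    qed
    \<comment> \<open>Fresh names keep the interval ends, over which the bisection ranges, apart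
      from the bounds \<open>a\<close> and \<open>b\<close> inside \<open>?Q\<close>.\<close>
    define A B where "A = a" and "B = b"
    have "A \<le> B" using ab by (simp add: A_def B_def)
    then have "?Q A B"
    proof (induction rule: Bolzano)
      case (trans x y z)
      show ?case
      proof (intro impI)
        assume g: "a \<le> x" "x < z" "z \<le> b"
        consider "x = y" | "y = z" | "x < y" "y < z" using trans(3,4) by linarith
        then show "finite (?X x z) \<and> M z - M x = jr x + (\<Sum>t\<in>?X x z. jr t - jl t) - jl z"
        proof cases
          case 3
          have 1: "finite (?X x y)" "M y - M x = jr x + (\<Sum>t\<in>?X x y. jr t - jl t) - jl y"
            using trans(1) g 3 by auto
          have 2: "finite (?X y z)" "M z - M y = jr y + (\<Sum>t\<in>?X y z. jr t - jl t) - jl z"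
            using trans(2) g 3 by auto
          let ?Y = "if is_crossing l C y then {y} else {}"
          have X: "?X x z = ?X x y \<union> (?Y \<union> ?X y z)" using 3 by (auto simp: not_less le_less)
          have "(\<Sum>t\<in>?X x z. jr t - jl t) = (\<Sum>t\<in>?X x y. jr t - jl t) + (\<Sum>t\<in>?Y \<union> ?X y z. jr t - jl t)"
            unfolding X using 1 2 3 by (intro sum.union_disjoint) auto
          also have "(\<Sum>t\<in>?Y \<union> ?X y z. jr t - jl t) = (\<Sum>t\<in>?Y. jr t - jl t) + (\<Sum>t\<in>?X y z. jr t - jl t)"
            using 1 2 3 by (intro sum.union_disjoint) auto
          also have "(\<Sum>t\<in>?Y. jr t - jl t) = jr y - jl y" using nocross[of y] by simp
          finally have "M z - M x = jr x + (\<Sum>t\<in>?X x z. jr t - jl t) - jl z" using 1 2 by simp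
          moreover have "finite (?X x z)" unfolding X using 1 2 by simp
          ultimately show ?thesis by blast
        qed (use trans(1,2) g in auto)
      qed
    next
      case (local t)
      then have tab: "t \<in> {a..b}" by (simp add: A_def B_def)
      obtain d where d: "d > 0"
        "\<And>s. s \<in> {a..b} \<Longrightarrow> t < s \<Longrightarrow> s < t + d \<Longrightarrow> \<not> is_crossing l C s \<and> M s = M t + jr t"
        "\<And>s. s \<in> {a..b} \<Longrightarrow> t - d < s \<Longrightarrow> s < t \<Longrightarrow> \<not> is_crossing l C s \<and> M s = M t + jl t"
        using jump[OF tab] by blast
      show ?case
      proof (rule exI[of _ d], intro conjI d(1) allI, rule impI, intro impI)
        fix x y assume xy: "x \<le> t \<and> t \<le> y \<and> y - x < d" and g: "a \<le> x" "x < y" "y \<le> b"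
        have X: "?X x y = (if x < t \<and> t < y \<and> is_crossing l C t then {t} else {})"
        proof -
          have st: "s = t" if "s \<in> ?X x y" for s
          proof (rule ccontr)
            assume "s \<noteq> t"
            then consider "s < t" | "t < s" by linarith
            then show False
            proof cases
              case 1
              have "s \<in> {a..b}" "t - d < s" using that xy g 1 by auto
              then show False using d(3)[of s] 1 that by blast
            next
              case 2
              have "s \<in> {a..b}" "s < t + d" using that xy g 2 by auto
              then show False using d(2)[of s] 2 that by blast
            qed
          qed
          show ?thesis
          proof (intro equalityI subsetI)
            fix s assume "s \<in> ?X x y"
            with st[OF this] show "s \<in> (if x < t \<and> t < y \<and> is_crossing l C t then {t} else {})" by simp
          qed (simp split: if_splits)
        qed
        have Ml: "M x = M t + jl t \<and> jr x = 0" if "x < t"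
          using d(3)[of x] that xy g nocross[of x] by auto
        have Mr: "M y = M t + jr t \<and> jl y = 0" if "t < y"
          using d(2)[of y] that xy g nocross[of y] by auto
        consider "x = t" "t < y" | "x < t" "t = y" | "x < t" "t < y" using xy g by linarith
        then show "finite (?X x y) \<and> M y - M x = jr x + (\<Sum>t\<in>?X x y. jr t - jl t) - jl y"
        proof cases
          case 1 then show ?thesis unfolding X using Mr by simp
        next
          case 2 then show ?thesis unfolding X using Ml by simp
        next
          case 3
          then show ?thesis unfolding X using Ml Mr nocross[of t] by simp
        qed
      qed
    qed
    then show ?thesis by (auto simp: A_def B_def)
  qed
  then have "M b - M a = jr a + (\<Sum>t\<in>?X a b. jr t - jl t) - jl b" using ab by auto
  then show ?thesis unfolding maslov_regular_def jr_def jl_def qf_signature_def by simp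
qed

end

subsection \<open>Images of a Lagrangian under symplectic maps\<close>

lemma linear_blinfun: "linear (blinfun_apply A)"
  by (simp add: blinfun.bounded_linear_right bounded_linear.linear)

text \<open>Injectivity bounds the maps below, so preimages of the unit ball are bounded and nearby
  maps move them little.\<close>

lemma subspace_continuous_on_image:
  fixes A :: "'a::metric_space \<Rightarrow> ('v::euclidean_space \<Rightarrow>\<^sub>L 'v)"
  assumes A: "continuous_on D A" and inj: "\<And>p. p \<in> D \<Longrightarrow> inj (blinfun_apply (A p))" and L: "subspace L"
  shows "subspace_continuous_on D (\<lambda>p. A p ` L)"
  unfolding subspace_continuous_on_def
proof (intro ballI allI impI)
  fix p and e :: real assume p: "p \<in> D" and e: "e > 0"
  obtain c where c: "c > 0" "\<And>x. c * norm x \<le> norm (A p x)"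
    using linear_inj_bounded_below_pos[OF linear_blinfun inj[OF p]] by (metis mult.commute)
  \<comment> \<open>The first bound keeps half of the lower bound \<open>c\<close> for nearby maps;
    the second yields an error of \<open>(c * e / 4) * (2 / c) = e / 2\<close>, which leaves room
    for the strict inequality.\<close>
  define \<eta> where "\<eta> = min (c / 2) (c * e / 4)"
  have \<eta>: "\<eta> > 0" "\<eta> \<le> c / 2" "\<eta> \<le> c * e / 4" using c e by (auto simp: \<eta>_def)
  obtain d where d: "d > 0" "\<And>q. q \<in> D \<Longrightarrow> dist q p < d \<Longrightarrow> dist (A q) (A p) < \<eta>"
    using A p \<eta>(1) unfolding continuous_on_iff by metis
  show "\<exists>d>0. \<forall>q\<in>D. dist q p < d \<longrightarrow> subspace_dist (A q ` L) (A p ` L) < e"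
  proof (intro exI[of _ d] conjI d(1) ballI impI)
    fix q assume q: "q \<in> D" "dist q p < d"
    have near: "norm (A q x - A p x) \<le> \<eta> * norm x" for x
    proof -
      have "norm ((A q - A p) x) \<le> norm (A q - A p) * norm x" by (rule norm_blinfun)
      also have "\<dots> \<le> \<eta> * norm x" using d(2)[OF q] by (intro mult_right_mono) (auto simp: dist_norm)
      finally show ?thesis by (simp add: blinfun.diff_left)
    qed
    have below: "c / 2 * norm x \<le> norm (A q x)" "c / 2 * norm x \<le> norm (A p x)" for x
    proof -
      have "c / 2 * norm x \<le> c * norm x" using c by (intro mult_right_mono) auto
      then show "c / 2 * norm x \<le> norm (A p x)" using c(2)[of x] by linarith
      have "norm (A p x) \<le> norm (A q x) + norm (A q x - A p x)"
        by (metis norm_triangle_sub norm_minus_commute)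
      moreover have "\<eta> * norm x \<le> c / 2 * norm x" using \<eta> by (intro mult_right_mono) auto
      ultimately show "c / 2 * norm x \<le> norm (A q x)" using c(2)[of x] near[of x] by (simp add: field_simps)
    qed
    have half: "(SUP x\<in>(B ` L) \<inter> cball 0 1. infdist x (B' ` L)) \<le> e / 2"
      if lin: "linear B" and low: "\<And>x. c / 2 * norm x \<le> norm (B x)"
        and nr: "\<And>x. norm (B x - B' x) \<le> \<eta> * norm x" for B B' :: "'v \<Rightarrow> 'v"
    proof (rule cSUP_least)
      have "B 0 \<in> B ` L \<inter> cball 0 1" using subspace_0[OF L] linear_0[OF lin] by auto
      then show "B ` L \<inter> cball 0 1 \<noteq> {}" by blast
      fix y assume "y \<in> B ` L \<inter> cball 0 1"
      then obtain x where x: "x \<in> L" "y = B x" "norm (B x) \<le> 1" by auto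
      have "c / 2 * norm x \<le> 1" using low[of x] x by linarith
      then have nx: "norm x \<le> 2 / c" using c by (simp add: field_simps)
      have "infdist y (B' ` L) \<le> dist y (B' x)" using x by (intro infdist_le) auto
      also have "\<dots> \<le> \<eta> * norm x" using nr x by (simp add: dist_norm)
      also have "\<dots> \<le> (c * e / 4) * (2 / c)" using \<eta> nx c e by (intro mult_mono) auto
      also have "\<dots> = e / 2" using c by simp
      finally show "infdist y (B' ` L) \<le> e / 2" .
    qed
    have "subspace_dist (A q ` L) (A p ` L) \<le> e / 2"
      unfolding subspace_dist_def
    proof (intro max.boundedI half linear_blinfun below near)
      show "norm (A p x - A q x) \<le> \<eta> * norm x" for x using near[of x] by (simp add: norm_minus_commute)
    qed
    then show "subspace_dist (A q ` L) (A p ` L) < e" using e by linarith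
  qed
qed

text \<open>Testing the polarized form against \<open>u\<close> itself gives \<open>2 * q u\<close>.
  For crossing forms the doubling rule is supplied by \<open>crossing_form_double\<close>.\<close>

lemma definite_nondegenerate:
  assumes "\<And>u. u \<in> S \<Longrightarrow> u \<noteq> 0 \<Longrightarrow> q u \<noteq> 0" "\<And>u. u \<in> S \<Longrightarrow> q (u + u) = 4 * q u"
  shows "qf_nondegenerate q S"
  unfolding qf_nondegenerate_def
proof (intro ballI impI)
  fix u assume u: "u \<in> S" "\<forall>v\<in>S. q (u + v) - q u - q v = 0"
  then have "q u = 0" using assms(2)[OF u(1)] by force
  then show "u = 0" using assms(1)[OF u(1)] by blast
qed

context symplectic
begin

lemma symplectic_map_lagrangian:
  assumes A: "symplectic_map \<omega> A" and L: "lagrangian \<omega> L"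
  shows "lagrangian \<omega> (A ` L)"
proof -
  have "inj A" using A by (auto simp: symplectic_map_def bij_def)
  then have "dim (A ` L) = dim L" by (intro dim_image_eq[OF linear_blinfun]) (rule inj_on_subset, auto)
  then show ?thesis
    using A L linear_subspace_image[OF linear_blinfun, of L A]
    unfolding lagrangian_def symplectic_map_def by auto
qed

lemma symplectic_map_inj: "symplectic_map \<omega> A \<Longrightarrow> inj (blinfun_apply A)"
  by (auto simp: symplectic_map_def bij_def)

lemma lag_C1_image:
  assumes A: "C1_on_interval a b A" "\<And>t. t \<in> {a..b} \<Longrightarrow> symplectic_map \<omega> (A t)" and L: "lagrangian \<omega> L"
  shows "lag_C1 \<omega> (\<lambda>t. A t ` L) a b"
proof -
  have sL: "subspace L" by (rule lagrangian_subspace[OF L])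
  obtain B where B: "B \<subseteq> L" "independent B" "L \<subseteq> span B" "card B = dim L" using basis_exists by blast
  have "finite B" using B(2) independent_imp_finite by blast
  then obtain h where h: "bij_betw h {0..<card B} B" using ex_bij_betw_nat_finite by blast
  have n: "card B = DIM('v) div 2" using B(4) lagrangian_dim[OF L] by simp
  have span: "span (h ` {..<DIM('v) div 2}) = L"
  proof -
    have "h ` {..<DIM('v) div 2} = B" using h n by (auto simp: bij_betw_def atLeast0LessThan)
    moreover have "span B = L" using B(1,3) sL span_minimal by blast
    ultimately show ?thesis by simp
  qed
  show ?thesis
    unfolding lag_C1_def
  proof (intro conjI ballI exI[of _ "\<lambda>t i. A t (h i)"] allI)
    show "lagrangian \<omega> (A t ` L)" if "t \<in> {a..b}" for t
      by (rule symplectic_map_lagrangian[OF A(2)[OF that] L])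
    show "A t ` L = span ((\<lambda>i. A t (h i)) ` {..<DIM('v) div 2})" if "t \<in> {a..b}" for t
      using linear_span_image[OF linear_blinfun, of "A t" "h ` {..<DIM('v) div 2}"]
      by (simp add: span image_image)
    obtain A' where A': "\<And>t. t \<in> {a..b} \<Longrightarrow> (A has_vector_derivative A' t) (at t within {a..b})"
      "continuous_on {a..b} A'" using A(1) unfolding C1_on_interval_def by blast
    show "C1_on_interval a b (\<lambda>t. A t (h i))" for i
      unfolding C1_on_interval_def
    proof (intro exI[of _ "\<lambda>t. A' t (h i)"] conjI ballI)
      show "((\<lambda>t. A t (h i)) has_vector_derivative A' t (h i)) (at t within {a..b})" if "t \<in> {a..b}" for t
        by (rule bounded_linear.has_vector_derivative[OF blinfun.bounded_linear_left A'(1)[OF that]])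
      show "continuous_on {a..b} (\<lambda>t. A' t (h i))" by (intro continuous_intros A'(2))
    qed
  qed
qed

lemma C1_on_interval_continuous: "C1_on_interval a b f \<Longrightarrow> continuous_on {a..b} f"
  unfolding C1_on_interval_def
  by (meson continuous_on_eq_continuous_within has_vector_derivative_continuous)

lemma subspace_continuous_image:
  assumes A: "continuous_on D A" "\<And>t. t \<in> D \<Longrightarrow> symplectic_map \<omega> (A t)" and L: "lagrangian \<omega> L"
  shows "subspace_continuous_on D (\<lambda>t. A t ` L)"
  by (rule subspace_continuous_on_image[OF A(1) symplectic_map_inj[OF A(2)] lagrangian_subspace[OF L]])

lemma crossing_form_image:
  assumes ab: "a < b" and A: "C1_on_interval a b A" "\<And>t. t \<in> {a..b} \<Longrightarrow> symplectic_map \<omega> (A t)"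
    and L: "lagrangian \<omega> L" and t0: "t0 \<in> {a..b}" "(A has_vector_derivative A') (at t0 within {a..b})"
    and e: "e \<in> L"
  shows "crossing_form \<omega> (\<lambda>t. A t ` L) C a b t0 (A t0 e) = \<omega> (A t0 e) (A' e)"
  by (rule crossing_form_eq[OF ab lag_C1_image[OF A L]
        subspace_continuous_image[OF C1_on_interval_continuous[OF A(1)] A(2) L] t0(1)])
     (use e bounded_linear.has_vector_derivative[OF blinfun.bounded_linear_left t0(2)] in auto)

lemma crossing_form_double:
  assumes ab: "a < b" and C1: "lag_C1 \<omega> l a b" and cont: "subspace_continuous_on {a..b} l"
    and t0: "t0 \<in> {a..b}" and v: "v \<in> l t0"
  shows "crossing_form \<omega> l C a b t0 (v + v) = 4 * crossing_form \<omega> l C a b t0 v"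
proof -
  obtain u u' where u: "\<And>t. t \<in> {a..b} \<Longrightarrow> u t \<in> l t" "u t0 = v"
    "(u has_vector_derivative u') (at t0 within {a..b})" using frame_curve[OF ab C1 cont t0 v] by blast
  have "crossing_form \<omega> l C a b t0 (u t0 + u t0) = \<omega> (u t0 + u t0) (u' + u')"
  proof (rule crossing_form_eq[OF ab C1 cont t0, of "\<lambda>t. u t + u t"])
    show "u t + u t \<in> l t" if "t \<in> {a..b}" for t
      by (intro subspace_add lagrangian_subspace[OF path_lagrangian[OF ab C1 cont that]] u that)
    show "((\<lambda>t. u t + u t) has_vector_derivative u' + u') (at t0 within {a..b})"
      by (intro has_vector_derivative_add u(3))
  qed
  moreover have "crossing_form \<omega> l C a b t0 (u t0) = \<omega> (u t0) u'"
    by (rule crossing_form_eq[OF ab C1 cont t0 u(1,3)])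
  ultimately show ?thesis using u(2) by (simp add: omega_simps)
qed

lemma iota_CLM_eq_primitive:
  assumes ab: "a < b" and C: "lagrangian \<omega> C" and M: "primitive C {a..b} l M"
    and l': "lag_C1 \<omega> l' a b" "regular_crossings \<omega> l' C a b" "lag_homotopic \<omega> a b l l'"
  shows "iota_CLM \<omega> C l a b = M b - M a"
proof -
  have eq: "maslov_regular \<omega> C k a b = M b - M a"
    if k: "lag_C1 \<omega> k a b" "regular_crossings \<omega> k C a b" "lag_homotopic \<omega> a b l k" for k
  proof -
    obtain M' where M': "primitive C {a..b} k M'" "M' b - M' a = M b - M a" "subspace_continuous_on {a..b} k"
      using primitive_homotopy[OF C less_imp_le[OF ab] k(3) M] by blast
    show ?thesis using maslov_regular_eq_primitive[OF ab k(1) M'(3) C k(2) M'(1)] M'(2) by simp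
  qed
  show ?thesis unfolding iota_CLM_def
  proof (rule the_equality)
    show "\<exists>l'. lag_C1 \<omega> l' a b \<and> regular_crossings \<omega> l' C a b \<and> lag_homotopic \<omega> a b l l' \<and>
        M b - M a = maslov_regular \<omega> C l' a b"
      using l' eq[OF l'] by (intro exI[of _ l']) simp
    show "m = M b - M a" if "\<exists>l'. lag_C1 \<omega> l' a b \<and> regular_crossings \<omega> l' C a b \<and>
        lag_homotopic \<omega> a b l l' \<and> m = maslov_regular \<omega> C l' a b" for m
      using that eq by blast
  qed
qed

subsection \<open>Rotations by a compatible complex structure\<close>

text \<open>Nondegeneracy makes the map from \<open>z\<close> to the coordinates of its functional
  injective, hence surjective by dimension.\<close>

lemma omega_riesz:
  assumes \<phi>: "linear \<phi>"
  obtains z where "\<And>y. \<omega> y z = (\<phi> y :: real)"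
proof -
  define S where "S z = (\<Sum>i\<in>Basis. \<omega> i z *\<^sub>R i)" for z
  have lin: "linear S" unfolding S_def
    by (rule linearI) (auto simp: omega_simps scaleR_add_left sum.distrib scaleR_sum_right)
  have Si: "S z \<bullet> i = \<omega> i z" if "i \<in> Basis" for z i
    unfolding S_def using that by (simp add: inner_sum_left_Basis)
  have "S z = 0 \<Longrightarrow> z = 0" for z
  proof (rule nondeg_right)
    fix y assume "S z = 0"
    then have "\<omega> i z = 0" if "i \<in> Basis" for i using Si[OF that, of z] by simp
    moreover have "linear (\<lambda>y. \<omega> y z)" using bil by (simp add: bilinear_def)
    ultimately have "(\<lambda>y. \<omega> y z) = (\<lambda>y. 0)" by (intro linear_eq_stdbasis linear_zero) auto
    then show "\<omega> y z = 0" by metis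
  qed
  then have "inj S" using linear_injective_0[OF lin] by blast
  then have "surj S" by (rule linear_injective_imp_surjective[OF lin _ refl])
  then obtain z where z: "S z = (\<Sum>i\<in>Basis. \<phi> i *\<^sub>R i)" by (metis surjD)
  have "\<omega> i z = \<phi> i" if "i \<in> Basis" for i
    using Si[OF that, of z] that unfolding z by (simp add: inner_sum_left_Basis)
  moreover have "linear (\<lambda>y. \<omega> y z)" using bil by (simp add: bilinear_def)
  ultimately have "(\<lambda>y. \<omega> y z) = \<phi>" by (intro linear_eq_stdbasis \<phi>) auto
  then show ?thesis using that by metis
qed

text \<open>\<open>X\<close> is a Lagrangian complement of \<open>L\<close>. The map
  \<open>j\<close> identifies \<open>L\<close> with \<open>X\<close> by transporting the inner
  product of \<open>L\<close> through \<omega>, and \<open>k\<close> is the inverse identification.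
  In the coordinates \<open>(?P x, k x)\<close> the form is standard and \<open>J\<close> sends
  \<open>(p, q)\<close> to \<open>(- q, p)\<close>.\<close>

lemma complex_structure_exists:
  assumes L: "lagrangian \<omega> L"
  obtains J where "linear J" "\<And>x. J (J x) = - x" "\<And>x y. \<omega> (J x) (J y) = \<omega> x y"
    "\<And>x. x \<noteq> 0 \<Longrightarrow> \<omega> x (J x) > 0"
proof -
  obtain X where X: "transversal X L" using transversal_exists[OF L] .
  let ?P = "proj X L" and ?Q = "proj L X"
  note X' = transversal_sym[OF X]
  have lP: "linear ?P" "linear ?Q" by (rule linear_proj[OF X], rule linear_proj[OF X'])
  have PQ: "?Q x = x - ?P x" for x by (rule proj_swap[OF X])
  have sX: "subspace X" "subspace L" by (rule transversal_subspace[OF X])+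
  have LX: "lagrangian \<omega> X" by (rule transversal_lagrangian(1)[OF X])
  have "\<exists>z. \<forall>y. \<omega> y z = ?P y \<bullet> ?P x" for x
  proof -
    have "linear (\<lambda>y. ?P y \<bullet> ?P x)"
      by (rule linearI) (auto simp: linear_add[OF lP(1)] linear_scale[OF lP(1)] inner_add_left)
    then show ?thesis using omega_riesz by metis
  qed
  then obtain j where j: "\<And>x y. \<omega> y (j x) = ?P y \<bullet> ?P x" by metis
  have eqI: "x = y" if "\<And>z. \<omega> z x = \<omega> z y" for x y
    using nondeg_right[of "x - y"] that by (simp add: omega_simps)
  have lj: "linear j"
    by (rule linearI; rule eqI) (auto simp: j omega_simps linear_add[OF lP(1)] linear_scale[OF lP(1)] inner_add_right)
  have jX: "j x \<in> X" for x
    by (rule lagrangian_maximal[OF LX]) (simp add: j proj_zero[OF X])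
  have jP: "j (?P x) = j x" for x
    by (rule eqI) (simp add: j proj_id[OF X proj_in[OF X]])
  have inj: "x = 0" if "x \<in> L" "j x = 0" for x
  proof -
    have "\<omega> x (j x) = x \<bullet> x" using that(1) by (simp add: j proj_id[OF X])
    then show ?thesis using that(2) by (simp add: omega_simps)
  qed
  have "inj_on j L" using inj by (subst linear_inj_on_iff_eq_0[OF lj sX(2)]) auto
  then have "dim (j ` L) = dim L"
    using dim_image_eq[OF lj, of L] sX(2) by (metis span_eq_iff)
  moreover have "2 * dim L = 2 * dim X" using lagrangian_dim[OF L] lagrangian_dim[OF LX] by simp
  ultimately have jL: "j ` L = X"
    using jX by (intro subspace_dim_equal linear_subspace_image[OF lj] sX) auto
  have "\<exists>u. u \<in> L \<and> j u = ?Q x" for x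
  proof -
    have "?Q x \<in> j ` L" unfolding jL by (rule proj_in[OF X'])
    then show ?thesis by (metis imageE)
  qed
  then obtain k where k: "\<And>x. k x \<in> L" "\<And>x. j (k x) = ?Q x" by metis
  have kI: "k x = u" if "u \<in> L" "j u = ?Q x" for x u
  proof -
    have "k x - u = 0"
    proof (rule inj)
      show "k x - u \<in> L" by (intro subspace_diff sX k that)
      show "j (k x - u) = 0" by (simp add: linear_diff[OF lj] k that)
    qed
    then show ?thesis by simp
  qed
  have lk: "linear k"
  proof (rule linearI; rule kI)
    fix x y c
    show "k x + k y \<in> L" "c *\<^sub>R k x \<in> L" by (intro subspace_add subspace_scale sX k)+
    show "j (k x + k y) = ?Q (x + y)" "j (c *\<^sub>R k x) = ?Q (c *\<^sub>R x)"
      by (simp_all only: k linear_add[OF lj] linear_scale[OF lj] linear_add[OF lP(2)] linear_scale[OF lP(2)])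
  qed
  define J where "J x = j x - k x" for x
  have PJ: "?P (J x) = - k x" for x
    using k(1)[of x] by (simp add: J_def linear_diff[OF lP(1)] proj_zero[OF X jX] proj_id[OF X])
  have QJ: "?Q (J x) = j x" for x unfolding PQ PJ by (simp add: J_def)
  have dec: "\<omega> x y = ?P x \<bullet> k y - ?P y \<bullet> k x" for x y
  proof -
    have "\<omega> x y = \<omega> x (?P y) + \<omega> (?P x) y" using omega_proj[OF X] by simp
    also have "\<omega> (?P x) y = \<omega> (?P x) (?Q y)"
      using lagrangian_isotropic[OF L proj_in[OF X] proj_in[OF X], of x y] by (simp add: PQ omega_simps)
    also have "\<dots> = ?P x \<bullet> k y"
      unfolding k(2)[symmetric] j using k(1) by (simp add: proj_id[OF X] proj_in[OF X])
    also have "\<omega> x (?P y) = - \<omega> (?P y) (?Q x)"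
      using lagrangian_isotropic[OF L proj_in[OF X] proj_in[OF X], of y x] skew[of x "?P y"] by (simp add: PQ omega_simps)
    also have "\<omega> (?P y) (?Q x) = ?P y \<bullet> k x"
      unfolding k(2)[symmetric] j using k(1) by (simp add: proj_id[OF X] proj_in[OF X])
    finally show ?thesis by simp
  qed
  have kJ: "k (J x) = ?P x" for x
    by (rule kI) (auto simp: QJ jP proj_in[OF X])
  show ?thesis
  proof (rule that[of J])
    show "linear J" unfolding J_def by (intro linear_compose_sub lj lk)
    show "J (J x) = - x" for x
    proof -
      have "j (J x) = j (?P (J x))" by (simp add: jP)
      also have "\<dots> = - ?Q x" unfolding PJ by (simp add: linear_neg[OF lj] k)
      finally show ?thesis unfolding J_def[of "J x"] kJ by (simp add: PQ)
    qed
    show "\<omega> (J x) (J y) = \<omega> x y" for x y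
      unfolding dec PJ kJ by (simp add: inner_commute)
    show "\<omega> x (J x) > 0" if "x \<noteq> 0" for x
    proof -
      have e: "\<omega> x (J x) = ?P x \<bullet> ?P x + k x \<bullet> k x" unfolding dec PJ kJ by simp
      have "?P x \<noteq> 0 \<or> k x \<noteq> 0"
      proof (rule ccontr)
        assume "\<not> ?thesis"
        then have "?P x = 0" "?Q x = 0" using k(2)[of x] linear_0[OF lj] by auto
        then show False using that by (simp add: PQ)
      qed
      then show ?thesis unfolding e by (auto intro: add_pos_nonneg add_nonneg_pos)
    qed
  qed
qed

end

section \<open>The circle of symplectic rotations\<close>

locale symplectic_rotation = symplectic +
  fixes J :: "'a \<Rightarrow>\<^sub>L 'a"
  assumes JJ: "J (J x) = - x" and omega_J: "\<omega> (J x) (J y) = \<omega> x y"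
    and J_pos: "x \<noteq> 0 \<Longrightarrow> \<omega> x (J x) > 0"
begin

text \<open>This is the exponential of \<open>\<theta> *\<^sub>R J\<close>, in closed form because
  \<open>J\<close> squares to minus the identity.\<close>

definition R :: "real \<Rightarrow> 'a \<Rightarrow>\<^sub>L 'a" where
  "R \<theta> = cos \<theta> *\<^sub>R id_blinfun + sin \<theta> *\<^sub>R J"

lemma R_apply: "R \<theta> x = cos \<theta> *\<^sub>R x + sin \<theta> *\<^sub>R J x"
  by (simp add: R_def blinfun.bilinear_simps)

lemma R_zero [simp]: "R 0 x = x"
  by (simp add: R_apply)

lemma R_R: "R \<theta> (R \<phi> x) = R (\<theta> + \<phi>) x"
  by (simp add: R_apply blinfun.bilinear_simps JJ cos_add sin_add algebra_simps)

lemma J_skew: "\<omega> (J x) y = - \<omega> x (J y)"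
  using omega_J[of "J x" y] by (simp add: JJ omega_simps)

lemma R_symplectic: "symplectic_map \<omega> (R \<theta>)"
proof -
  have "bij (R \<theta>)"
    by (rule bij_betw_byWitness[of _ "R (- \<theta>)"]) (auto simp: R_R)
  moreover have "\<omega> (R \<theta> x) (R \<theta> y) = \<omega> x y" for x y
  proof -
    have "\<omega> (R \<theta> x) (R \<theta> y) = cos \<theta> * (cos \<theta> * \<omega> x y) + sin \<theta> * (sin \<theta> * \<omega> x y)"
      unfolding R_apply by (simp add: omega_simps J_skew JJ algebra_simps)
    also have "\<dots> = ((cos \<theta>)\<^sup>2 + (sin \<theta>)\<^sup>2) * \<omega> x y"
      by (simp only: power2_eq_square distrib_right mult.assoc)
    finally show ?thesis by simp
  qed
  ultimately show ?thesis by (simp add: symplectic_map_def)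
qed

lemma R_deriv: "(R has_vector_derivative J o\<^sub>L R \<theta>) (at \<theta> within S)"
proof -
  have eq: "- sin \<theta> *\<^sub>R id_blinfun + cos \<theta> *\<^sub>R J = J o\<^sub>L R \<theta>"
    by (rule blinfun_eqI) (simp add: R_apply blinfun.bilinear_simps JJ)
  have "((\<lambda>\<theta>. cos \<theta> *\<^sub>R id_blinfun + sin \<theta> *\<^sub>R J) has_vector_derivative
    (- sin \<theta> *\<^sub>R id_blinfun + cos \<theta> *\<^sub>R J)) (at \<theta> within S)"
    by (auto intro!: derivative_eq_intros)
  then show ?thesis unfolding eq R_def[abs_def] .
qed

lemma R_continuous [continuous_intros]:
  fixes f :: "'b::metric_space \<Rightarrow> real"
  shows "continuous_on S f \<Longrightarrow> continuous_on S (\<lambda>x. R (f x))"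
  unfolding R_def by (auto intro!: continuous_intros)

text \<open>A rotation by \<open>pi\<close> is minus the identity, which fixes every subspace. The
  angle can thus be made large without changing the Lagrangian.\<close>

lemma R_shift_pi:
  assumes "subspace L"
  shows "R (\<theta> + real N * pi) ` L = R \<theta> ` L"
proof (induction N)
  case (Suc N)
  have e: "R (\<phi> + pi) x = R \<phi> (- x)" for \<phi> x
    by (simp add: R_apply blinfun.bilinear_simps)
  have neg: "uminus ` L = L"
  proof (intro equalityI subsetI)
    fix x assume "x \<in> L"
    then have "- x \<in> L" using assms subspace_neg by blast
    then show "x \<in> uminus ` L" by (metis imageI minus_minus)
  qed (use assms subspace_neg in auto)
  have "R (\<theta> + real (Suc N) * pi) ` L = R (\<theta> + real N * pi) ` (uminus ` L)"
    unfolding image_image by (simp add: e[symmetric] algebra_simps)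
  then show ?case using Suc neg by simp
qed simp

lemma J_coercive: obtains c where "c > 0" "\<And>x. \<omega> x (J x) \<ge> c * (norm x)\<^sup>2"
proof -
  have "bilinear (\<lambda>x y. \<omega> x (J y))" by (rule bilinear_compose[OF bil linear_ident linear_blinfun])
  from pos_def_coercive[OF this subspace_UNIV J_pos] obtain c where
    "c > 0" "\<And>u. u \<in> UNIV \<Longrightarrow> c * (norm u)\<^sup>2 \<le> \<omega> u (J u)" by blast
  then show ?thesis using that[of c] by simp
qed

text \<open>The crossing form of the rotating Lagrangian at angle 0 is
  \<open>\<omega> v (J v)\<close>, which is positive, so the crossing is isolated by
  \<open>chart_index_jump\<close>.\<close>

lemma rotate_transversal:
  assumes L: "lagrangian \<omega> L" and C: "lagrangian \<omega> C"
  obtains d where "d > 0" "\<And>\<theta>. 0 < \<theta> \<Longrightarrow> \<theta> < d \<Longrightarrow> transversal (R \<theta> ` L) C"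
proof -
  have C1: "C1_on_interval 0 1 R" unfolding C1_on_interval_def
    by (intro exI[of _ "\<lambda>\<theta>. J o\<^sub>L R \<theta>"] conjI ballI R_deriv continuous_intros)
  let ?l = "\<lambda>\<theta>. R \<theta> ` L"
  have lC1: "lag_C1 \<omega> ?l 0 1" by (rule lag_C1_image[OF C1 R_symplectic L])
  have cont: "subspace_continuous_on {0..1} ?l"
    by (rule subspace_continuous_image[OF C1_on_interval_continuous[OF C1] R_symplectic L])
  have cf: "crossing_form \<omega> ?l C 0 1 0 v = \<omega> v (J v)" if "v \<in> L" for v
    using crossing_form_image[OF zero_less_one C1 R_symplectic L _ R_deriv that, of 0 C] by simp
  have l0: "?l 0 = L" by simp
  obtain W where W: "transversal W (?l 0)" using transversal_exists[OF L] l0 by metis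
  have "qf_nondegenerate (crossing_form \<omega> ?l C 0 1 0) (?l 0 \<inter> C)"
  proof (rule definite_nondegenerate)
    fix u assume u: "u \<in> ?l 0 \<inter> C"
    then have "u \<in> L" by simp
    then show "crossing_form \<omega> ?l C 0 1 0 u \<noteq> 0" if "u \<noteq> 0" using J_pos[OF that] by (simp add: cf)
    show "crossing_form \<omega> ?l C 0 1 0 (u + u) = 4 * crossing_form \<omega> ?l C 0 1 0 u"
      by (rule crossing_form_double[OF zero_less_one lC1 cont]) (use u in auto)
  qed
  then obtain d where d: "d > 0" "\<And>t. t \<in> {0..1} \<Longrightarrow> 0 < t \<Longrightarrow> t < 0 + d \<Longrightarrow> ?l t \<inter> C = {0}"
    using chart_index_jump[OF zero_less_one lC1 cont _ C W] by (metis atLeastAtMost_iff order_refl zero_le_one)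
  show ?thesis
  proof (rule that[of "min d 1"])
    show "min d 1 > 0" using d by simp
    fix \<theta> :: real assume "0 < \<theta>" "\<theta> < min d 1"
    then have "?l \<theta> \<inter> C = {0}" using d(2)[of \<theta>] by auto
    then show "transversal (R \<theta> ` L) C"
      using symplectic_map_lagrangian[OF R_symplectic L] C by (simp add: transversal_def)
  qed
qed

text \<open>A slight rotation of \<open>A\<close> is transversal to \<open>A\<close> itself and to
  \<open>B\<close>.\<close>

lemma common_transversal:
  assumes "lagrangian \<omega> A" "lagrangian \<omega> B"
  obtains X where "transversal X A" "transversal X B"
proof -
  obtain d1 where d1: "d1 > 0" "\<And>\<theta>. 0 < \<theta> \<Longrightarrow> \<theta> < d1 \<Longrightarrow> transversal (R \<theta> ` A) A"
    using rotate_transversal[OF assms(1,1)] by blast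
  obtain d2 where d2: "d2 > 0" "\<And>\<theta>. 0 < \<theta> \<Longrightarrow> \<theta> < d2 \<Longrightarrow> transversal (R \<theta> ` A) B"
    using rotate_transversal[OF assms] by blast
  show ?thesis
    by (rule that[of "R (min d1 d2 / 2) ` A"]) (use d1 d2 in \<open>auto intro!: d1(2) d2(2)\<close>)
qed

end

context symplectic_rotation
begin

lemma omega_R: "\<omega> (R \<theta> x) (R \<theta> y) = \<omega> x y"
  using R_symplectic[of \<theta>] by (simp add: symplectic_map_def)

lemma J_R: "J (R \<theta> x) = R \<theta> (J x)"
  by (simp add: R_apply blinfun.bilinear_simps)

subsection \<open>Regular representatives\<close>

text \<open>Rotating by \<open>f t = m * t * (T - t)\<close> makes all crossings with large \<open>\<bar>f' t\<bar>\<close> definite. The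
  remaining times lie near \<open>T / 2\<close>, where for large \<open>m\<close> the rotated Lagrangian stays close to the
  rotation of \<open>\<psi> (T / 2) ` L\<close> by \<open>\<theta>\<close>, which is transversal to \<open>C\<close>.\<close>

lemma regular_representative_exists:
  assumes T: "0 < T" and \<psi>: "C1_on_interval 0 T \<psi>" "\<And>t. t \<in> {0..T} \<Longrightarrow> symplectic_map \<omega> (\<psi> t)"
    and L: "lagrangian \<omega> L" and C: "lagrangian \<omega> C"
  obtains l' where "lag_C1 \<omega> l' 0 T" "regular_crossings \<omega> l' C 0 T"
    "lag_homotopic \<omega> 0 T (\<lambda>t. \<psi> t ` L) l'"
proof -
  obtain \<psi>' where \<psi>': "\<And>t. t \<in> {0..T} \<Longrightarrow> (\<psi> has_vector_derivative \<psi>' t) (at t within {0..T})"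
    "continuous_on {0..T} \<psi>'" using \<psi>(1) unfolding C1_on_interval_def by blast
  have c\<psi>: "continuous_on {0..T} \<psi>" by (rule C1_on_interval_continuous[OF \<psi>(1)])
  have sL: "subspace L" by (rule lagrangian_subspace[OF L])
  have symp: "symplectic_map \<omega> (R \<theta> o\<^sub>L \<psi> t)" if "t \<in> {0..T}" for t \<theta>
  proof -
    have "bij (R \<theta>)" "bij (\<psi> t)" using R_symplectic \<psi>(2)[OF that] by (auto simp: symplectic_map_def)
    then have "bij (R \<theta> \<circ> \<psi> t)" by (intro bij_comp)
    moreover have "blinfun_apply (R \<theta> o\<^sub>L \<psi> t) = R \<theta> \<circ> \<psi> t" by auto
    ultimately show ?thesis
      using omega_R \<psi>(2)[OF that] by (simp add: symplectic_map_def)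
  qed
  obtain c1 where c1: "c1 > 0" "\<And>x. \<omega> x (J x) \<ge> c1 * (norm x)\<^sup>2" using J_coercive by blast
  obtain k where k: "k > 0" "\<And>x y. \<bar>\<omega> x y\<bar> \<le> k * norm x * norm y" using omega_bounded by blast
  obtain B where B: "B > 0" "\<And>t. t \<in> {0..T} \<Longrightarrow> norm (\<psi>' t) \<le> B"
  proof -
    have "bounded (\<psi>' ` {0..T})" by (intro compact_imp_bounded compact_continuous_image \<psi>'(2) compact_Icc)
    then show ?thesis using that unfolding bounded_pos by auto
  qed
  \<comment> \<open>The minimum over the compact product of the time interval and the unit sphere
    bounds all the maps \<open>\<psi> t\<close> below uniformly.\<close>
  obtain c where c: "c > 0" "\<And>t e. t \<in> {0..T} \<Longrightarrow> c * norm e \<le> norm (\<psi> t e)"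
  proof -
    let ?K = "{0..T} \<times> sphere (0::'a) 1"
    have comp: "compact ?K" by (intro compact_Times compact_Icc compact_sphere)
    obtain i :: 'a where "i \<in> Basis" using nonempty_Basis by blast
    then have "(0, i) \<in> ?K" using T by simp
    then have ne: "?K \<noteq> {}" by blast
    have "continuous_on ?K (\<lambda>p. norm (\<psi> (fst p) (snd p)))"
      by (intro continuous_intros continuous_on_compose2[OF c\<psi>]) auto
    from continuous_attains_inf[OF comp ne this] obtain p where
      p: "p \<in> ?K" "\<And>q. q \<in> ?K \<Longrightarrow> norm (\<psi> (fst p) (snd p)) \<le> norm (\<psi> (fst q) (snd q))" by blast
    show ?thesis
    proof (rule that[of "norm (\<psi> (fst p) (snd p))"])
      have "inj (\<psi> (fst p))" using p(1) by (intro symplectic_map_inj \<psi>(2)) auto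
      then have "\<psi> (fst p) (snd p) \<noteq> 0"
        using p(1) linear_injective_0[OF linear_blinfun, of "\<psi> (fst p)"] by auto
      then show "norm (\<psi> (fst p) (snd p)) > 0" by simp
      fix t e assume t: "t \<in> {0..T}"
      show "norm (\<psi> (fst p) (snd p)) * norm e \<le> norm (\<psi> t e)"
      proof (cases "e = 0")
        case False
        have "norm (\<psi> (fst p) (snd p)) \<le> norm (\<psi> (fst (t, e /\<^sub>R norm e)) (snd (t, e /\<^sub>R norm e)))"
          using t False by (intro p(2)) auto
        also have "\<dots> = norm (\<psi> t e) / norm e" by (simp add: blinfun.scaleR_right divide_inverse mult.commute)
        finally show ?thesis using False by (simp add: pos_le_divide_eq)
      qed simp
    qed
  qed
  define c2 where "c2 = k * B / c"
  have c2: "\<bar>\<omega> (\<psi> t e) (\<psi>' t e)\<bar> \<le> c2 * (norm (\<psi> t e))\<^sup>2" if t: "t \<in> {0..T}" for t e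
  proof -
    have "norm (\<psi>' t e) \<le> norm (\<psi>' t) * norm e" by (rule norm_blinfun)
    also have "\<dots> \<le> B * (norm (\<psi> t e) / c)"
      using B(1) B(2)[OF t] c(2)[OF t, of e] c(1)
      by (intro mult_mono) (auto simp: pos_le_divide_eq mult.commute)
    finally have "k * norm (\<psi> t e) * norm (\<psi>' t e) \<le> k * norm (\<psi> t e) * (B * (norm (\<psi> t e) / c))"
      using k(1) by (intro mult_left_mono) auto
    moreover have "\<bar>\<omega> (\<psi> t e) (\<psi>' t e)\<bar> \<le> k * norm (\<psi> t e) * norm (\<psi>' t e)" by (rule k(2))
    ultimately show ?thesis by (simp add: c2_def power2_eq_square mult_ac)
  qed
  \<comment> \<open>Once \<open>\<bar>f' t\<bar> > \<kappa>\<close>, the rotational part of the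
    crossing form, at least \<open>c1 * \<bar>f' t\<bar>\<close> in size, dominates the part coming
    from \<psi>, at most \<open>c2\<close>, both relative to the squared norm.\<close>
  define \<kappa> where "\<kappa> = c2 / c1"
  have \<kappa>: "\<kappa> > 0" using c1 k B c by (simp add: \<kappa>_def c2_def)
  have T2: "T / 2 \<in> {0..T}" using T by simp
  let ?Q = "\<lambda>p. (R (fst p) o\<^sub>L \<psi> (snd p)) ` L"
  have cQ: "subspace_continuous_on (UNIV \<times> {0..T}) ?Q"
  proof (rule subspace_continuous_image[OF _ _ L])
    show "continuous_on (UNIV \<times> {0..T}) (\<lambda>p. R (fst p) o\<^sub>L \<psi> (snd p))"
      by (intro bounded_bilinear.continuous_on[OF bounded_bilinear_blinfun_compose]
          continuous_intros continuous_on_compose2[OF c\<psi>]) auto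
  qed (use symp in auto)
  obtain \<theta> where \<theta>: "\<theta> > 0" "transversal (?Q (\<theta>, T / 2)) C"
  proof -
    obtain d where d: "d > 0" "\<And>\<theta>. 0 < \<theta> \<Longrightarrow> \<theta> < d \<Longrightarrow> transversal (R \<theta> ` (\<psi> (T / 2) ` L)) C"
      using rotate_transversal[OF symplectic_map_lagrangian[OF \<psi>(2)[OF T2] L] C] by blast
    have "transversal (R (d / 2) ` (\<psi> (T / 2) ` L)) C" using d by (intro d(2)) auto
    then show ?thesis using that[of "d / 2"] d(1) by (simp add: image_image)
  qed
  obtain r where r: "r > 0" "\<And>\<phi> t. t \<in> {0..T} \<Longrightarrow> \<bar>\<phi> - \<theta>\<bar> < r / 2 \<Longrightarrow> \<bar>t - T / 2\<bar> < r / 2 \<Longrightarrow>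
    transversal C (?Q (\<phi>, t))"
  proof -
    obtain d where d: "d > 0" "\<And>M. lagrangian \<omega> M \<Longrightarrow> subspace_dist M (?Q (\<theta>, T / 2)) < d \<Longrightarrow> transversal C M"
      by (rule proj_continuous[OF transversal_sym[OF \<theta>(2)] zero_less_one]) (rule that; assumption)
    have "(\<theta>, T / 2) \<in> UNIV \<times> {0..T}" using T2 by simp
    then obtain r where r: "r > 0" "\<And>q. q \<in> UNIV \<times> {0..T} \<Longrightarrow> dist q (\<theta>, T / 2) < r \<Longrightarrow>
        subspace_dist (?Q q) (?Q (\<theta>, T / 2)) < d"
      using cQ d(1) unfolding subspace_continuous_on_def by blast
    show ?thesis
    proof (rule that[OF r(1)])
      fix \<phi> t assume t: "t \<in> {0..T}" "\<bar>\<phi> - \<theta>\<bar> < r / 2" "\<bar>t - T / 2\<bar> < r / 2"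
      have "dist (\<phi>, t) (\<theta>, T / 2) \<le> dist \<phi> \<theta> + dist t (T / 2)"
        unfolding dist_Pair_Pair by (rule sqrt_sum_squares_le_sum) auto
      also have "\<dots> < r" using t by (simp add: dist_real_def)
      finally have "subspace_dist (?Q (\<phi>, t)) (?Q (\<theta>, T / 2)) < d" using t by (intro r(2)) auto
      moreover have "lagrangian \<omega> (?Q (\<phi>, t))" using symplectic_map_lagrangian[OF symp[OF t(1)] L] by simp
      ultimately show "transversal C (?Q (\<phi>, t))" by (intro d(2))
    qed
  qed
  \<comment> \<open>With \<open>u = t - T / 2\<close>, a small derivative
    \<open>\<bar>f' t\<bar> \<le> \<kappa>\<close> means
    \<open>m * \<bar>u\<bar> \<le> \<kappa> / 2\<close>. The first summand then forces
    \<open>\<bar>u\<bar> < r / 2\<close> and the second forces \<open>m * u\<^sup>2 < r / 2\<close>,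
    so time and angle stay in the neighbourhood fixed by \<open>r\<close>.\<close>
  define m0 where "m0 = \<kappa> / r + \<kappa>\<^sup>2 / (2 * r)"
  have m0: "m0 > 0" using \<kappa> r by (simp add: m0_def add_pos_pos)
  obtain N :: nat where N: "T\<^sup>2 / 4 * m0 / pi < real N" using reals_Archimedean2 by blast
  \<comment> \<open>The maximum of \<open>f\<close>, attained at \<open>T / 2\<close>, equals
    \<theta> plus a multiple of \<open>pi\<close>; the multiple makes \<open>m\<close> large while
    the rotated subspace is the one for \<theta>.\<close>
  define m where "m = 4 / T\<^sup>2 * (\<theta> + real N * pi)"
  have mT: "m * (T / 2)\<^sup>2 = \<theta> + real N * pi" using T by (simp add: m_def power_divide)
  have m: "m > m0"
  proof -
    have "T\<^sup>2 / 4 * m0 < real N * pi" using N by (simp add: pos_divide_less_eq)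
    also have "\<dots> < \<theta> + real N * pi" using \<theta> by simp
    finally have "T\<^sup>2 / 4 * m0 < T\<^sup>2 / 4 * m" using mT by (simp add: power_divide mult.commute)
    then show ?thesis using T by simp
  qed
  then have mpos: "m > 0" using m0 by simp
  define f where "f t = m * t * (T - t)" for t
  define f' where "f' t = m * (T - 2 * t)" for t
  have f_deriv: "(f has_vector_derivative f' t) (at t within S)" for t S
  proof -
    have "(f has_real_derivative f' t) (at t within S)"
      unfolding f_def f'_def by (auto intro!: derivative_eq_intros simp: algebra_simps)
    then show ?thesis by (simp add: has_real_derivative_iff_has_vector_derivative)
  qed
  have cf: "continuous_on S f" for S unfolding f_def by (intro continuous_intros)
  define A where "A t = R (f t) o\<^sub>L \<psi> t" for t
  define A' where "A' t = (R (f t) o\<^sub>L \<psi>' t) + ((f' t *\<^sub>R (J o\<^sub>L R (f t))) o\<^sub>L \<psi> t)" for t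
  have A_deriv: "(A has_vector_derivative A' t) (at t within {0..T})" if "t \<in> {0..T}" for t
  proof -
    have "((R \<circ> f) has_vector_derivative f' t *\<^sub>R (J o\<^sub>L R (f t))) (at t within {0..T})"
      by (rule vector_diff_chain_within[OF f_deriv R_deriv])
    from bounded_bilinear.has_vector_derivative[OF bounded_bilinear_blinfun_compose this \<psi>'(1)[OF that]]
    show ?thesis unfolding A_def[abs_def] A'_def by (simp add: o_def)
  qed
  have A_C1: "C1_on_interval 0 T A" unfolding C1_on_interval_def
  proof (intro exI[of _ A'] conjI ballI A_deriv)
    have "continuous_on {0..T} f'" unfolding f'_def by (intro continuous_intros)
    then show "continuous_on {0..T} A'" unfolding A'_def
      by (intro continuous_intros bounded_bilinear.continuous_on[OF bounded_bilinear_blinfun_compose]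
         \<psi>'(2) c\<psi> cf)
  qed
  have A_symp: "symplectic_map \<omega> (A t)" if "t \<in> {0..T}" for t using symp[OF that] by (simp add: A_def)
  let ?l = "\<lambda>t. A t ` L"
  have lC1: "lag_C1 \<omega> ?l 0 T" by (rule lag_C1_image[OF A_C1 A_symp L])
  have lcont: "subspace_continuous_on {0..T} ?l"
    by (rule subspace_continuous_image[OF C1_on_interval_continuous[OF A_C1] A_symp L])
  have reg: "regular_crossings \<omega> ?l C 0 T"
    unfolding regular_crossings_def
  proof (intro ballI impI)
    fix t assume t: "t \<in> {0..T}" and cr: "is_crossing ?l C t"
    have large: "\<bar>f' t\<bar> * c1 > c2"
    proof (rule ccontr)
      assume "\<not> ?thesis"
      then have "\<bar>f' t\<bar> \<le> \<kappa>" using c1 by (simp add: \<kappa>_def pos_le_divide_eq)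
      define u where "u = t - T / 2"
      have "\<bar>f' t\<bar> = 2 * (m * \<bar>u\<bar>)"
      proof -
        have "f' t = - (2 * (m * u))" by (simp add: f'_def u_def algebra_simps)
        then show ?thesis using mpos by (simp add: abs_mult)
      qed
      then have mu: "m * \<bar>u\<bar> \<le> \<kappa> / 2" using \<open>\<bar>f' t\<bar> \<le> \<kappa>\<close> by simp
      have "m > \<kappa> / r" "m > \<kappa>\<^sup>2 / (2 * r)"
        using m \<kappa> r unfolding m0_def by (smt (verit) divide_pos_pos zero_less_power)+
      then have mr: "\<kappa> < m * r" "\<kappa>\<^sup>2 < m * (2 * r)" using r by (auto simp: pos_divide_less_eq)
      have "m * \<bar>u\<bar> < m * (r / 2)" using mu mr by simp
      then have u: "\<bar>u\<bar> < r / 2" using mpos by simp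
      have "(m * \<bar>u\<bar>)\<^sup>2 \<le> (\<kappa> / 2)\<^sup>2" using mu mpos by (intro power_mono) auto
      also have "(\<kappa> / 2)\<^sup>2 < m * (r / 2)" using mr(2) by (simp add: power_divide)
      finally have "m * (m * u\<^sup>2) < m * (r / 2)" by (simp add: power_mult_distrib power2_eq_square mult_ac)
      then have mu2: "m * u\<^sup>2 < r / 2" using mpos by simp
      have "f t = m * (T / 2)\<^sup>2 - m * u\<^sup>2" by (simp add: f_def u_def power2_eq_square field_simps)
      then have ft: "f t = (\<theta> - m * u\<^sup>2) + real N * pi" using mT by simp
      have "?l t = R (f t) ` (\<psi> t ` L)" by (simp add: A_def image_image)
      also have "\<dots> = R (\<theta> - m * u\<^sup>2) ` (\<psi> t ` L)"
        unfolding ft by (rule R_shift_pi) (rule linear_subspace_image[OF linear_blinfun sL])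
      finally have "?l t = ?Q (\<theta> - m * u\<^sup>2, t)" by (simp add: image_image)
      moreover have "transversal C (?Q (\<theta> - m * u\<^sup>2, t))"
        using t mu2 u mpos by (intro r(2)) (auto simp: u_def)
      ultimately have "?l t \<inter> C = {0}" by (auto simp: transversal_def)
      then show False using cr by (simp add: is_crossing_def)
    qed
    let ?q = "crossing_form \<omega> ?l C 0 T t"
    have q: "?q (A t e) = f' t * \<omega> (\<psi> t e) (J (\<psi> t e)) + \<omega> (\<psi> t e) (\<psi>' t e)" if "e \<in> L" for e
    proof -
      have "?q (A t e) = \<omega> (A t e) (A' t e)"
        by (rule crossing_form_image[OF T A_C1 A_symp L t A_deriv[OF t] that])
      also have "\<dots> = \<omega> (R (f t) (\<psi> t e)) (R (f t) (\<psi>' t e)) +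
          f' t * \<omega> (R (f t) (\<psi> t e)) (R (f t) (J (\<psi> t e)))"
        by (simp add: A_def A'_def blinfun.bilinear_simps omega_simps J_R)
      finally show ?thesis by (simp add: omega_R)
    qed
    show "qf_nondegenerate ?q (?l t \<inter> C)"
    proof (rule definite_nondegenerate)
      fix v assume v: "v \<in> ?l t \<inter> C"
      then obtain e where e: "e \<in> L" "v = A t e" by auto
      show "?q (v + v) = 4 * ?q v"
        by (rule crossing_form_double[OF T lC1 lcont t]) (use v in auto)
      assume "v \<noteq> 0"
      let ?x = "\<psi> t e"
      have "?x \<noteq> 0" using \<open>v \<noteq> 0\<close> e by (auto simp: A_def blinfun.zero_right)
      then have nx: "(norm ?x)\<^sup>2 > 0" by simp
      have "\<bar>\<omega> ?x (\<psi>' t e)\<bar> \<le> c2 * (norm ?x)\<^sup>2" by (rule c2[OF t])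
      also have "\<dots> < (\<bar>f' t\<bar> * c1) * (norm ?x)\<^sup>2" using large nx by (rule mult_strict_right_mono)
      also have "\<dots> = \<bar>f' t\<bar> * (c1 * (norm ?x)\<^sup>2)" by (rule mult.assoc)
      also have "\<dots> \<le> \<bar>f' t\<bar> * \<omega> ?x (J ?x)" by (intro mult_left_mono c1(2)) auto
      also have "\<dots> = \<bar>f' t * \<omega> ?x (J ?x)\<bar>"
        using J_pos[OF \<open>?x \<noteq> 0\<close>] by (simp add: abs_mult)
      finally show "?q v \<noteq> 0" unfolding e(2) q[OF e(1)] by linarith
    qed
  qed
  \<comment> \<open>The homotopy scales the angle; the endpoints stay fixed because \<open>f\<close>
    vanishes at 0 and \<open>T\<close>.\<close>
  have "lag_homotopic \<omega> 0 T (\<lambda>t. \<psi> t ` L) ?l"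
    unfolding lag_homotopic_def
  proof (intro exI[of _ "\<lambda>p. (R (fst p * f (snd p)) o\<^sub>L \<psi> (snd p)) ` L"] conjI ballI)
    show "lagrangian \<omega> ((R (fst p * f (snd p)) o\<^sub>L \<psi> (snd p)) ` L)" if "p \<in> {0..1} \<times> {0..T}" for p
      using that by (intro symplectic_map_lagrangian[OF symp L]) auto
    show "subspace_continuous_on ({0..1} \<times> {0..T}) (\<lambda>p. (R (fst p * f (snd p)) o\<^sub>L \<psi> (snd p)) ` L)"
    proof (rule subspace_continuous_image[OF _ _ L])
      show "continuous_on ({0..1} \<times> {0..T}) (\<lambda>p. R (fst p * f (snd p)) o\<^sub>L \<psi> (snd p))"
        by (intro bounded_bilinear.continuous_on[OF bounded_bilinear_blinfun_compose]
            continuous_intros continuous_on_compose2[OF c\<psi>] continuous_on_compose2[OF cf[of UNIV]]) auto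
    qed (use symp in auto)
  qed (auto simp: A_def f_def image_image)
  then show ?thesis using that lC1 reg by blast
qed

end

subsection \<open>Comparison of the two indices\<close>

context symplectic_rotation
begin

text \<open>Near each time, with one \<open>X\<close> transversal to both Lagrangians, the cocycle
  identity turns the expression into the index of \<open>diff_form\<close> up to a constant. Its
  nullity depends on the intersection of the two Lagrangians, whose dimension is constant because
  \<open>\<psi> t\<close> is injective.\<close>

lemma primitive_difference:
  fixes a b :: real
  assumes \<psi>: "continuous_on {a..b} \<psi>" "\<And>t. t \<in> {a..b} \<Longrightarrow> symplectic_map \<omega> (\<psi> t)"
    and L: "lagrangian \<omega> L1" "lagrangian \<omega> L2" and C: "lagrangian \<omega> C"
    and M: "primitive C {a..b} (\<lambda>t. \<psi> t ` L1) M1" "primitive C {a..b} (\<lambda>t. \<psi> t ` L2) M2"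
    and st: "s \<in> {a..b}" "t \<in> {a..b}"
  shows "M1 s - M2 s + triple_index \<omega> (\<psi> s ` L1) (\<psi> s ` L2) C =
    M1 t - M2 t + triple_index \<omega> (\<psi> t ` L1) (\<psi> t ` L2) C"
proof (rule connected_local_const[OF connected_Icc st], intro ballI)
  fix t0 assume t0: "t0 \<in> {a..b}"
  let ?l1 = "\<lambda>t. \<psi> t ` L1" and ?l2 = "\<lambda>t. \<psi> t ` L2" and ?F = "at t0 within {a..b}"
  have lag: "lagrangian \<omega> (?l1 t)" "lagrangian \<omega> (?l2 t)" if "t \<in> {a..b}" for t
    using symplectic_map_lagrangian[OF \<psi>(2)[OF that]] L by auto
  have cont: "subspace_continuous_on {a..b} ?l1" "subspace_continuous_on {a..b} ?l2"
    using subspace_continuous_image[OF \<psi>] L by auto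
  have dims: "dim (?l1 t \<inter> ?l2 t) = dim (L1 \<inter> L2)" if "t \<in> {a..b}" for t
  proof -
    have inj: "inj (\<psi> t)" by (rule symplectic_map_inj[OF \<psi>(2)[OF that]])
    have "?l1 t \<inter> ?l2 t = \<psi> t ` (L1 \<inter> L2)" using inj by (simp add: image_Int)
    then show ?thesis using dim_image_eq[OF linear_blinfun, of "\<psi> t"] inj by (metis inj_on_subset subset_UNIV)
  qed
  obtain X where X: "transversal X (?l1 t0)" "transversal X (?l2 t0)"
    using common_transversal[OF lag[OF t0]] by blast
  obtain e where e: "e > 0"
    "\<And>X' A' B'. transversal X' A' \<Longrightarrow> transversal X' B' \<Longrightarrow> dim (A' \<inter> B') = dim (?l1 t0 \<inter> ?l2 t0) \<Longrightarrow>
      (\<And>x. norm ((proj X' A' x - proj X' B' x) - (proj X (?l1 t0) x - proj X (?l2 t0) x)) \<le> e * norm x) \<Longrightarrow>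
      form_index (diff_form X' A' B') UNIV = form_index (diff_form X (?l1 t0) (?l2 t0)) UNIV"
    using pos_index_diff_form_locally_const[OF X] by blast
  have e2: "e / 2 > 0" using e by simp
  have ev1: "\<forall>\<^sub>F t in ?F. t \<in> {a..b} \<and> transversal X (?l1 t) \<and>
      (\<forall>x. norm (proj X (?l1 t) x - proj X (?l1 t0) x) \<le> e / 2 * norm x)"
    by (rule eventually_proj[where l = ?l1, OF X(1) t0 lag(1) cont(1) e2])
  have ev2: "\<forall>\<^sub>F t in ?F. t \<in> {a..b} \<and> transversal X (?l2 t) \<and>
      (\<forall>x. norm (proj X (?l2 t) x - proj X (?l2 t0) x) \<le> e / 2 * norm x)"
    by (rule eventually_proj[where l = ?l2, OF X(2) t0 lag(2) cont(2) e2])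
  have ev3: "\<forall>\<^sub>F t in at t0 within {a..b}. offset C X l M t = offset C X l M t0"
    if prim: "primitive C {a..b} l M" "transversal X (l t0)" for l M
  proof -
    obtain d where "d > 0" "\<And>q. q \<in> {a..b} \<Longrightarrow> dist q t0 < d \<Longrightarrow>
      offset C X l M q = offset C X l M t0"
      using primitiveD[OF prim(1) t0 prim(2)] by blast
    then show ?thesis unfolding eventually_at by (intro exI[of _ d]) blast
  qed
  from ev1 ev2 ev3[OF M(1) X(1)] ev3[OF M(2) X(2)]
  show "\<forall>\<^sub>F t in ?F. M1 t0 - M2 t0 + triple_index \<omega> (?l1 t0) (?l2 t0) C =
    M1 t - M2 t + triple_index \<omega> (?l1 t) (?l2 t) C"
  proof eventually_elim
    case (elim t)
    then have t: "t \<in> {a..b}" and tr: "transversal X (?l1 t)" "transversal X (?l2 t)"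
      and n: "\<And>x. norm (proj X (?l1 t) x - proj X (?l1 t0) x) \<le> e / 2 * norm x"
        "\<And>x. norm (proj X (?l2 t) x - proj X (?l2 t0) x) \<le> e / 2 * norm x" by auto
    have "form_index (diff_form X (?l1 t) (?l2 t)) UNIV =
      form_index (diff_form X (?l1 t0) (?l2 t0)) UNIV"
    proof (rule e(2)[OF tr])
      show "dim (?l1 t \<inter> ?l2 t) = dim (?l1 t0 \<inter> ?l2 t0)" by (simp only: dims[OF t] dims[OF t0])
      fix x
      let ?d1 = "proj X (?l1 t) x - proj X (?l1 t0) x" and ?d2 = "proj X (?l2 t) x - proj X (?l2 t0) x"
      have "norm (?d1 - ?d2) \<le> norm ?d1 + norm ?d2" by (rule norm_triangle_ineq4)
      also have "\<dots> \<le> e / 2 * norm x + e / 2 * norm x" by (intro add_mono n)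
      finally show "norm ((proj X (?l1 t) x - proj X (?l2 t) x) - (proj X (?l1 t0) x - proj X (?l2 t0) x))
        \<le> e * norm x" by (simp add: algebra_simps)
    qed
    then show ?case
      using triple_index_cocycle[OF tr C] triple_index_cocycle[OF X C] elim(3,4) by linarith
  qed
qed

end

theorem theorem4p5:
  fixes \<omega> :: "'v::euclidean_space \<Rightarrow> 'v \<Rightarrow> real"
    and n k :: nat and T :: real
    and L1 L2 L3 :: "'v set"
    and \<psi> :: "real \<Rightarrow> ('v \<Rightarrow>\<^sub>L 'v)"
  assumes symp: "symplectic_form \<omega>"
    and dimV: "DIM('v) = 2 * n"
    and T: "0 < T"
    and lag: "lagrangian \<omega> L1" "lagrangian \<omega> L2" "lagrangian \<omega> L3"
    and psi_sp: "\<forall>t\<in>{0..T}. symplectic_map \<omega> (\<psi> t)"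
    and psi_C1: "C1_on_interval 0 T \<psi>"
    and psi0: "\<psi> 0 = id_blinfun"
    and h1: "plus_curve \<omega> (\<lambda>t. blinfun_apply (\<psi> t) ` L2) L3 0 T"
    and h2: "triple_index \<omega> L1 L2 L3 = int n - int (dim (L1 \<inter> L2))"
    and h3: "dim (L3 \<inter> L2) = k"
    and h4: "iota_CLM \<omega> L3 (\<lambda>t. blinfun_apply (\<psi> t) ` L1) 0 T = int k"
  shows "iota_CLM \<omega> L3 (\<lambda>t. blinfun_apply (\<psi> t) ` L2) 0 T = int k"
proof -
  interpret symplectic \<omega> by unfold_locales (rule symp)
  obtain J where J: "linear J" "\<And>x. J (J x) = - x" "\<And>x y. \<omega> (J x) (J y) = \<omega> x y"
    "\<And>x. x \<noteq> 0 \<Longrightarrow> \<omega> x (J x) > 0" using complex_structure_exists[OF lag(3)] by blast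
  have Jb: "blinfun_apply (Blinfun J) = J"
    using J(1) by (intro bounded_linear_Blinfun_apply) (simp add: linear_conv_bounded_linear)
  interpret symplectic_rotation \<omega> "Blinfun J" by unfold_locales (simp_all add: Jb J)
  let ?l1 = "\<lambda>t. \<psi> t ` L1" and ?l2 = "\<lambda>t. \<psi> t ` L2"
  have sp: "symplectic_map \<omega> (\<psi> t)" if "t \<in> {0..T}" for t using psi_sp that by blast
  have c\<psi>: "continuous_on {0..T} \<psi>" by (rule C1_on_interval_continuous[OF psi_C1])
  have lagl: "lagrangian \<omega> (?l1 t)" "lagrangian \<omega> (?l2 t)" if "t \<in> {0..T}" for t
    using symplectic_map_lagrangian[OF sp[OF that]] lag by auto
  have cont: "subspace_continuous_on {0..T} ?l1" "subspace_continuous_on {0..T} ?l2"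
    using subspace_continuous_image[OF c\<psi> sp] lag by auto
  have T0: "0 \<le> T" using T by simp
  obtain M1 where M1: "primitive L3 {0..T} ?l1 M1"
    using primitive_interval[OF lag(3) T0 lagl(1) cont(1)] by blast
  obtain M2 where M2: "primitive L3 {0..T} ?l2 M2"
    using primitive_interval[OF lag(3) T0 lagl(2) cont(2)] by blast
  \<comment> \<open>The representative turns \<open>h4\<close> into a statement on the increment of
    \<open>M1\<close>.\<close>
  obtain l' where l': "lag_C1 \<omega> l' 0 T" "regular_crossings \<omega> l' L3 0 T" "lag_homotopic \<omega> 0 T ?l1 l'"
    using regular_representative_exists[OF T psi_C1 sp lag(1,3)] by blast
  have i1: "M1 T - M1 0 = int k" using iota_CLM_eq_primitive[OF T lag(3) M1 l'] h4 by simp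
  let ?q = "crossing_form \<omega> ?l2 L3 0 T"
  have C1: "lag_C1 \<omega> ?l2 0 T" using h1 by (simp add: plus_curve_def)
  have pos: "?q t u > 0" if "t \<in> {0..T}" "u \<in> ?l2 t \<inter> L3" "u \<noteq> 0" for t u
  proof -
    have "is_crossing ?l2 L3 t" using that by (auto simp: is_crossing_def)
    then show ?thesis using h1 that unfolding plus_curve_def qf_pos_def_def by blast
  qed
  \<comment> \<open>A plus curve is regular, so it represents itself under the constant
    homotopy.\<close>
  have reg: "regular_crossings \<omega> ?l2 L3 0 T" unfolding regular_crossings_def
  proof (intro ballI impI definite_nondegenerate)
    fix t u assume t: "t \<in> {0..T}" and u: "u \<in> ?l2 t \<inter> L3"
    show "?q t u \<noteq> 0" if "u \<noteq> 0" using pos[OF t u that] by simp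
    show "?q t (u + u) = 4 * ?q t u"
      by (rule crossing_form_double[OF T C1 cont(2) t]) (use u in auto)
  qed
  have mr: "maslov_regular \<omega> L3 ?l2 0 T = M2 T - M2 0"
    by (rule maslov_regular_eq_primitive[OF T C1 cont(2) lag(3) reg M2])
  have hom: "lag_homotopic \<omega> 0 T ?l2 ?l2" unfolding lag_homotopic_def
  proof (intro exI[of _ "\<lambda>p. ?l2 (snd p)"] conjI ballI)
    show "subspace_continuous_on ({0..1} \<times> {0..T}) (\<lambda>p. ?l2 (snd p))"
      by (rule subspace_continuous_image[OF continuous_on_compose2[OF c\<psi>] sp lag(2)])
        (auto intro!: continuous_intros)
  qed (use lagl in auto)
  have i2: "iota_CLM \<omega> L3 ?l2 0 T = M2 T - M2 0"
    by (rule iota_CLM_eq_primitive[OF T lag(3) M2 C1 reg hom])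
  have l0: "?l1 0 = L1" "?l2 0 = L2" by (simp_all add: psi0)
  have neg0: "neg_index (?q t) (?l2 t \<inter> L3) = 0" if t: "t \<in> {0..T}" for t
  proof -
    let ?S = "?l2 t \<inter> L3"
    have sS: "subspace ?S" by (intro subspace_inter lagrangian_subspace lagl lag t)
    \<comment> \<open>\<open>pos\<close> says nothing at the zero vector; doubling forces the value
      there to be 0.\<close>
    have "?q t (0 + 0) = 4 * ?q t 0"
      by (rule crossing_form_double[OF T C1 cont(2) t]) (rule subspace_0[OF lagrangian_subspace[OF lagl(2)[OF t]]])
    then have "- ?q t v \<le> 0" if "v \<in> ?S" for v using pos[OF t that] by (cases "v = 0") auto
    then show ?thesis
      using pos_index_add_nonpos_le[OF sS sS order_refl, of "\<lambda>x. - ?q t x"] unfolding neg_index_def by simp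
  qed
  \<comment> \<open>The start is a crossing of dimension \<open>k\<close>, and the left endpoint
    enters the crossing formula with its full positive index. No other term is negative.\<close>
  have "dim (L2 \<inter> L3) \<le> pos_index (?q 0) (?l2 0 \<inter> L3)"
    unfolding l0(2)
  proof (rule pos_index_ge)
    show "subspace (L2 \<inter> L3)" by (intro subspace_inter lagrangian_subspace lag)
    show "?q 0 u > 0" if "u \<in> L2 \<inter> L3" "u \<noteq> 0" for u using pos[of 0 u] that T l0 by simp
  qed simp
  moreover have "(\<Sum>t\<in>{t. 0 < t \<and> t < T \<and> is_crossing ?l2 L3 t}. qf_signature (?q t) (?l2 t \<inter> L3)) \<ge> 0"
    by (rule sum_nonneg) (simp add: qf_signature_def neg0)
  ultimately have lower: "M2 T - M2 0 \<ge> int k"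
    using mr neg0[of T] T h3 unfolding maslov_regular_def by (simp add: Int_commute)
  \<comment> \<open>The triple index starts at its maximal value by \<open>h2\<close>, so it cannot
    rise, and the increment of \<open>M2\<close> is at most that of \<open>M1\<close>.\<close>
  have "M1 0 - M2 0 + triple_index \<omega> L1 L2 L3 = M1 T - M2 T + triple_index \<omega> (?l1 T) (?l2 T) L3"
    using primitive_difference[OF c\<psi> sp lag M1 M2, of 0 T] T l0 by simp
  moreover have "triple_index \<omega> (?l1 T) (?l2 T) L3 \<le> int n - int (dim (L1 \<inter> L2))"
  proof -
    have TT: "T \<in> {0..T}" using T by simp
    have inj: "inj (\<psi> T)" by (rule symplectic_map_inj[OF sp[OF TT]])
    have "?l1 T \<inter> ?l2 T = \<psi> T ` (L1 \<inter> L2)" using inj by (simp add: image_Int)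
    then have "dim (?l1 T \<inter> ?l2 T) = dim (L1 \<inter> L2)"
      using dim_image_eq[OF linear_blinfun, of "\<psi> T"] inj by (metis inj_on_subset subset_UNIV)
    moreover have "dim (?l1 T) = n" using lagrangian_dim[OF lagl(1)[OF TT]] dimV by simp
    ultimately show ?thesis using triple_index_le[OF lagl(1)[OF TT] lagl(2)[OF TT] lag(3)] by simp
  qed
  ultimately have "M2 T - M2 0 \<le> M1 T - M1 0" using h2 by linarith
  then show ?thesis using i1 i2 lower by simp
qed

end
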